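(* Let $M$ be a $(2n+1)$-dimensional smooth manifold with a contact structure $\xi$. There is an isomorphism of $\mathrm{CVect}(M)$-modules $$\mathrm{TVect}(M)\cong \Omega^2_0(M)\otimes \mathcal{F}_{-\frac{2}{n+1}}(M),$$ where the tensor product is defined over $C^\infty(M)$, $\mathrm{CVect}(M)$ acts on $\mathrm{TVect}(M)$ by the Lie bracket, and $\mathrm{CVect}(M)$ acts on the right-hand side by the Lie derivative.
   Context: A contact structure $\xi$ on a $(2n+1)$-dimensional smooth manifold $M$ ($n\ge 1$) is a codimension 1 distribution which is completely non-integrable: locally $\xi=\ker\alpha$ for a real 1-form $\alpha$ (a contact form, defined up to multiplication by a nonvanishing function) with $\alpha\wedge(d\alpha)^n\neq 0$ everywhere. All vector fields, functions, forms and densities below are smooth with complex coefficients; $C^\infty(M)$ denotes complex-valued smooth functions. $\mathrm{CVect}(M)$ is the Lie algebra of contact vector fields, i.e. of vector fields $X$ with $L_X\alpha=f_X\alpha$ for some function $f_X$, for every (local) contact form $\alpha$. $\mathrm{TVect}(M)$ is the space of vector fields tangent to $\xi$ (i.e. $\alpha(X)=0$ for every local contact form); the bracket of a contact vector field with a tangent one is tangent, so $\mathrm{TVect}(M)$ is a $\mathrm{CVect}(M)$-module. $\Omega^2_0(M)$ is the space of 2-forms on $M$ vanishing on the contact distribution $\xi$, i.e. those locally of the form $\omega=\alpha\wedge\beta$ with $\alpha$ a contact form and $\beta$ an arbitrary 1-form. For $\lambda\in\mathbb{R}$, $\mathcal{F}_\lambda(M)$ is the space of (complex-valued) tensor densities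 of degree $\lambda$ on $M$: sections of the line bundle $(\wedge^{2n+1}T^*_{\mathbb{C}}M)^{\lambda}$, where the real power is understood as the complexification of the real $\lambda$-density bundle. Locally, given a volume form $\Omega$, a $\lambda$-density is written $f\,\Omega^\lambda$ with $f$ a function (here $\Omega^\lambda$ means $|\Omega|^\lambda$), and the Lie derivative is $L_X(f\Omega^\lambda)=\bigl(X(f)+\lambda\,\mathrm{div}_\Omega(X)\,f\bigr)\Omega^\lambda$, where $L_X\Omega=\mathrm{div}_\Omega(X)\,\Omega$. On a tensor product over $C^\infty(M)$, $L_X$ acts by the Leibniz rule. *)

theory Defs
  imports "HOL-Algebra.Module" "HOL-Algebra.Free_Abelian_Groups"
    "HOL-Analysis.Analysis"
begin

section \<open>Smooth maps between Euclidean spaces\<close>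

text \<open>Only used for open sets \<open>S\<close>, where \<open>at x\<close> involves no choice.\<close>

primrec Ck_on :: "nat \<Rightarrow> 'a::real_normed_vector set \<Rightarrow> ('a \<Rightarrow> 'b::real_normed_vector) \<Rightarrow> bool" where
  "Ck_on 0 S f \<longleftrightarrow> continuous_on S f"
| "Ck_on (Suc k) S f \<longleftrightarrow> (\<forall>x\<in>S. f differentiable (at x)) \<and>
     (\<forall>v. Ck_on k S (\<lambda>x. frechet_derivative f (at x) v))"

definition smooth_on :: "'a::real_normed_vector set \<Rightarrow> ('a \<Rightarrow> 'b::real_normed_vector) \<Rightarrow> bool" where
  "smooth_on S f \<longleftrightarrow> (\<forall>k. Ck_on k S f)"

definition pd :: "'d::finite \<Rightarrow> (real^'d \<Rightarrow> complex) \<Rightarrow> real^'d \<Rightarrow> complex" where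
  "pd i f x = frechet_derivative f (at x) (axis i 1)"


section \<open>Smooth manifolds\<close>

text \<open>
  The manifold \<open>M\<close> is the whole of a Hausdorff, second countable type \<open>'m\<close>, with a smooth atlas of
  charts into \<open>real^'d\<close>; its dimension is \<open>CARD('d)\<close>. A chart is a domain together with a coordinate
  map, whose values off the domain are irrelevant.
\<close>

type_synonym ('m, 'd) chart = "'m set \<times> ('m \<Rightarrow> real^'d)"

abbreviation dom_of :: "('m, 'd) chart \<Rightarrow> 'm set" where "dom_of c \<equiv> fst c"
abbreviation crd :: "('m, 'd) chart \<Rightarrow> 'm \<Rightarrow> real^'d" where "crd c \<equiv> snd c"
abbreviation img_of :: "('m, 'd) chart \<Rightarrow> (real^'d) set" where "img_of c \<equiv> crd c ` dom_of c"
abbreviation icrd :: "('m, 'd) chart \<Rightarrow> real^'d \<Rightarrow> 'm" where "icrd c \<equiv> inv_into (dom_of c) (crd c)"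

definition smooth_atlas ::
  "('m::{t2_space,second_countable_topology}, 'd::finite) chart set \<Rightarrow> bool" where
  "smooth_atlas A \<longleftrightarrow>
     (\<Union>c\<in>A. dom_of c) = UNIV \<and>
     (\<forall>c\<in>A. open (dom_of c) \<and> open (img_of c) \<and>
        homeomorphism (dom_of c) (img_of c) (crd c) (icrd c)) \<and>
     (\<forall>c\<in>A. \<forall>c'\<in>A. smooth_on (crd c ` (dom_of c \<inter> dom_of c')) (crd c' \<circ> icrd c))"

text \<open>The Jacobian matrix at \<open>p\<close> of the coordinate change from \<open>c\<close> to \<open>c'\<close>.\<close>

definition jac :: "('m, 'd::finite) chart \<Rightarrow> ('m, 'd) chart \<Rightarrow> 'm \<Rightarrow> real^'d^'d" where
  "jac c c' p = matrix (frechet_derivative (crd c' \<circ> icrd c) (at (crd c p)))"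

abbreviation cmat :: "real^'d^'e \<Rightarrow> complex^'d^'e" where
  "cmat J \<equiv> map_matrix complex_of_real J"

definition smooth_fun_on ::
  "('m, 'd::finite) chart set \<Rightarrow> 'm set \<Rightarrow> ('m \<Rightarrow> complex) \<Rightarrow> bool" where
  "smooth_fun_on A U f \<longleftrightarrow> (\<forall>c\<in>A. smooth_on (crd c ` (dom_of c \<inter> U)) (f \<circ> icrd c))"

definition smooth_functions :: "('m, 'd::finite) chart set \<Rightarrow> ('m \<Rightarrow> complex) ring" where
  "smooth_functions A = \<lparr>carrier = {f. smooth_fun_on A UNIV f},
     monoid.mult = (\<lambda>f g p. f p * g p), one = (\<lambda>_. 1), ring.zero = (\<lambda>_. 0), add = (\<lambda>f g p. f p + g p)\<rparr>"


section \<open>Tensor fields\<close>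

text \<open>
  A tensor field is given by its components in each chart, as functions of the coordinates, subject
  to a transformation law. The law is a relation \<open>T J s s'\<close> between components \<open>s\<close>, \<open>s'\<close> at the same
  point in two charts, \<open>J\<close> being the Jacobian of the change from the first chart to the second.
  For global fields the components are set to 0 wherever they are meaningless (off the image of
  the chart, and for charts not in the atlas), so that equality of fields is equality in HOL.
\<close>

type_synonym ('m, 'd, 't) field = "('m, 'd) chart \<Rightarrow> real^'d \<Rightarrow> 't"

definition field_on :: "('m::topological_space, 'd::finite) chart set \<Rightarrow> 'm set \<Rightarrow>
    (real^'d^'d \<Rightarrow> 't \<Rightarrow> 't \<Rightarrow> bool) \<Rightarrow> ('m, 'd, 't::real_normed_vector) field \<Rightarrow> bool" where
  "field_on A U T s \<longleftrightarrow>
     (\<forall>c\<in>A. smooth_on (crd c ` (dom_of c \<inter> U)) (s c)) \<and>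
     (\<forall>c\<in>A. \<forall>c'\<in>A. \<forall>p \<in> dom_of c \<inter> dom_of c' \<inter> U.
        T (jac c c' p) (s c (crd c p)) (s c' (crd c' p)))"

definition fields :: "('m::topological_space, 'd::finite) chart set \<Rightarrow>
    (real^'d^'d \<Rightarrow> 't \<Rightarrow> 't \<Rightarrow> bool) \<Rightarrow> ('m, 'd, 't::real_normed_vector) field set" where
  "fields A T = {s. field_on A UNIV T s \<and> (\<forall>c x. c \<notin> A \<or> x \<notin> img_of c \<longrightarrow> s c x = 0)}"

definition vec_law :: "real^'d^'d \<Rightarrow> complex^'d::finite \<Rightarrow> complex^'d \<Rightarrow> bool" where
  "vec_law J u u' \<longleftrightarrow> u' = cmat J *v u"

definition covec_law :: "real^'d^'d \<Rightarrow> complex^'d::finite \<Rightarrow> complex^'d \<Rightarrow> bool" where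
  "covec_law J a a' \<longleftrightarrow> a = a' v* cmat J"

definition bilin_law :: "real^'d^'d \<Rightarrow> complex^'d^'d::finite \<Rightarrow> complex^'d^'d \<Rightarrow> bool" where
  "bilin_law J w w' \<longleftrightarrow> w = Finite_Cartesian_Product.transpose (cmat J) ** w' ** cmat J"

text \<open>\<open>f |dx|\<^sup>\<lambda> = f' |dx'|\<^sup>\<lambda>\<close> where \<open>|dx'| = |det J| |dx|\<close>.\<close>

definition density_law :: "real \<Rightarrow> real^'d^'d::finite \<Rightarrow> complex \<Rightarrow> complex \<Rightarrow> bool" where
  "density_law l J f f' \<longleftrightarrow> f = complex_of_real (\<bar>det J\<bar> powr l) * f'"

definition vector_fields ::
  "('m::topological_space, 'd::finite) chart set \<Rightarrow> ('m, 'd, complex^'d) field set" where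
  "vector_fields A = fields A vec_law"

definition two_forms ::
  "('m::topological_space, 'd::finite) chart set \<Rightarrow> ('m, 'd, complex^'d^'d) field set" where
  "two_forms A = {w \<in> fields A bilin_law. \<forall>c x i j. w c x $ i $ j = - w c x $ j $ i}"

definition densities ::
  "('m::topological_space, 'd::finite) chart set \<Rightarrow> real \<Rightarrow> ('m, 'd, complex) field set" where
  "densities A l = fields A (density_law l)"


section \<open>Exterior and Lie derivatives in coordinates\<close>

definition ext_d :: "(real^'d \<Rightarrow> complex^'d) \<Rightarrow> real^'d \<Rightarrow> complex^'d^'d::finite" where
  "ext_d a x = (\<chi> i j. pd i (\<lambda>y. a y $ j) x - pd j (\<lambda>y. a y $ i) x)"

definition dir_deriv :: "(real^'d \<Rightarrow> complex^'d) \<Rightarrow> (real^'d::finite \<Rightarrow> complex) \<Rightarrow> real^'d \<Rightarrow> complex" where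
  "dir_deriv X f x = (\<Sum>i\<in>UNIV. X x $ i * pd i f x)"

definition lie_vec :: "('m, 'd, complex^'d) field \<Rightarrow> ('m, 'd, complex^'d::finite) field
    \<Rightarrow> ('m, 'd, complex^'d) field" where
  "lie_vec X Y c x = (\<chi> k. dir_deriv (X c) (\<lambda>y. Y c y $ k) x - dir_deriv (Y c) (\<lambda>y. X c y $ k) x)"

definition lie_one_form :: "('m, 'd, complex^'d) field \<Rightarrow> ('m, 'd, complex^'d::finite) field
    \<Rightarrow> ('m, 'd, complex^'d) field" where
  "lie_one_form X a c x = (\<chi> j. dir_deriv (X c) (\<lambda>y. a c y $ j) x
      + (\<Sum>k\<in>UNIV. a c x $ k * pd j (\<lambda>y. X c y $ k) x))"

definition lie_two_form :: "('m, 'd, complex^'d) field \<Rightarrow> ('m, 'd, complex^'d^'d::finite) field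
    \<Rightarrow> ('m, 'd, complex^'d^'d) field" where
  "lie_two_form X w c x = (\<chi> i j. dir_deriv (X c) (\<lambda>y. w c y $ i $ j) x
      + (\<Sum>k\<in>UNIV. w c x $ k $ j * pd i (\<lambda>y. X c y $ k) x)
      + (\<Sum>k\<in>UNIV. w c x $ i $ k * pd j (\<lambda>y. X c y $ k) x))"

text \<open>The reference volume form in a chart is the coordinate one, whose divergence is the usual one.\<close>

definition lie_density :: "real \<Rightarrow> ('m, 'd, complex^'d) field \<Rightarrow> ('m, 'd::finite, complex) field
    \<Rightarrow> ('m, 'd, complex) field" where
  "lie_density l X f c x = dir_deriv (X c) (f c) x
      + complex_of_real l * (\<Sum>i\<in>UNIV. pd i (\<lambda>y. X c y $ i) x) * f c x"


section \<open>Exterior products at a point\<close>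

text \<open>
  A \<open>k\<close>-form on a vector space is a function of a sequence of vectors that depends only on the
  entries \<open>0, \<dots>, k - 1\<close>.
\<close>

definition wedge :: "nat \<Rightarrow> nat \<Rightarrow> ((nat \<Rightarrow> 'v) \<Rightarrow> complex) \<Rightarrow> ((nat \<Rightarrow> 'v) \<Rightarrow> complex)
    \<Rightarrow> (nat \<Rightarrow> 'v) \<Rightarrow> complex" where
  "wedge k l a b v =
     (\<Sum>p | p permutes {..<k+l}. of_int (sign p) * a (\<lambda>i. v (p i)) * b (\<lambda>i. v (p (k + i))))
       / (fact k * fact l)"

primrec wedge_power :: "((nat \<Rightarrow> 'v) \<Rightarrow> complex) \<Rightarrow> nat \<Rightarrow> (nat \<Rightarrow> 'v) \<Rightarrow> complex"
  where
  "wedge_power w 0 = (\<lambda>v. 1)"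
| "wedge_power w (Suc m) = wedge 2 (2 * m) w (wedge_power w m)"

text \<open>Covectors and skew matrices as forms on complexified tangent vectors.\<close>

definition covec_form :: "complex^'d \<Rightarrow> (nat \<Rightarrow> complex^'d::finite) \<Rightarrow> complex" where
  "covec_form a v = (\<Sum>i\<in>UNIV. a $ i * v 0 $ i)"

definition bilin_form :: "complex^'d^'d \<Rightarrow> (nat \<Rightarrow> complex^'d::finite) \<Rightarrow> complex" where
  "bilin_form w v = (\<Sum>i\<in>UNIV. \<Sum>j\<in>UNIV. w $ i $ j * v 0 $ i * v 1 $ j)"

abbreviation cvec :: "real^'d \<Rightarrow> complex^'d" where
  "cvec u \<equiv> \<chi> i. complex_of_real (u $ i)"


section \<open>Contact structures\<close>

text \<open>A (real) codimension 1 distribution, given by hyperplanes in coordinates; its smoothness is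
  part of the existence of local contact forms below.\<close>

definition hyperplane_field ::
  "('m, 'd::finite) chart set \<Rightarrow> ('m, 'd, (real^'d) set) field \<Rightarrow> bool" where
  "hyperplane_field A \<xi> \<longleftrightarrow>
     (\<forall>c\<in>A. \<forall>x\<in>img_of c. subspace (\<xi> c x) \<and> dim (\<xi> c x) + 1 = CARD('d)) \<and>
     (\<forall>c\<in>A. \<forall>c'\<in>A. \<forall>p \<in> dom_of c \<inter> dom_of c'.
        \<xi> c' (crd c' p) = (\<lambda>u. jac c c' p *v u) ` \<xi> c (crd c p))"

text \<open>\<open>\<alpha>\<close> is a contact form for \<open>\<xi>\<close> on the open set \<open>U\<close>: a real 1-form with kernel \<open>\<xi>\<close> and
  \<open>\<alpha> \<and> (d\<alpha>)\<^sup>n \<noteq> 0\<close> everywhere. Its components are stored as complex vectors with real entries.\<close>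

definition contact_form_on :: "('m::topological_space, 'd::finite) chart set \<Rightarrow> nat \<Rightarrow>
    ('m, 'd, (real^'d) set) field \<Rightarrow> 'm set \<Rightarrow> ('m, 'd, complex^'d) field \<Rightarrow> bool" where
  "contact_form_on A n \<xi> U \<alpha> \<longleftrightarrow> open U \<and> field_on A U covec_law \<alpha> \<and>
     (\<forall>c\<in>A. \<forall>x \<in> crd c ` (dom_of c \<inter> U).
        (\<forall>i. \<alpha> c x $ i \<in> \<real>) \<and>
        \<xi> c x = {u. covec_form (\<alpha> c x) (\<lambda>_. cvec u) = 0} \<and>
        (\<exists>v. wedge 1 (2 * n) (covec_form (\<alpha> c x))
               (wedge_power (bilin_form (ext_d (\<alpha> c) x)) n) v \<noteq> 0))"

definition contact_structure :: "('m::topological_space, 'd::finite) chart set \<Rightarrow> nat \<Rightarrow>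
    ('m, 'd, (real^'d) set) field \<Rightarrow> bool" where
  "contact_structure A n \<xi> \<longleftrightarrow> hyperplane_field A \<xi> \<and>
     (\<forall>p. \<exists>U \<alpha>. p \<in> U \<and> contact_form_on A n \<xi> U \<alpha>)"

definition CVect :: "('m::topological_space, 'd::finite) chart set \<Rightarrow> nat \<Rightarrow>
    ('m, 'd, (real^'d) set) field \<Rightarrow> ('m, 'd, complex^'d) field set" where
  "CVect A n \<xi> = {X \<in> vector_fields A. \<forall>U \<alpha>. contact_form_on A n \<xi> U \<alpha> \<longrightarrow>
     (\<exists>f. smooth_fun_on A U f \<and>
        (\<forall>c\<in>A. \<forall>p \<in> dom_of c \<inter> U.
           lie_one_form X \<alpha> c (crd c p) = f p *s \<alpha> c (crd c p)))}"

text \<open>The fields \<open>monoid.mult\<close> and \<open>one\<close> inherited from rings play no role in a module record.\<close>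

definition TVect :: "('m::topological_space, 'd::finite) chart set \<Rightarrow> nat \<Rightarrow>
    ('m, 'd, (real^'d) set) field \<Rightarrow> ('m \<Rightarrow> complex, ('m, 'd, complex^'d) field) module" where
  "TVect A n \<xi> = \<lparr>carrier = {X \<in> vector_fields A. \<forall>U \<alpha>. contact_form_on A n \<xi> U \<alpha> \<longrightarrow>
       (\<forall>c\<in>A. \<forall>x \<in> crd c ` (dom_of c \<inter> U). covec_form (\<alpha> c x) (\<lambda>_. X c x) = 0)},
     monoid.mult = undefined, one = undefined,
     ring.zero = (\<lambda>c x. 0), add = (\<lambda>X Y c x. X c x + Y c x),
     module.smult = (\<lambda>f X c x. f (icrd c x) *s X c x)\<rparr>"

definition Omega20 :: "('m::topological_space, 'd::finite) chart set \<Rightarrow>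
    ('m, 'd, (real^'d) set) field \<Rightarrow> ('m \<Rightarrow> complex, ('m, 'd, complex^'d^'d) field) module" where
  "Omega20 A \<xi> = \<lparr>carrier = {w \<in> two_forms A. \<forall>c\<in>A. \<forall>x\<in>img_of c. \<forall>u\<in>\<xi> c x. \<forall>v\<in>\<xi> c x.
       bilin_form (w c x) (\<lambda>i. if i = 0 then cvec u else cvec v) = 0},
     monoid.mult = undefined, one = undefined,
     ring.zero = (\<lambda>c x. 0), add = (\<lambda>w w' c x. w c x + w' c x),
     module.smult = (\<lambda>f w c x. \<chi> i j. f (icrd c x) * w c x $ i $ j)\<rparr>"

definition Density :: "('m::topological_space, 'd::finite) chart set \<Rightarrow> real \<Rightarrow>
    ('m \<Rightarrow> complex, ('m, 'd, complex) field) module" where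
  "Density A l = \<lparr>carrier = densities A l,
     monoid.mult = undefined, one = undefined,
     ring.zero = (\<lambda>c x. 0), add = (\<lambda>f g c x. f c x + g c x),
     module.smult = (\<lambda>h f c x. h (icrd c x) * f c x)\<rparr>"


section \<open>Tensor products of modules\<close>

text \<open>The free abelian group on pairs, modulo the bilinearity relations over \<open>R\<close>.\<close>

definition tensor_relators :: "('r, 'k) ring_scheme \<Rightarrow> ('r, 'a, 'p) module_scheme \<Rightarrow>
    ('r, 'b, 'q) module_scheme \<Rightarrow> ('a \<times> 'b \<Rightarrow>\<^sub>0 int) set" where
  "tensor_relators R M N =
     {frag_of (x \<oplus>\<^bsub>M\<^esub> x', y) - frag_of (x, y) - frag_of (x', y) | x x' y.
        x \<in> carrier M \<and> x' \<in> carrier M \<and> y \<in> carrier N} \<union>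
     {frag_of (x, y \<oplus>\<^bsub>N\<^esub> y') - frag_of (x, y) - frag_of (x, y') | x y y'.
        x \<in> carrier M \<and> y \<in> carrier N \<and> y' \<in> carrier N} \<union>
     {frag_of (r \<odot>\<^bsub>M\<^esub> x, y) - frag_of (x, r \<odot>\<^bsub>N\<^esub> y) | r x y.
        r \<in> carrier R \<and> x \<in> carrier M \<and> y \<in> carrier N}"

definition tensor_free :: "('r, 'a, 'p) module_scheme \<Rightarrow> ('r, 'b, 'q) module_scheme \<Rightarrow>
    ('a \<times> 'b \<Rightarrow>\<^sub>0 int) monoid" where
  "tensor_free M N = free_Abelian_group (carrier M \<times> carrier N)"

definition tensor_kernel :: "('r, 'k) ring_scheme \<Rightarrow> ('r, 'a, 'p) module_scheme \<Rightarrow>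
    ('r, 'b, 'q) module_scheme \<Rightarrow> ('a \<times> 'b \<Rightarrow>\<^sub>0 int) set" where
  "tensor_kernel R M N = generate (tensor_free M N) (tensor_relators R M N)"

text \<open>The map induced on the quotient by the additive extension of \<open>e\<close> to the free group. The union
  is a coset only if the result does not depend on the representative.\<close>

definition tensor_lift :: "('r, 'k) ring_scheme \<Rightarrow> ('r, 'a, 'p) module_scheme \<Rightarrow>
    ('r, 'b, 'q) module_scheme \<Rightarrow> ('a \<times> 'b \<Rightarrow> 'a \<times> 'b \<Rightarrow>\<^sub>0 int) \<Rightarrow>
    ('a \<times> 'b \<Rightarrow>\<^sub>0 int) set \<Rightarrow> ('a \<times> 'b \<Rightarrow>\<^sub>0 int) set" where
  "tensor_lift R M N e C =
     (\<Union>z\<in>C. tensor_kernel R M N #>\<^bsub>tensor_free M N\<^esub> frag_extend e z)"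

definition tensor_product :: "('r, 'k) ring_scheme \<Rightarrow> ('r, 'a, 'p) module_scheme \<Rightarrow>
    ('r, 'b, 'q) module_scheme \<Rightarrow> ('r, ('a \<times> 'b \<Rightarrow>\<^sub>0 int) set) module" where
  "tensor_product R M N =
     (let Q = tensor_free M N Mod tensor_kernel R M N in
      \<lparr>carrier = carrier Q, monoid.mult = undefined, one = undefined,
       ring.zero = one Q, add = monoid.mult Q,
       module.smult = (\<lambda>r. tensor_lift R M N (\<lambda>(x, y). frag_of (r \<odot>\<^bsub>M\<^esub> x, y)))\<rparr>)"

text \<open>The Leibniz rule for operators \<open>D\<close> on \<open>M\<close> and \<open>E\<close> on \<open>N\<close>.\<close>

definition tensor_leibniz :: "('r, 'k) ring_scheme \<Rightarrow> ('r, 'a, 'p) module_scheme \<Rightarrow>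
    ('r, 'b, 'q) module_scheme \<Rightarrow> ('a \<Rightarrow> 'a) \<Rightarrow> ('b \<Rightarrow> 'b) \<Rightarrow>
    ('a \<times> 'b \<Rightarrow>\<^sub>0 int) set \<Rightarrow> ('a \<times> 'b \<Rightarrow>\<^sub>0 int) set" where
  "tensor_leibniz R M N D E =
     tensor_lift R M N (\<lambda>(x, y). frag_of (D x, y) + frag_of (x, E y))"


section \<open>Isomorphisms of modules over a Lie algebra of vector fields\<close>

text \<open>Both \<open>V\<close> and \<open>W\<close> are modules over an algebra of complex-valued functions, and hence complex
  vector spaces through the constant functions. A Lie algebra module isomorphism is linear over the
  constants only.\<close>

definition lie_module_iso :: "'g set \<Rightarrow>
    ('m \<Rightarrow> complex, 'v, 'p) module_scheme \<Rightarrow> ('g \<Rightarrow> 'v \<Rightarrow> 'v) \<Rightarrow>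
    ('m \<Rightarrow> complex, 'w, 'q) module_scheme \<Rightarrow> ('g \<Rightarrow> 'w \<Rightarrow> 'w) \<Rightarrow> ('v \<Rightarrow> 'w) \<Rightarrow> bool" where
  "lie_module_iso L V act W act' \<Phi> \<longleftrightarrow>
     (\<forall>X\<in>L. \<forall>v\<in>carrier V. act X v \<in> carrier V) \<and>
     (\<forall>X\<in>L. \<forall>w\<in>carrier W. act' X w \<in> carrier W) \<and>
     bij_betw \<Phi> (carrier V) (carrier W) \<and>
     (\<forall>v\<in>carrier V. \<forall>v'\<in>carrier V. \<Phi> (v \<oplus>\<^bsub>V\<^esub> v') = \<Phi> v \<oplus>\<^bsub>W\<^esub> \<Phi> v') \<and>
     (\<forall>z. \<forall>v\<in>carrier V. \<Phi> ((\<lambda>_. z) \<odot>\<^bsub>V\<^esub> v) = (\<lambda>_. z) \<odot>\<^bsub>W\<^esub> \<Phi> v) \<and>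
     (\<forall>X\<in>L. \<forall>v\<in>carrier V. \<Phi> (act X v) = act' X (\<Phi> v))"

end

theory Submission
  imports Defs
begin

text \<open>
  For a local contact form \<open>\<alpha>\<close> with \<open>W = d\<alpha>\<close>, the isomorphism sends a tangent field \<open>Y\<close> to
  \<open>(\<alpha> \<and> i\<^sub>Y d\<alpha>) \<otimes> |\<alpha> \<and> (d\<alpha>)\<^sup>n|\<close> to the power \<open>- 2 / (n + 1)\<close>. Replacing \<open>\<alpha>\<close> by \<open>g\<alpha>\<close> multiplies the 2-form by
  \<open>g\<^sup>2\<close> and the volume form by \<open>g\<close> to the power \<open>n + 1\<close>, so nothing changes; if \<open>L\<^sub>X \<alpha> = f\<alpha>\<close>, then \<open>L\<^sub>X\<close> adds \<open>2f\<close>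
  on the first factor and \<open>- 2f\<close> on the second, which gives equivariance. Pointwise bijectivity is
  the nondegeneracy of \<open>d\<alpha>\<close> on \<open>\<xi>\<close>.

  The volume form enters only through \<open>det (W + \<alpha> \<otimes> \<alpha>)\<close>, which is its square up to a constant: this is a
  density of weight 2 whose behaviour under coordinate changes, rescaling and Lie derivatives follows
  from linear algebra and Jacobi's formula. The line bundle of densities is trivialized globally by a
  positive density \<open>\<mu>\<close>, so that tensoring with it is tensoring with a free module of rank one.
\<close>

section \<open>Smooth maps\<close>

text \<open>One obstacle is that neither a global contact form nor an orientation need exist, so
  everything built from \<alpha> must survive passing to g\<alpha> with g of either sign. This is
  why absolute powers appear and why the square of the volume is used: its scaling factor is an even
  power of g. For an odd-size skew W, det W = 0 and the adjugate of W is the tensor square of a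
  vector of Pfaffians; expanding in the rank-one term shows that det (W + \<alpha> \<otimes>
  \<alpha>) is the square of the coefficient of \<alpha> \<and> W^n up to a constant. Having weight
  2, it enters with exponent -1/(n+1), half of the degree in the theorem. The other obstacle is that
  an element of the tensor product is a coset in a free abelian group, not a field. With a generator
  \<mu>, every coset is the class of w \<otimes> \<mu> for a unique w, and X acts on w by L_X w +
  (L_X \<mu> / \<mu>) w. What remains are comparisons of 2-forms at a point of a chart.\<close>

lemma differentiable_eq_on_open:
  assumes "open S" "x \<in> S" "\<And>y. y \<in> S \<Longrightarrow> f y = g y" "f differentiable (at x)"
  shows "g differentiable (at x)" "frechet_derivative g (at x) = frechet_derivative f (at x)"
proof -
  have "(f has_derivative frechet_derivative f (at x)) (at x)"
    using assms(4) by (simp add: frechet_derivative_works)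
  then have "(g has_derivative frechet_derivative f (at x)) (at x)"
    using has_derivative_transform_within_open[OF _ assms(1,2)] assms(3) by metis
  then show "g differentiable (at x)" "frechet_derivative g (at x) = frechet_derivative f (at x)"
    by (auto simp: differentiable_def frechet_derivative_at[symmetric])
qed

lemma Ck_on_cong:
  assumes "open S" "\<And>x. x \<in> S \<Longrightarrow> f x = g x" "Ck_on k S f"
  shows "Ck_on k S g"
  using assms(2,3)
proof (induction k arbitrary: f g)
  case 0
  then show ?case by (auto cong: continuous_on_cong)
next
  case (Suc k)
  show ?case unfolding Ck_on.simps
  proof (intro conjI ballI allI)
    fix x assume x: "x \<in> S"
    show "g differentiable at x"
      using differentiable_eq_on_open(1)[OF assms(1) x, of f g] Suc.prems x by auto
  next
    fix v
    show "Ck_on k S (\<lambda>x. frechet_derivative g (at x) v)"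
    proof (rule Suc.IH)
      show "Ck_on k S (\<lambda>x. frechet_derivative f (at x) v)" using Suc.prems by auto
      show "frechet_derivative f (at x) v = frechet_derivative g (at x) v" if "x \<in> S" for x
        using differentiable_eq_on_open(2)[OF assms(1) that, of f g] Suc.prems that by auto
    qed
  qed
qed

lemma Ck_on_subset: "Ck_on k S f \<Longrightarrow> T \<subseteq> S \<Longrightarrow> Ck_on k T f"
  by (induction k arbitrary: f) (auto intro: continuous_on_subset)

lemma Ck_on_decr: "Ck_on (Suc k) S f \<Longrightarrow> Ck_on k S f"
proof (induction k arbitrary: f)
  case 0
  then show ?case
    by (auto intro!: continuous_at_imp_continuous_on differentiable_imp_continuous_within)
next
  case (Suc k)
  then show ?case by (metis Ck_on.simps(2))
qed

text \<open>\<open>Ck_on\<close> speaks of \<open>frechet_derivative\<close>, which is a choice.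
  Uniqueness of the derivative lets any explicit formula \<open>f'\<close> replace it; the inductive
  closure rules below start from here.\<close>

lemma Ck_on_SucI:
  assumes "open S" "\<And>x. x \<in> S \<Longrightarrow> (f has_derivative f' x) (at x)"
    and "\<And>v. Ck_on k S (\<lambda>x. f' x v)"
  shows "Ck_on (Suc k) S f"
  unfolding Ck_on.simps
proof (intro conjI ballI allI)
  show "f differentiable at x" if "x \<in> S" for x using assms(2)[OF that] by (auto simp: differentiable_def)
  show "Ck_on k S (\<lambda>x. frechet_derivative f (at x) v)" for v
    by (rule Ck_on_cong[OF assms(1) _ assms(3)[of v]]) (metis assms(2) frechet_derivative_at)
qed

lemma Ck_on_SucD:
  assumes "Ck_on (Suc k) S f" "x \<in> S"
  shows "(f has_derivative frechet_derivative f (at x)) (at x)"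
  using assms by (auto simp: frechet_derivative_works[symmetric])

lemma Ck_on_const: "open S \<Longrightarrow> Ck_on k S (\<lambda>x. c)"
proof (induction k arbitrary: c)
  case (Suc k)
  show ?case by (rule Ck_on_SucI[of S _ "\<lambda>_ _. 0"]) (auto simp: Suc)
qed auto

lemma Ck_on_bounded_linear:
  assumes "bounded_linear L" "open S" "Ck_on k S f"
  shows "Ck_on k S (\<lambda>x. L (f x))"
  using assms(3)
proof (induction k arbitrary: f)
  case 0
  then show ?case using bounded_linear.continuous_on[OF assms(1)] by simp
next
  case (Suc k)
  show ?case
    by (rule Ck_on_SucI[OF assms(2) bounded_linear.has_derivative[OF assms(1) Ck_on_SucD[OF Suc.prems]]])
      (use Suc in auto)
qed

lemma Ck_on_add:
  assumes "open S" "Ck_on k S f" "Ck_on k S g"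
  shows "Ck_on k S (\<lambda>x. f x + g x)"
  using assms(2,3)
proof (induction k arbitrary: f g)
  case (Suc k)
  show ?case
    by (rule Ck_on_SucI[OF assms(1) has_derivative_add[OF Ck_on_SucD[OF Suc.prems(1)] Ck_on_SucD[OF Suc.prems(2)]]])
      (use Suc in auto)
qed (auto intro: continuous_intros)

lemma Ck_on_sum:
  assumes "open S" "\<And>i. i \<in> I \<Longrightarrow> Ck_on k S (f i)"
  shows "Ck_on k S (\<lambda>x. \<Sum>i\<in>I. f i x)"
  using assms(2)
  by (induction I rule: infinite_finite_induct) (auto intro!: Ck_on_const Ck_on_add assms(1))

text \<open>The product rule leaves one factor undifferentiated; \<open>Ck_on_decr\<close> lowers
  its order to that of the differentiated factor, so that the induction hypothesis applies to both
  summands.\<close>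

lemma Ck_on_bilinear:
  assumes "bounded_bilinear pr" "open S" "Ck_on k S f" "Ck_on k S g"
  shows "Ck_on k S (\<lambda>x. pr (f x) (g x))"
  using assms(3,4)
proof (induction k arbitrary: f g)
  case 0
  then show ?case using bounded_bilinear.continuous_on[OF assms(1)] by auto
next
  case (Suc k)
  note D = bounded_bilinear.FDERIV[OF assms(1) Ck_on_SucD[OF Suc.prems(1)] Ck_on_SucD[OF Suc.prems(2)]]
  show ?case
    by (rule Ck_on_SucI[OF assms(2) D], assumption, assumption)
      (use Suc.prems Ck_on_decr[OF Suc.prems(1)] Ck_on_decr[OF Suc.prems(2)] Suc.IH
        in \<open>auto intro!: Ck_on_add[OF assms(2)]\<close>)
qed

text \<open>The hypothesis on f controls derivatives in fixed directions, whereas the chain rule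
  evaluates the derivative of f in a direction that moves with x. Expanding this direction in a
  basis gives a finite sum of products, each of class C^k; this is what the Euclidean codomain of
  \<phi> is for.\<close>

lemma Ck_on_compose:
  fixes \<phi> :: "'a::real_normed_vector \<Rightarrow> 'b::euclidean_space" and f :: "'b \<Rightarrow> 'c::real_normed_vector"
  assumes "open S" "\<phi> ` S \<subseteq> T" "Ck_on k T f" "Ck_on k S \<phi>"
  shows "Ck_on k S (\<lambda>x. f (\<phi> x))"
  using assms(3,4)
proof (induction k arbitrary: f)
  case 0
  then show ?case using assms(2) by (auto intro: continuous_on_compose2)
next
  case (Suc k)
  note df = Ck_on_SucD[OF Suc.prems(1)] and d\<phi> = Ck_on_SucD[OF Suc.prems(2)]
  have "Ck_on (Suc k) S (\<lambda>x. f (\<phi> x))"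
  proof (rule Ck_on_SucI[OF assms(1)])
    fix x assume x: "x \<in> S"
    then have T: "\<phi> x \<in> T" using assms(2) by auto
    have lin: "linear (frechet_derivative f (at (\<phi> x)))"
      using df[OF T] has_derivative_linear by blast
    have eq: "frechet_derivative f (at (\<phi> x)) w = (\<Sum>b\<in>Basis. (w \<bullet> b) *\<^sub>R frechet_derivative f (at (\<phi> x)) b)" for w
      by (subst euclidean_representation[of w, symmetric], subst linear_sum[OF lin])
        (simp add: linear_cmul[OF lin])
    show "((\<lambda>x. f (\<phi> x)) has_derivative (\<lambda>v. \<Sum>b\<in>Basis. (frechet_derivative \<phi> (at x) v \<bullet> b) *\<^sub>R
        frechet_derivative f (at (\<phi> x)) b)) (at x)"
      using has_derivative_compose[OF d\<phi>[OF x] df[OF T]] by (subst eq[symmetric])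
  next
    fix v
    show "Ck_on k S (\<lambda>x. \<Sum>b\<in>Basis. (frechet_derivative \<phi> (at x) v \<bullet> b) *\<^sub>R frechet_derivative f (at (\<phi> x)) b)"
      by (intro Ck_on_sum[OF assms(1)] Ck_on_bilinear[OF bounded_bilinear_scaleR assms(1)]
          Ck_on_bounded_linear[OF bounded_linear_inner_left assms(1)])
        (use Suc Ck_on_decr[OF Suc.prems(2)] in auto)
  qed
  then show ?case .
qed

lemma smooth_on_compose:
  fixes \<phi> :: "'a::real_normed_vector \<Rightarrow> 'b::euclidean_space" and f :: "'b \<Rightarrow> 'c::real_normed_vector"
  assumes "open S" "smooth_on T f" "smooth_on S \<phi>" "\<phi> ` S \<subseteq> T"
  shows "smooth_on S (\<lambda>x. f (\<phi> x))"
  using assms Ck_on_compose unfolding smooth_on_def by blast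

lemma smooth_on_cong:
  assumes "open S" "\<And>x. x \<in> S \<Longrightarrow> f x = g x" "smooth_on S f"
  shows "smooth_on S g"
  using assms Ck_on_cong unfolding smooth_on_def by metis

lemma smooth_on_subset: "smooth_on S f \<Longrightarrow> T \<subseteq> S \<Longrightarrow> smooth_on T f"
  by (auto simp: smooth_on_def intro: Ck_on_subset)

lemma smooth_on_const: "open S \<Longrightarrow> smooth_on S (\<lambda>x. c)"
  by (simp add: smooth_on_def Ck_on_const)

lemma smooth_on_add: "open S \<Longrightarrow> smooth_on S f \<Longrightarrow> smooth_on S g \<Longrightarrow> smooth_on S (\<lambda>x. f x + g x)"
  by (simp add: smooth_on_def Ck_on_add)

lemma smooth_on_sum: "open S \<Longrightarrow> (\<And>i. i \<in> I \<Longrightarrow> smooth_on S (f i)) \<Longrightarrow> smooth_on S (\<lambda>x. \<Sum>i\<in>I. f i x)"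
  by (simp add: smooth_on_def Ck_on_sum)

lemma smooth_on_bounded_linear:
  "bounded_linear L \<Longrightarrow> open S \<Longrightarrow> smooth_on S f \<Longrightarrow> smooth_on S (\<lambda>x. L (f x))"
  by (simp add: smooth_on_def Ck_on_bounded_linear)

lemma smooth_on_minus: "open S \<Longrightarrow> smooth_on S f \<Longrightarrow> smooth_on S (\<lambda>x. - f x)"
  using smooth_on_bounded_linear[OF bounded_linear_minus[OF bounded_linear_ident]] by blast

lemma smooth_on_diff: "open S \<Longrightarrow> smooth_on S f \<Longrightarrow> smooth_on S g \<Longrightarrow> smooth_on S (\<lambda>x. f x - g x)"
  using smooth_on_add[of S f "\<lambda>x. - g x"] smooth_on_minus by fastforce

lemma smooth_on_mult:
  fixes f g :: "'a::real_normed_vector \<Rightarrow> 'b::real_normed_algebra"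
  shows "open S \<Longrightarrow> smooth_on S f \<Longrightarrow> smooth_on S g \<Longrightarrow> smooth_on S (\<lambda>x. f x * g x)"
  by (simp add: smooth_on_def Ck_on_bilinear[OF bounded_bilinear_mult])

lemma smooth_on_prod:
  fixes f :: "'i \<Rightarrow> 'a::real_normed_vector \<Rightarrow> 'b::{real_normed_algebra, comm_ring_1}"
  shows "open S \<Longrightarrow> (\<And>i. i \<in> I \<Longrightarrow> smooth_on S (f i)) \<Longrightarrow> smooth_on S (\<lambda>x. \<Prod>i\<in>I. f i x)"
  by (induction I rule: infinite_finite_induct) (auto intro!: smooth_on_const smooth_on_mult)

text \<open>Derivatives are taken \<open>at x\<close> and not within S, so the condition is local.
  It serves functions whose formula changes from one neighbourhood to the next, such as bumps
  extended by 0.\<close>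

lemma smooth_on_local:
  assumes "\<And>x. x \<in> S \<Longrightarrow> \<exists>T. open T \<and> x \<in> T \<and> smooth_on T f"
  shows "smooth_on S f"
proof -
  have "Ck_on k S f" if "\<And>x. x \<in> S \<Longrightarrow> \<exists>T. open T \<and> x \<in> T \<and> Ck_on k T f" for k and f :: "'a \<Rightarrow> 'b"
    using that
  proof (induction k arbitrary: f)
    case 0
    show ?case unfolding Ck_on.simps
      by (intro continuous_at_imp_continuous_on ballI)
        (use 0 in \<open>metis Ck_on.simps(1) continuous_on_eq_continuous_at\<close>)
  next
    case (Suc k)
    show ?case unfolding Ck_on.simps
    proof (intro conjI ballI allI)
      show "f differentiable at x" if "x \<in> S" for x using Suc.prems[OF that] by auto
      show "Ck_on k S (\<lambda>x. frechet_derivative f (at x) v)" for v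
        by (rule Suc.IH) (use Suc.prems in \<open>metis Ck_on.simps(2)\<close>)
    qed
  qed
  then show ?thesis using assms unfolding smooth_on_def by meson
qed

section \<open>Inverses and absolute powers\<close>

lemma Ck_on_inverse:
  "Ck_on k (- {0}) (inverse :: 'a::real_normed_field \<Rightarrow> 'a)"
proof (induction k)
  case 0
  then show ?case by (auto intro!: continuous_intros)
next
  case (Suc k)
  have o: "open (- {0::'a})" by auto
  \<comment> \<open>The derivative of the inverse is a product of inverses, so the induction closes
    on itself.\<close>
  have "Ck_on k (- {0}) (\<lambda>x::'a. - (inverse x * v * inverse x))" for v
    by (rule Ck_on_bounded_linear[OF bounded_linear_minus[OF bounded_linear_ident] o
          Ck_on_bilinear[OF bounded_bilinear_mult o
            Ck_on_bilinear[OF bounded_bilinear_mult o Suc Ck_on_const[OF o]] Suc]])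
  then show ?case
    by (intro Ck_on_SucI[OF o, where f' = "\<lambda>x v. - (inverse x * v * inverse x)"] has_derivative_inverse') auto
qed

lemma smooth_on_inverse:
  fixes f :: "'a::real_normed_vector \<Rightarrow> 'b::{real_normed_field, euclidean_space}"
  assumes "open S" "smooth_on S f" "\<And>x. x \<in> S \<Longrightarrow> f x \<noteq> 0"
  shows "smooth_on S (\<lambda>x. inverse (f x))"
  by (rule smooth_on_compose[of S "- {0}" inverse, OF assms(1) _ assms(2)])
    (use assms(3) Ck_on_inverse in \<open>auto simp only: smooth_on_def ComplI singleton_iff\<close>)

lemma smooth_on_divide:
  fixes f g :: "'a::real_normed_vector \<Rightarrow> 'b::{real_normed_field, euclidean_space}"
  assumes "open S" "smooth_on S f" "smooth_on S g" "\<And>x. x \<in> S \<Longrightarrow> g x \<noteq> 0"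
  shows "smooth_on S (\<lambda>x. f x / g x)"
  unfolding divide_inverse using assms by (intro smooth_on_mult smooth_on_inverse)

lemma Ck_on_real_SucI:
  assumes "open S" "\<And>x. x \<in> S \<Longrightarrow> (f has_real_derivative f' x) (at x)" "Ck_on k S f'"
  shows "Ck_on (Suc k) S (f :: real \<Rightarrow> real)"
  by (rule Ck_on_SucI[OF assms(1), of _ "\<lambda>x v. f' x * v"])
    (use assms in \<open>auto simp: has_field_derivative_def intro!: Ck_on_bilinear[OF bounded_bilinear_mult] Ck_on_const\<close>)

lemma DERIV_transform_eventually:
  assumes "(f has_field_derivative d) (at x)" "\<forall>\<^sub>F y in nhds x. g y = f y"
  shows "(g has_field_derivative d) (at x)"
  using DERIV_cong_ev[OF refl assms(2) refl] assms(1) by blast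

text \<open>Writing the derivative with \<open>inverse x\<close> instead of the exponent
  \<open>l - 1\<close> carries the sign for negative x and keeps l fixed, as the induction for
  smoothness requires.\<close>

lemma DERIV_abs_powr:
  fixes x :: real assumes "x \<noteq> 0"
  shows "((\<lambda>x. \<bar>x\<bar> powr l) has_real_derivative l * \<bar>x\<bar> powr l * inverse x) (at x)"
proof -
  consider "x > 0" | "x < 0" using assms by linarith
  then show ?thesis
  proof cases
    case 1
    have "((\<lambda>x. x powr l) has_real_derivative l * \<bar>x\<bar> powr l * inverse x) (at x)"
      using has_real_derivative_powr[OF 1, of l] 1 by (simp add: powr_diff divide_inverse mult.assoc)
    moreover have "\<forall>\<^sub>F y in nhds x. \<bar>y\<bar> powr l = y powr l"
      using eventually_nhds_in_open[of "{0<..}" x] 1 by (auto elim!: eventually_mono)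
    ultimately show ?thesis by (rule DERIV_transform_eventually)
  next
    case 2
    have "((\<lambda>x. (- x) powr l) has_real_derivative (l * (- x) powr (l - 1)) * (- 1)) (at x)"
      by (rule DERIV_chain2[OF has_real_derivative_powr]) (use 2 in \<open>auto intro!: derivative_eq_intros\<close>)
    then have "((\<lambda>x. (- x) powr l) has_real_derivative l * \<bar>x\<bar> powr l * inverse x) (at x)"
      using 2 by (simp add: powr_diff divide_inverse mult.assoc)
    moreover have "\<forall>\<^sub>F y in nhds x. \<bar>y\<bar> powr l = (- y) powr l"
      using eventually_nhds_in_open[of "{..<0}" x] 2 by (auto elim!: eventually_mono)
    ultimately show ?thesis by (rule DERIV_transform_eventually)
  qed
qed

lemma smooth_on_abs_powr: "smooth_on (- {0}) (\<lambda>x::real. \<bar>x\<bar> powr l)"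
proof -
  have "Ck_on k (- {0}) (\<lambda>x::real. \<bar>x\<bar> powr l)" for k
  proof (induction k)
    case 0
    show ?case by (auto intro!: continuous_intros)
  next
    case (Suc k)
    show ?case
    proof (rule Ck_on_real_SucI[where f' = "\<lambda>x. l * \<bar>x\<bar> powr l * inverse x"])
      show o: "open (- {0::real})" by auto
      show "((\<lambda>x. \<bar>x\<bar> powr l) has_real_derivative l * \<bar>x\<bar> powr l * inverse x) (at x)"
        if "x \<in> - {0}" for x :: real
        by (rule DERIV_abs_powr) (use that in auto)
      show "Ck_on k (- {0}) (\<lambda>x::real. l * \<bar>x\<bar> powr l * inverse x)"
        by (rule Ck_on_bilinear[OF bounded_bilinear_mult o
              Ck_on_bilinear[OF bounded_bilinear_mult o Ck_on_const[OF o] Suc] Ck_on_inverse])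
    qed
  qed
  then show ?thesis unfolding smooth_on_def by blast
qed

text \<open>Up to linear combinations this family is closed under differentiation. The member m = 0
  is the usual flat function exp(-1/t), from which bumps are made.\<close>

definition flat_exp :: "nat \<Rightarrow> real \<Rightarrow> real" where
  "flat_exp m t = (if t > 0 then exp (- inverse t) * inverse t ^ m else 0)"

lemma flat_exp_nonneg: "flat_exp m t \<ge> 0"
  by (simp add: flat_exp_def)

lemma flat_exp_pos_iff: "flat_exp m t > 0 \<longleftrightarrow> t > 0"
  by (simp add: flat_exp_def)

text \<open>With y = 1/t the right-hand limit becomes that of y^m / e^y at infinity.\<close>

lemma flat_exp_tendsto: "((\<lambda>t. flat_exp m t) \<longlongrightarrow> 0) (at 0)"
proof -
  have 1: "((\<lambda>t::real. exp (- inverse t) * inverse t ^ m) \<longlongrightarrow> 0) (at_right 0)"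
  proof -
    have "((\<lambda>y::real. y ^ m / exp y) \<longlongrightarrow> 0) at_top" by (rule tendsto_power_div_exp_0)
    then have "((\<lambda>t::real. inverse t ^ m / exp (inverse t)) \<longlongrightarrow> 0) (at_right 0)"
      by (rule filterlim_compose) (rule filterlim_inverse_at_top_right)
    then show ?thesis by (simp add: exp_minus field_simps)
  qed
  have "(flat_exp m \<longlongrightarrow> 0) (at_right 0)"
    by (rule tendsto_cong[THEN iffD1, OF _ 1])
      (rule eventually_mono[OF eventually_at_right_less], simp add: flat_exp_def)
  moreover have "(flat_exp m \<longlongrightarrow> 0) (at_left 0)"
    by (rule tendsto_eventually, rule eventually_mono[OF eventually_at_left_real[of "-1" 0]])
      (auto simp: flat_exp_def)
  ultimately show ?thesis by (simp add: filterlim_split_at)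
qed

lemma DERIV_flat_exp:
  "(flat_exp m has_real_derivative flat_exp (m + 2) t - real m * flat_exp (m + 1) t) (at t)"
proof -
  consider "t > 0" | "t < 0" | "t = 0" by linarith
  then show ?thesis
  proof cases
    case 1
    have "((\<lambda>t. exp (- inverse t) * inverse t ^ m) has_real_derivative
        exp (- inverse t) * inverse t ^ 2 * inverse t ^ m
        + exp (- inverse t) * (real m * inverse t ^ (m - 1) * (- (inverse t ^ 2)))) (at t)"
      using 1 by (auto intro!: derivative_eq_intros simp: power2_eq_square)
    moreover have "exp (- inverse t) * inverse t ^ 2 * inverse t ^ m
        + exp (- inverse t) * (real m * inverse t ^ (m - 1) * (- (inverse t ^ 2)))
        = flat_exp (m + 2) t - real m * flat_exp (m + 1) t"
      using 1 by (cases m) (auto simp: flat_exp_def power2_eq_square algebra_simps)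
    moreover have "\<forall>\<^sub>F y in nhds t. flat_exp m y = exp (- inverse y) * inverse y ^ m"
      using eventually_nhds_in_open[of "{0<..}" t] 1 by (auto simp: flat_exp_def elim!: eventually_mono)
    ultimately show ?thesis using DERIV_transform_eventually by metis
  next
    case 2
    have "((\<lambda>t. 0) has_real_derivative 0) (at t)" by simp
    moreover have "\<forall>\<^sub>F y in nhds t. flat_exp m y = 0"
      using eventually_nhds_in_open[of "{..<0}" t] 2 by (auto simp: flat_exp_def elim!: eventually_mono)
    moreover have "flat_exp (m + 2) t - real m * flat_exp (m + 1) t = 0" using 2 by (simp add: flat_exp_def)
    ultimately show ?thesis using DERIV_transform_eventually by fastforce
  next
    case 3
    \<comment> \<open>The difference quotient at 0 is \<open>flat_exp (Suc m)\<close>, whose limit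
      is known.\<close>
    have "((\<lambda>h. (flat_exp m (0 + h) - flat_exp m 0) / h) \<longlongrightarrow> 0) (at 0)"
      by (rule tendsto_cong[THEN iffD1, OF _ flat_exp_tendsto[of "Suc m"]])
        (auto simp: flat_exp_def divide_inverse intro: always_eventually)
    then show ?thesis using 3 by (simp add: DERIV_def flat_exp_def)
  qed
qed

lemma smooth_on_flat_exp: "smooth_on UNIV (flat_exp m)"
proof -
  have "Ck_on k UNIV (flat_exp m)" for k
  proof (induction k arbitrary: m)
    case 0
    show ?case unfolding Ck_on.simps
      by (intro continuous_at_imp_continuous_on ballI DERIV_isCont[OF DERIV_flat_exp])
  next
    case (Suc k)
    have "Ck_on k UNIV (\<lambda>t. flat_exp (m + 2) t + - real m * flat_exp (m + 1) t)"
      by (rule Ck_on_add[OF open_UNIV Suc Ck_on_bilinear[OF bounded_bilinear_mult open_UNIV Ck_on_const[OF open_UNIV] Suc]])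
    then have "Ck_on k UNIV (\<lambda>t. flat_exp (m + 2) t - real m * flat_exp (m + 1) t)"
      by simp
    then show ?case
      using Ck_on_real_SucI[OF open_UNIV DERIV_flat_exp] by blast
  qed
  then show ?thesis unfolding smooth_on_def by blast
qed

section \<open>Partial derivatives\<close>

lemma frechet_derivative_bounded_linear:
  assumes "bounded_linear L" "f differentiable (at x)"
  shows "frechet_derivative (\<lambda>y. L (f y)) (at x) v = L (frechet_derivative f (at x) v)"
proof -
  have "((\<lambda>y. L (f y)) has_derivative (\<lambda>v. L (frechet_derivative f (at x) v))) (at x)"
    using bounded_linear.has_derivative[OF assms(1)] assms(2) by (simp add: frechet_derivative_works)
  from fun_cong[OF frechet_derivative_at[OF this], of v] show ?thesis by (rule sym)
qed

text \<open>Two applications of the mean value theorem, along u and then along v, turn the second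
  difference into h^2 times the mixed derivative at a nearby point; continuity of that derivative
  gives the limit. A one-sided limit is enough to compare the two orders of differentiation.\<close>

lemma second_difference_quotient:
  fixes f :: "'a::real_normed_vector \<Rightarrow> real" and u v :: 'a
  assumes S: "open S" "x \<in> S" and f: "Ck_on 2 S f"
  defines "\<Delta> \<equiv> \<lambda>h. f (x + h *\<^sub>R u + h *\<^sub>R v) - f (x + h *\<^sub>R u) - f (x + h *\<^sub>R v) + f x"
  shows "((\<lambda>h. \<Delta> h / h\<^sup>2) \<longlongrightarrow>
    frechet_derivative (\<lambda>y. frechet_derivative f (at y) u) (at x) v) (at_right 0)"
proof -
  define fu where "fu = (\<lambda>y. frechet_derivative f (at y) u)"
  define fuv where "fuv = (\<lambda>y. frechet_derivative fu (at y) v)"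
  have C: "Ck_on (Suc (Suc 0)) S f" using f by (simp only: numeral_2_eq_2)
  then have Cu: "Ck_on (Suc 0) S fu" and "continuous_on S fuv"
    by (auto simp: fu_def fuv_def)
  then have cont: "isCont fuv x" using S by (simp add: continuous_on_eq_continuous_at)
  obtain r where r: "r > 0" "ball x r \<subseteq> S" using S by (meson openE)
  have "((\<lambda>h. \<Delta> h / h\<^sup>2) \<longlongrightarrow> fuv x) (at_right 0)"
  proof (rule tendstoI)
    fix e :: real assume "e > 0"
    then obtain d where d: "d > 0" "\<And>y. dist y x < d \<Longrightarrow> dist (fuv y) (fuv x) < e"
      using cont unfolding continuous_at_eps_delta by meson
    \<comment> \<open>For h < \<rho> the whole parallelogram spanned by h u and h v lies in the ball
      inside S and in the ball where \<open>fuv\<close> varies by less than e. The summand 1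
      excludes a zero denominator.\<close>
    define \<rho> where "\<rho> = min r d / (norm u + norm v + 1)"
    have \<rho>: "\<rho> > 0" using r d by (simp add: \<rho>_def add_nonneg_pos)
    have near: "dist (x + s *\<^sub>R u + t *\<^sub>R v) x < min r d" if "0 \<le> s" "s \<le> h" "0 \<le> t" "t \<le> h" "h < \<rho>" for s t h
    proof -
      have "dist (x + s *\<^sub>R u + t *\<^sub>R v) x \<le> s * norm u + t * norm v"
        using that norm_triangle_ineq[of "s *\<^sub>R u" "t *\<^sub>R v"] by (simp add: dist_norm)
      also have "\<dots> \<le> h * norm u + h * norm v"
        using that by (intro add_mono mult_right_mono) auto
      also have "\<dots> \<le> h * (norm u + norm v + 1)" using that by (simp add: algebra_simps)
      also have "\<dots> < min r d" using that(5)
        by (simp only: \<rho>_def) (simp add: pos_less_divide_eq add_nonneg_pos)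
      finally show ?thesis .
    qed
    have "dist (\<Delta> h / h\<^sup>2) (fuv x) < e" if h: "0 < h" "h < \<rho>" for h
    proof -
      have in_S: "x + s *\<^sub>R u + t *\<^sub>R v \<in> S" if "0 \<le> s" "s \<le> h" "0 \<le> t" "t \<le> h" for s t
        using near[OF that h(2)] r(2) by (auto simp: dist_commute)
      have df: "((\<lambda>s. f (x + s *\<^sub>R u + t *\<^sub>R v)) has_real_derivative fu (x + s *\<^sub>R u + t *\<^sub>R v)) (at s)"
        if "0 \<le> s" "s \<le> h" "0 \<le> t" "t \<le> h" for s t
      proof -
        have "((\<lambda>s. x + s *\<^sub>R u + t *\<^sub>R v) has_derivative (\<lambda>s. s *\<^sub>R u)) (at s)"
          by (auto intro!: derivative_eq_intros)
        from has_derivative_compose[OF this Ck_on_SucD[OF C in_S[OF that]]]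
        show ?thesis
          using linear_cmul[OF has_derivative_linear[OF Ck_on_SucD[OF C in_S[OF that]]]]
          by (simp add: has_field_derivative_def fu_def mult_commute_abs)
      qed
      \<comment> \<open>The function of s is itself a difference in the direction v, so its
        increment over [0, h] is the second difference.\<close>
      have "\<exists>s>0. s < h \<and> \<Delta> h = h * (fu (x + s *\<^sub>R u + h *\<^sub>R v) - fu (x + s *\<^sub>R u + 0 *\<^sub>R v))"
      proof -
        have "\<exists>s>0. s < h \<and> (\<lambda>s. f (x + s *\<^sub>R u + h *\<^sub>R v) - f (x + s *\<^sub>R u + 0 *\<^sub>R v)) h
            - (\<lambda>s. f (x + s *\<^sub>R u + h *\<^sub>R v) - f (x + s *\<^sub>R u + 0 *\<^sub>R v)) 0
            = (h - 0) * (fu (x + s *\<^sub>R u + h *\<^sub>R v) - fu (x + s *\<^sub>R u + 0 *\<^sub>R v))"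
          by (rule MVT2[OF h(1)], rule DERIV_diff) (rule df; use h in simp)+
        then show ?thesis by (simp add: \<Delta>_def algebra_simps)
      qed
      then obtain s where s: "0 < s" "s < h"
        "\<Delta> h = h * (fu (x + s *\<^sub>R u + h *\<^sub>R v) - fu (x + s *\<^sub>R u + 0 *\<^sub>R v))" by blast
      have dfu: "((\<lambda>t. fu (x + s *\<^sub>R u + t *\<^sub>R v)) has_real_derivative fuv (x + s *\<^sub>R u + t *\<^sub>R v)) (at t)"
        if "0 \<le> t" "t \<le> h" for t
      proof -
        have i: "x + s *\<^sub>R u + t *\<^sub>R v \<in> S" using in_S that s by simp
        have "((\<lambda>t. x + s *\<^sub>R u + t *\<^sub>R v) has_derivative (\<lambda>t. t *\<^sub>R v)) (at t)"
          by (auto intro!: derivative_eq_intros)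
        from has_derivative_compose[OF this Ck_on_SucD[OF Cu i]]
        show ?thesis
          using linear_cmul[OF has_derivative_linear[OF Ck_on_SucD[OF Cu i]]]
          by (simp add: has_field_derivative_def fuv_def mult_commute_abs)
      qed
      have "\<exists>t>0. t < h \<and> fu (x + s *\<^sub>R u + h *\<^sub>R v) - fu (x + s *\<^sub>R u + 0 *\<^sub>R v) = (h - 0) * fuv (x + s *\<^sub>R u + t *\<^sub>R v)"
        by (rule MVT2[OF h(1)], rule dfu)
      then obtain t where t: "0 < t" "t < h"
        "fu (x + s *\<^sub>R u + h *\<^sub>R v) - fu (x + s *\<^sub>R u + 0 *\<^sub>R v) = h * fuv (x + s *\<^sub>R u + t *\<^sub>R v)" by auto
      have "\<Delta> h / h\<^sup>2 = fuv (x + s *\<^sub>R u + t *\<^sub>R v)"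
        using s(3) t(3) h(1) by (simp add: power2_eq_square)
      moreover have "dist (x + s *\<^sub>R u + t *\<^sub>R v) x < d" using near[of s h t] s t h by simp
      ultimately show ?thesis using d(2) by simp
    qed
    then show "\<forall>\<^sub>F h in at_right 0. dist (\<Delta> h / h\<^sup>2) (fuv x) < e"
      using \<rho> eventually_at_right[of 0 1] unfolding eventually_at_right_field by blast
  qed
  then show ?thesis by (simp add: fuv_def fu_def)
qed

text \<open>The second difference is symmetric in u and v, and limits are unique.\<close>

lemma symmetric_second_derivative_real:
  fixes f :: "'a::real_normed_vector \<Rightarrow> real"
  assumes "open S" "x \<in> S" "Ck_on 2 S f"
  shows "frechet_derivative (\<lambda>y. frechet_derivative f (at y) u) (at x) v
    = frechet_derivative (\<lambda>y. frechet_derivative f (at y) v) (at x) u"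
proof -
  have "((\<lambda>h. (f (x + h *\<^sub>R u + h *\<^sub>R v) - f (x + h *\<^sub>R u) - f (x + h *\<^sub>R v) + f x) / h\<^sup>2) \<longlongrightarrow>
    frechet_derivative (\<lambda>y. frechet_derivative f (at y) v) (at x) u) (at_right 0)"
    using second_difference_quotient[OF assms, of v u] by (simp add: algebra_simps)
  with second_difference_quotient[OF assms, of u v] show ?thesis
    using tendsto_unique trivial_limit_at_right_real by blast
qed

text \<open>The mean value theorem is real, so real and imaginary parts are treated separately;
  \<open>eq\<close> moves a real-linear map past both derivatives.\<close>

lemma symmetric_second_derivative:
  fixes f :: "'a::real_normed_vector \<Rightarrow> complex"
  assumes S: "open S" "x \<in> S" and f: "smooth_on S f"
  shows "frechet_derivative (\<lambda>y. frechet_derivative f (at y) u) (at x) v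
    = frechet_derivative (\<lambda>y. frechet_derivative f (at y) v) (at x) u"
proof -
  have C: "Ck_on (Suc (Suc 0)) S f" using f unfolding smooth_on_def by blast
  have eq: "L (frechet_derivative (\<lambda>y. frechet_derivative f (at y) u) (at x) v)
      = frechet_derivative (\<lambda>y. frechet_derivative (\<lambda>z. L (f z)) (at y) u) (at x) v"
    if L: "bounded_linear L" for L :: "complex \<Rightarrow> real" and u v
  proof -
    have "L (frechet_derivative (\<lambda>y. frechet_derivative f (at y) u) (at x) v)
        = frechet_derivative (\<lambda>y. L (frechet_derivative f (at y) u)) (at x) v"
      using C S by (intro frechet_derivative_bounded_linear[OF L, symmetric]) auto
    also have "\<dots> = frechet_derivative (\<lambda>y. frechet_derivative (\<lambda>z. L (f z)) (at y) u) (at x) v"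
    proof (rule arg_cong[of _ _ "\<lambda>F. F v"], rule differentiable_eq_on_open(2)[OF S, symmetric])
      fix y assume "y \<in> S"
      then show "L (frechet_derivative f (at y) u) = frechet_derivative (\<lambda>z. L (f z)) (at y) u"
        using C by (intro frechet_derivative_bounded_linear[OF L, symmetric]) auto
    next
      show "(\<lambda>y. L (frechet_derivative f (at y) u)) differentiable at x"
        using bounded_linear.has_derivative[OF L Ck_on_SucD[of 0 S "\<lambda>y. frechet_derivative f (at y) u"]] C S
        by (auto simp: differentiable_def)
    qed
    finally show ?thesis .
  qed
  have L: "Ck_on 2 S (\<lambda>z. L (f z))" if "bounded_linear L" for L :: "complex \<Rightarrow> real"
    using Ck_on_bounded_linear[OF that S(1) C] by (simp only: numeral_2_eq_2)
  show ?thesis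
    using symmetric_second_derivative_real[OF S L[OF bounded_linear_Re], of u v]
      symmetric_second_derivative_real[OF S L[OF bounded_linear_Im], of u v]
    unfolding eq[OF bounded_linear_Re, symmetric] eq[OF bounded_linear_Im, symmetric]
    by (rule complex_eqI)
qed

section \<open>Rules for complex partial derivatives\<close>

lemma pd_eqI: "(f has_derivative f') (at x) \<Longrightarrow> pd i f x = f' (axis i 1)"
  unfolding pd_def by (drule frechet_derivative_at) simp

lemma smooth_on_has_derivative:
  "smooth_on S f \<Longrightarrow> x \<in> S \<Longrightarrow> (f has_derivative frechet_derivative f (at x)) (at x)"
  using Ck_on_SucD unfolding smooth_on_def by blast

lemma smooth_on_imp_differentiable: "smooth_on S f \<Longrightarrow> x \<in> S \<Longrightarrow> f differentiable (at x)"
  using smooth_on_has_derivative differentiable_def by blast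

lemma smooth_on_pd: "smooth_on S f \<Longrightarrow> smooth_on S (pd i f)"
  unfolding smooth_on_def pd_def[abs_def] by (metis Ck_on.simps(2))

lemma pd_commute:
  assumes "open S" "x \<in> S" "smooth_on S f"
  shows "pd i (pd j f) x = pd j (pd i f) x"
  using symmetric_second_derivative[OF assms] unfolding pd_def[abs_def] by metis

lemma pd_cong:
  assumes "open S" "x \<in> S" "\<And>y. y \<in> S \<Longrightarrow> f y = g y" "f differentiable (at x)"
  shows "pd i f x = pd i g x"
  using differentiable_eq_on_open(2)[OF assms] by (simp add: pd_def)

lemma pd_const [simp]: "pd i (\<lambda>_. c) x = 0"
  by (simp add: pd_def)

lemma pd_add: "f differentiable (at x) \<Longrightarrow> g differentiable (at x) \<Longrightarrow>
    pd i (\<lambda>y. f y + g y) x = pd i f x + pd i g x"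
  by (subst pd_eqI[OF has_derivative_add]) (auto simp: frechet_derivative_works pd_def)

lemma pd_minus: "f differentiable (at x) \<Longrightarrow> pd i (\<lambda>y. - f y) x = - pd i f x"
  by (subst pd_eqI[OF has_derivative_minus]) (auto simp: frechet_derivative_works pd_def)

lemma pd_diff: "f differentiable (at x) \<Longrightarrow> g differentiable (at x) \<Longrightarrow>
    pd i (\<lambda>y. f y - g y) x = pd i f x - pd i g x"
  by (subst pd_eqI[OF has_derivative_diff]) (auto simp: frechet_derivative_works pd_def)

lemma pd_mult: "f differentiable (at x) \<Longrightarrow> g differentiable (at x) \<Longrightarrow>
    pd i (\<lambda>y. f y * g y) x = f x * pd i g x + pd i f x * g x"
  by (subst pd_eqI[OF has_derivative_mult]) (auto simp: frechet_derivative_works pd_def)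

lemma pd_sum: "(\<And>k. k \<in> K \<Longrightarrow> f k differentiable (at x)) \<Longrightarrow>
    pd i (\<lambda>y. \<Sum>k\<in>K. f k y) x = (\<Sum>k\<in>K. pd i (f k) x)"
  by (subst pd_eqI[OF has_derivative_sum, of K f "\<lambda>k. frechet_derivative (f k) (at x)"])
    (auto simp: frechet_derivative_works pd_def)

lemma frechet_derivative_eq_sum_pd:
  fixes f :: "real^'d::finite \<Rightarrow> complex"
  assumes "f differentiable (at x)"
  shows "frechet_derivative f (at x) v = (\<Sum>a\<in>UNIV. of_real (v $ a) * pd a f x)"
proof -
  have lin: "linear (frechet_derivative f (at x))" by (rule linear_frechet_derivative[OF assms])
  have "v = (\<Sum>a\<in>UNIV. v $ a *\<^sub>R axis a 1)"
    by (simp add: vec_eq_iff axis_def if_distrib sum.delta cong: if_cong)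
  then have "frechet_derivative f (at x) v = frechet_derivative f (at x) (\<Sum>a\<in>UNIV. v $ a *\<^sub>R axis a 1)"
    by (rule arg_cong)
  also have "\<dots> = (\<Sum>a\<in>UNIV. of_real (v $ a) * pd a f x)"
    by (simp add: linear_sum[OF lin] linear_cmul[OF lin] pd_def) (simp add: scaleR_conv_of_real)
  finally show ?thesis .
qed

text \<open>The Jacobian entries are expressed through \<open>pd\<close> of the complexified
  components of \<phi>, which puts them in the same calculus as the complex-valued fields.\<close>

lemma pd_chain:
  fixes f :: "real^'d::finite \<Rightarrow> complex" and \<phi> :: "real^'e::finite \<Rightarrow> real^'d"
  assumes "\<phi> differentiable (at x)" "f differentiable (at (\<phi> x))"
  shows "pd i (\<lambda>y. f (\<phi> y)) x = (\<Sum>a\<in>UNIV. pd a f (\<phi> x) * pd i (\<lambda>y. of_real (\<phi> y $ a)) x)"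
proof -
  have 1: "(\<phi> has_derivative frechet_derivative \<phi> (at x)) (at x)"
    "(f has_derivative frechet_derivative f (at (\<phi> x))) (at (\<phi> x))"
    using assms by (simp_all add: frechet_derivative_works)
  have 2: "pd i (\<lambda>y. of_real (\<phi> y $ a)) x = of_real (frechet_derivative \<phi> (at x) (axis i 1) $ a)" for a
    using pd_eqI[OF bounded_linear.has_derivative[OF bounded_linear_of_real
          bounded_linear.has_derivative[OF bounded_linear_vec_nth 1(1)]]] .
  show ?thesis unfolding 2 pd_eqI[OF has_derivative_compose[OF 1]]
    frechet_derivative_eq_sum_pd[OF assms(2)] by (simp add: mult.commute)
qed

lemma smooth_on_vec_nth: "open S \<Longrightarrow> smooth_on S f \<Longrightarrow> smooth_on S (\<lambda>x. f x $ i)"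
  by (rule smooth_on_bounded_linear[OF bounded_linear_vec_nth])

lemma bounded_linear_axis: "bounded_linear (axis i :: 'a::real_normed_vector \<Rightarrow> 'a^'n)"
proof (rule bounded_linear_intro[of _ 1])
  show "axis i (x + y) = axis i x + axis i y" for x y :: 'a by (simp add: vec_eq_iff axis_def)
  show "axis i (r *\<^sub>R x) = r *\<^sub>R axis i x" for r and x :: 'a by (simp add: vec_eq_iff axis_def)
  show "norm (axis i x :: 'a^'n) \<le> norm x * 1" for x :: 'a
  proof -
    have "(\<Sum>j\<in>UNIV. (norm (axis i x $ j :: 'a))\<^sup>2) = (\<Sum>j\<in>UNIV. if j = i then (norm x)\<^sup>2 else 0)"
      by (rule sum.cong) (auto simp: axis_def)
    then show ?thesis by (simp add: norm_vec_def L2_set_def)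
  qed
qed

lemma smooth_on_vec:
  fixes f :: "'a::real_normed_vector \<Rightarrow> 'b::real_normed_vector^'n"
  assumes "open S" "\<And>i. smooth_on S (\<lambda>x. f x $ i)"
  shows "smooth_on S f"
proof -
  have "f = (\<lambda>x. \<Sum>i\<in>UNIV. axis i (f x $ i))"
    by (auto simp: vec_eq_iff axis_def if_distrib sum.delta fun_eq_iff cong: if_cong)
  moreover have "smooth_on S (\<lambda>x. \<Sum>i\<in>UNIV. axis i (f x $ i))"
    by (intro smooth_on_sum smooth_on_bounded_linear[OF bounded_linear_axis] assms)
  ultimately show ?thesis by simp
qed

section \<open>Rank-one perturbations of skew matrices\<close>

text \<open>Bilinear and without conjugation, unlike the real inner product of complex vectors: this
  is how a covector evaluates a complexified tangent vector.\<close>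

definition cdot :: "'a::comm_semiring_1^'n::finite \<Rightarrow> 'a^'n \<Rightarrow> 'a" where
  "cdot a b = (\<Sum>i\<in>UNIV. a $ i * b $ i)"

definition outer :: "'a::times^'m \<Rightarrow> 'a^'n \<Rightarrow> 'a^'n^'m" where
  "outer a b = (\<chi> i j. a $ i * b $ j)"

definition mscale :: "'a::times \<Rightarrow> 'a^'n^'m \<Rightarrow> 'a^'n^'m" where
  "mscale c A = (\<chi> i j. c * A $ i $ j)"

lemma outer_nth [simp]: "outer a b $ i $ j = a $ i * b $ j"
  by (simp add: outer_def)

lemma mscale_nth [simp]: "mscale c A $ i $ j = c * A $ i $ j"
  by (simp add: mscale_def)

lemma cdot_commute: "cdot a b = cdot b a"
  by (simp add: cdot_def mult.commute)

lemma cdot_simps [simp]: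
  fixes a b c :: "'a::comm_ring_1^'n::finite"
  shows "cdot (a + b) c = cdot a c + cdot b c" "cdot a (b + c) = cdot a b + cdot a c"
    "cdot (a - b) c = cdot a c - cdot b c" "cdot a (b - c) = cdot a b - cdot a c"
    "cdot (- a) b = - cdot a b" "cdot a (- b) = - cdot a b"
    "cdot (k *s a) b = k * cdot a b" "cdot a (k *s b) = k * cdot a b"
    "cdot 0 a = 0" "cdot a 0 = 0"
  by (simp_all add: cdot_def algebra_simps sum.distrib sum_distrib_left sum_subtractf sum_negf)

lemma outer_mult_vec: "outer a b *v x = cdot b x *s (a :: 'a::comm_ring_1^'n::finite)"
  by (simp add: vec_eq_iff matrix_vector_mult_def cdot_def sum_distrib_left sum_distrib_right mult_ac)

lemma vec_mult_outer: "x v* outer a b = cdot x a *s (b :: 'a::comm_ring_1^'n::finite)"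
  by (simp add: vec_eq_iff vector_matrix_mult_def cdot_def sum_distrib_left sum_distrib_right mult_ac)

lemma mult_outer: "A ** outer a b = outer (A *v a) (b :: 'a::comm_ring_1^'n::finite)"
  by (simp add: vec_eq_iff matrix_matrix_mult_def matrix_vector_mult_def sum_distrib_left sum_distrib_right mult_ac)

lemma outer_mult: "outer a b ** A = outer (a :: 'a::comm_ring_1^'n::finite) (b v* A)"
  by (simp add: vec_eq_iff matrix_matrix_mult_def vector_matrix_mult_def sum_distrib_left sum_distrib_right mult_ac)

lemma matrix_rdistribs:
  fixes A B C :: "'a::comm_ring_1^'n^'n::finite"
  shows "(A + B) ** C = A ** C + B ** C" "(A - B) ** C = A ** C - B ** C"
  by (simp_all add: vec_eq_iff matrix_matrix_mult_def algebra_simps sum.distrib sum_subtractf)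

lemma mscale_mult: "mscale c A ** B = mscale c (A ** (B :: 'a::comm_ring_1^'n^'n::finite))"
  "A ** mscale c B = mscale c (A ** (B :: 'a::comm_ring_1^'n^'n::finite))"
  by (simp_all add: vec_eq_iff matrix_matrix_mult_def sum_distrib_left sum_distrib_right mult_ac)

lemma mscale_mult_vec: "mscale c A *v x = c *s (A *v (x :: 'a::comm_ring_1^'n::finite))"
  by (simp add: vec_eq_iff matrix_vector_mult_def sum_distrib_left sum_distrib_right mult_ac)

lemma mscale_eq_mat: "mscale c A = mat c ** (A :: 'a::comm_ring_1^'n^'n::finite)"
  by (simp add: vec_eq_iff matrix_matrix_mult_def mat_def if_distrib if_distribR cong: if_cong)

lemma det_mat: "det (mat c :: 'a::comm_ring_1^'n^'n::finite) = c ^ CARD('n)"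
  by (subst det_diagonal) (auto simp: mat_def)

lemma det_mscale: "det (mscale c A) = c ^ CARD('n) * det (A :: 'a::comm_ring_1^'n^'n::finite)"
  by (simp add: mscale_eq_mat det_mul det_mat)

lemma cdot_mult_vec: "cdot a (A *v b) = cdot (a v* A) (b :: 'a::comm_ring_1^'n::finite)"
proof -
  have "cdot a (A *v b) = (\<Sum>i\<in>UNIV. \<Sum>j\<in>UNIV. a $ i * A $ i $ j * b $ j)"
    by (simp add: cdot_def matrix_vector_mult_def sum_distrib_left sum_distrib_right mult_ac)
  also have "\<dots> = cdot (a v* A) b"
    by (subst sum.swap) (simp add: cdot_def vector_matrix_mult_def sum_distrib_left sum_distrib_right mult_ac)
  finally show ?thesis .
qed

lemma trace_outer: "trace (outer a b) = cdot a b"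
  by (simp add: trace_def cdot_def)

lemma trace_mscale: "trace (mscale c A) = c * trace (A :: 'a::comm_ring_1^'n^'n::finite)"
  by (simp add: trace_def sum_distrib_left)

text \<open>The rows indexed by \<open>S\<close> are perturbed one after the other.\<close>

lemma det_perturb_rows:
  fixes u a :: "'a::field^'n::finite"
  shows "det (\<chi> i. if i \<in> S then axis i 1 + u $ i *s a else axis i 1) = 1 + (\<Sum>i\<in>S. u $ i * a $ i)"
proof -
  have "finite S" by simp
  then show ?thesis
  proof (induction S)
    case empty
    have "(\<chi> i. axis i 1) = (mat 1 :: 'a^'n^'n)" by (simp add: vec_eq_iff axis_def mat_def)
    then show ?case by simp
  next
    case (insert k S)
    let ?r = "\<lambda>i. if i \<in> S then axis i 1 + u $ i *s a else axis i 1"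
    have 1: "det (\<chi> i. if i \<in> insert k S then axis i 1 + u $ i *s a else axis i 1)
        = det (\<chi> i. if i = k then axis k 1 + u $ k *s a else ?r i)"
      by (rule arg_cong[of _ _ det]) (auto simp: vec_eq_iff)
    have 2: "det (\<chi> i. if i = k then axis k 1 else ?r i) = 1 + (\<Sum>i\<in>S. u $ i * a $ i)"
      unfolding insert.IH[symmetric] using insert.hyps
      by (intro arg_cong[of _ _ det]) (auto simp: vec_eq_iff)
    \<comment> \<open>Once row k is \<open>a\<close>, the multiples of \<open>a\<close> in the other
      rows can be removed by row operations; the identity matrix with row k replaced by
      \<open>a\<close> has determinant \<open>a $ k\<close>.\<close>
    have 3: "det (\<chi> i. if i = k then a else if i \<in> T then axis i 1 + u $ i *s a else axis i 1) = a $ k"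
      if "finite T" "k \<notin> T" for T
      using that
    proof (induction T)
      case empty
      have a: "a = (\<Sum>i\<in>UNIV. a $ i *s row i (mat 1))"
        by (simp add: vec_eq_iff row_def mat_def if_distrib if_distribR cong: if_cong)
      have "(\<chi> i. if i = k then a else if i \<in> {} then axis i 1 + u $ i *s a else axis i 1)
          = ((\<chi> i. if i = k then (\<Sum>i\<in>UNIV. a $ i *s row i (mat 1)) else row i (mat 1)) :: 'a^'n^'n)"
        by (subst a[symmetric]) (auto simp: vec_eq_iff row_def mat_def axis_def)
      then show ?case using cramer_lemma_transpose[where x = a and k = k and A = "mat 1"] by simp
    next
      case (insert m T)
      let ?A = "(\<chi> i. if i = k then a else if i \<in> T then axis i 1 + u $ i *s a else axis i 1) :: 'a^'n^'n"
      have "m \<noteq> k" using insert by auto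
      then have "det (\<chi> i. if i = m then row m ?A + u $ m *s row k ?A else row i ?A) = det ?A"
        by (rule det_row_operation)
      moreover have "(\<chi> i. if i = m then row m ?A + u $ m *s row k ?A else row i ?A)
         = (\<chi> i. if i = k then a else if i \<in> insert m T then axis i 1 + u $ i *s a else axis i 1)"
        using insert by (auto simp: vec_eq_iff row_def)
      ultimately show ?case using insert by simp
    qed
    show ?case
      unfolding 1 by (subst det_row_add, subst det_row_mul) (use insert.hyps 2 3[of S] in simp)
  qed
qed

lemma det_one_plus_outer:
  fixes u a :: "'a::field^'n::finite"
  shows "det (mat 1 + outer u a) = 1 + cdot u a"
proof -
  have "mat 1 + outer u a = (\<chi> i. if i \<in> UNIV then axis i 1 + u $ i *s a else axis i 1)"
    by (simp add: vec_eq_iff mat_def axis_def eq_commute)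
  then show ?thesis using det_perturb_rows[of UNIV u a] by (simp add: cdot_def)
qed

lemma det_one_plus_mscale_outer:
  fixes u a :: "'a::field^'n::finite"
  shows "det (mat 1 + mscale c (outer u a)) = 1 + c * cdot u a"
proof -
  have "mscale c (outer u a) = outer (c *s u) a" by (simp add: vec_eq_iff mult_ac)
  then show ?thesis by (simp add: det_one_plus_outer)
qed

lemma kernel_of_det_zero:
  fixes A :: "'a::field^'n^'n::finite"
  assumes "det A = 0"
  obtains x where "x \<noteq> 0" "A *v x = 0"
  using assms by (metis invertible_det_nz invertible_left_inverse matrix_left_invertible_ker)

lemma skew_mult_vec:
  fixes W :: "'a::comm_ring_1^'n^'n::finite"
  assumes "transpose W = - W"
  shows "x v* W = - (W *v x)"
proof -
  have "x v* W = transpose W *v x" by simp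
  also have "\<dots> = - (W *v x)" by (simp only: assms) (simp add: vec_eq_iff matrix_vector_mult_def sum_negf)
  finally show ?thesis .
qed

lemma skew_quadratic_zero:
  fixes W :: "complex^'n^'n::finite"
  assumes "transpose W = - W"
  shows "cdot x (W *v x) = 0"
  using skew_mult_vec[OF assms, of x] cdot_mult_vec[of x W x] cdot_commute[of x "W *v x"] by simp

lemma det_odd_skew:
  fixes W :: "complex^'n^'n::finite"
  assumes "transpose W = - W" "odd CARD('n)"
  shows "det W = 0"
proof -
  have "- W = mscale (- 1) W" by (simp add: vec_eq_iff)
  then have "det W = (- 1) ^ CARD('n) * det W"
    by (metis assms(1) det_mscale det_transpose)
  then show ?thesis using assms(2) by simp
qed

text \<open>An odd-size skew W has a kernel vector x. If \<open>a\<close> vanished on x, then x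
  would also lie in the kernel of the invertible W + a \<otimes> a; so x can be normalized. At a
  point of a contact manifold this is the Reeb vector.\<close>

lemma Reeb_vector:
  fixes W :: "complex^'n^'n::finite"
  assumes W: "transpose W = - W" and odd: "odd CARD('n)" and D: "det (W + outer a a) \<noteq> 0"
  obtains R where "W *v R = 0" "R v* W = 0" "cdot a R = 1"
proof -
  obtain x where x: "x \<noteq> 0" "W *v x = 0" using kernel_of_det_zero[OF det_odd_skew[OF W odd]] .
  have "cdot a x \<noteq> 0"
  proof
    assume "cdot a x = 0"
    then have "(W + outer a a) *v x = 0" by (simp add: matrix_vector_mult_add_rdistrib outer_mult_vec x)
    moreover have "invertible (W + outer a a)" using D by (simp add: invertible_det_nz)
    ultimately show False using x(1) by (metis invertible_left_inverse matrix_left_invertible_ker)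
  qed
  then have "W *v (inverse (cdot a x) *s x) = 0" "cdot a (inverse (cdot a x) *s x) = 1"
    by (simp_all add: vector_scalar_commute x)
  then show ?thesis using that skew_mult_vec[OF W] by (metis neg_equal_0_iff_equal)
qed

text \<open>Rescaling a contact form by \<open>g\<close> changes \<open>W = d\<alpha>\<close> into \<open>gW + dg \<and> \<alpha>\<close>. The right-hand side
  is brought to the form \<open>gW + g\<^sup>2 \<alpha>\<otimes>\<alpha>\<close> by a unimodular congruence.\<close>

lemma det_gauge:
  fixes W :: "complex^'n^'n::finite"
  assumes W: "transpose W = - W" and odd: "odd CARD('n)" and D: "det (W + outer a a) \<noteq> 0" and g: "g \<noteq> 0"
  shows "det (mscale g W + outer b a - outer a b + mscale (g\<^sup>2) (outer a a))
    = g ^ (CARD('n) + 1) * det (W + outer a a)"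
proof -
  let ?M = "W + outer a a"
  obtain R where R: "W *v R = 0" "R v* W = 0" "cdot a R = 1" using Reeb_vector[OF W odd D] .
  \<comment> \<open>Changing b by a multiple of a does not affect
    \<open>outer b a - outer a b\<close>; the multiple is chosen so that b0 vanishes on the Reeb
    vector.\<close>
  define b0 where "b0 = b - cdot b R *s a"
  have b0R: "cdot b0 R = 0" by (simp add: b0_def R)
  obtain B where B: "?M ** B = mat 1" using D
    by (metis invertible_det_nz invertible_right_inverse)
  \<comment> \<open>Pairing M u = b0 with R gives a(u) = b0(R) = 0, hence W u = b0. This u defines
    the shears \<open>?P\<close> and \<open>?Q\<close>, whose determinants are 1 because a(u) =
    0.\<close>
  define u where "u = B *v b0"
  have Mu: "?M *v u = b0" by (simp add: u_def matrix_vector_mul_assoc B)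
  have RM: "R v* ?M = a"
  proof -
    have "R v* ?M = R v* W + R v* outer a a"
      by (simp add: vec_eq_iff vector_matrix_mult_def algebra_simps sum.distrib)
    then show ?thesis by (simp add: R vec_mult_outer cdot_commute[of R])
  qed
  have au: "cdot a u = 0" using cdot_mult_vec[of R ?M u] b0R by (simp add: RM Mu cdot_commute)
  have Wu: "W *v u = b0" using Mu by (simp add: matrix_vector_mult_add_rdistrib outer_mult_vec au)
  have uW: "u v* W = - b0" using skew_mult_vec[OF W, of u] Wu by simp
  let ?N = "mscale g W + mscale (g\<^sup>2) (outer a a)"
  let ?P = "mat 1 + mscale (1 / g) (outer u a)" and ?Q = "mat 1 + mscale (1 / g) (outer a u)"
  \<comment> \<open>Since M R = a, the factor 1 + (g - 1) R \<otimes> a changes only the coefficient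
    of a \<otimes> a; its determinant g is the extra factor beyond g^dim.\<close>
  have N: "?N = mscale g (?M ** (mat 1 + mscale (g - 1) (outer R a)))"
    by (simp add: matrix_add_ldistrib mscale_mult mult_outer matrix_vector_mult_add_rdistrib R outer_mult_vec)
      (simp add: vec_eq_iff algebra_simps power2_eq_square)
  have detN: "det ?N = g ^ (CARD('n) + 1) * det ?M"
    unfolding N det_mscale det_mul det_one_plus_mscale_outer by (simp add: R cdot_commute[of R])
  have NP: "?N ** ?P = ?N + outer b0 a"
  proof -
    have "?N *v u = g *s b0"
      by (simp add: matrix_vector_mult_add_rdistrib mscale_mult_vec outer_mult_vec Wu au)
    then show ?thesis using g
      by (simp add: matrix_add_ldistrib mscale_mult mult_outer) (simp add: vec_eq_iff)
  qed
  have QN: "?Q ** (?N + outer b0 a) = ?N + outer b0 a - outer a b0"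
  proof -
    have "u v* ?N = g *s (u v* W) + g\<^sup>2 *s (u v* outer a a)"
      by (simp add: vec_eq_iff vector_matrix_mult_def algebra_simps sum.distrib sum_distrib_left)
    then have "u v* ?N = - (g *s b0)" by (simp add: uW vec_mult_outer au cdot_commute[of u])
    moreover have "cdot u b0 = 0" using skew_quadratic_zero[OF W, of u] Wu by simp
    ultimately show ?thesis using g
      by (simp add: matrix_add_ldistrib matrix_rdistribs mscale_mult outer_mult vec_mult_outer)
        (simp add: vec_eq_iff uW au cdot_commute[of u] field_simps)
  qed
  have "det (?Q ** (?N ** ?P)) = det ?N"
    by (simp add: det_mul det_one_plus_mscale_outer au cdot_commute[of u])
  moreover have "?Q ** (?N ** ?P) = mscale g W + outer b a - outer a b + mscale (g\<^sup>2) (outer a a)"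
    unfolding NP QN by (simp add: vec_eq_iff b0_def algebra_simps)
  ultimately show ?thesis using detN by simp
qed

text \<open>The infinitesimal counterpart of \<open>det_gauge\<close>, with Md in the role of the
  derivative of M = W + a \<otimes> a along a field with Jacobian T. Since B = M^-1 sends a to R,
  the two terms in b cancel in the trace, f M contributes dim times f and the remaining f a
  \<otimes> a contributes f; each of the two terms with T contributes trace T.\<close>

lemma trace_gauge:
  fixes W :: "complex^'n^'n::finite"
  assumes W: "transpose W = - W" and odd: "odd CARD('n)" and B: "(W + outer a a) ** B = mat 1"
    and Md: "Md + transpose T ** (W + outer a a) + (W + outer a a) ** T
      = mscale f W + outer b a - outer a b + mscale (2 * f) (outer a a)"
  shows "trace (Md ** B) = (of_nat CARD('n) + 1) * f - 2 * trace T"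
proof -
  let ?M = "W + outer a a"
  have D: "det ?M \<noteq> 0" using B by (metis invertible_det_nz invertible_right_inverse)
  obtain R where R: "W *v R = 0" "R v* W = 0" "cdot a R = 1" using Reeb_vector[OF W odd D] .
  have B': "B ** ?M = mat 1" using B matrix_left_right_inverse by blast
  have MR: "?M *v R = a" by (simp add: matrix_vector_mult_add_rdistrib outer_mult_vec R)
  have Ba: "B *v a = R" using matrix_vector_mul_assoc[of B ?M R] by (simp add: MR B')
  have "R v* ?M = R v* W + R v* outer a a"
    by (simp add: vec_eq_iff vector_matrix_mult_def algebra_simps sum.distrib)
  then have RM: "R v* ?M = a" by (simp add: R vec_mult_outer cdot_commute[of R])
  have aB: "a v* B = R"
    using vector_matrix_mul_assoc[of R ?M B] by (simp add: RM B)
  have "trace ((transpose T ** ?M) ** B) = trace T"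
    unfolding matrix_mul_assoc[symmetric] B by (simp add: trace_def transpose_def)
  moreover have "trace ((?M ** T) ** B) = trace T"
    by (subst trace_mul_sym) (simp add: matrix_mul_assoc B')
  moreover have "trace ((mscale f W + outer b a - outer a b + mscale (2 * f) (outer a a)) ** B)
      = (of_nat CARD('n) + 1) * f"
  proof -
    have eq: "mscale f W + outer b a - outer a b + mscale (2 * f) (outer a a)
      = mscale f ?M + outer b a - outer a b + mscale f (outer a a)"
      by (simp add: vec_eq_iff algebra_simps)
    have "trace (outer b a ** B) = cdot b R" "trace (outer a a ** B) = 1"
      by (simp_all add: outer_mult trace_outer aB R)
    moreover have "trace (outer a b ** B) = cdot b R"
      using cdot_mult_vec[of b B a] by (simp add: outer_mult trace_outer cdot_commute[of a] Ba)
    ultimately show ?thesis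
      unfolding eq matrix_rdistribs(2) matrix_rdistribs(1)[of _ "mscale f (outer a a)"]
        matrix_rdistribs(1)[of "mscale f ?M"] mscale_mult B trace_add trace_sub trace_mscale trace_I
      by (simp add: algebra_simps)
  qed
  ultimately have "trace (Md ** B) + trace T + trace T = (of_nat CARD('n) + 1) * f"
    unfolding Md[symmetric] matrix_rdistribs(1)[of _ "?M ** T"] matrix_rdistribs(1)[of Md] trace_add
    by simp
  then show ?thesis by (simp add: algebra_simps)
qed

section \<open>Nonvanishing of top-degree wedge products\<close>

definition multilinear_form :: "nat \<Rightarrow> ((nat \<Rightarrow> complex^'d) \<Rightarrow> complex) \<Rightarrow> bool" where
  "multilinear_form m f \<longleftrightarrow> (\<forall>v j x. m \<le> j \<longrightarrow> f (v(j := x)) = f v) \<and>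
     (\<forall>v j x y c. j < m \<longrightarrow> f (v(j := x + c *s y)) = f (v(j := x)) + c * f (v(j := y)))"

text \<open>Stands for the vanishing of the interior product with u, for forms that are not assumed
  alternating: u in any slot gives 0.\<close>

definition annihilates :: "complex^'d \<Rightarrow> nat \<Rightarrow> ((nat \<Rightarrow> complex^'d) \<Rightarrow> complex) \<Rightarrow> bool" where
  "annihilates u m f \<longleftrightarrow> (\<forall>v j. j < m \<longrightarrow> v j = u \<longrightarrow> f v = 0)"

lemma covec_form_eq: "covec_form a v = cdot a (v 0)"
  by (simp add: covec_form_def cdot_def)

lemma bilin_form_eq: "bilin_form W v = cdot (v 0) (W *v v 1)"
  by (simp add: bilin_form_def cdot_def matrix_vector_mult_def sum_distrib_left mult_ac)

lemma multilinear_covec_form: "multilinear_form 1 (covec_form a)"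
  by (auto simp: multilinear_form_def covec_form_eq)

lemma multilinear_bilin_form: "multilinear_form 2 (bilin_form W)"
  by (auto simp: multilinear_form_def bilin_form_eq matrix_vector_right_distrib vector_scalar_commute
      less_2_cases_iff)

lemma fun_upd_permute:
  assumes "p permutes S"
  shows "(v(j := x)) (p i) = ((\<lambda>i. v (p i))(inv_into UNIV p j := x)) i"
  using permutes_inverses[OF assms] by auto

text \<open>In the summand of p, changing entry j of v changes entry p^-1(j) of the permuted
  sequence. For j < k + l this entry belongs to exactly one of the two factors; for larger j it is
  fixed by p and neither factor sees it.\<close>

lemma multilinear_wedge:
  assumes a: "multilinear_form k a" and b: "multilinear_form l b"
  shows "multilinear_form (k + l) (wedge k l a b)"
proof -
  define g :: "(nat \<Rightarrow> nat) \<Rightarrow> (nat \<Rightarrow> complex^'a) \<Rightarrow> complex" where "g = (\<lambda>p v. a (\<lambda>i. v (p i)) * b (\<lambda>i. v (p (k + i))))"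
  have upd_a: "(\<lambda>i. (v(j := x)) (p i)) = (\<lambda>i. v (p i))(inv_into UNIV p j := x)"
    if "p permutes {..<k+l}" for p and v :: "nat \<Rightarrow> complex^'a" and j x
    using fun_upd_permute[OF that] by (intro ext)
  have upd_b: "(\<lambda>i. (v(j := x)) (p (k + i))) = (if inv_into UNIV p j < k then (\<lambda>i. v (p (k + i)))
      else (\<lambda>i. v (p (k + i)))(inv_into UNIV p j - k := x))"
    if "p permutes {..<k+l}" for p and v :: "nat \<Rightarrow> complex^'a" and j x
    using fun_upd_permute[OF that, of v j x] by (auto simp: fun_eq_iff)
  have g1: "g p (v(j := x)) = g p v" if p: "p permutes {..<k+l}" and j: "k + l \<le> j" for p v j x
  proof -
    have "inv_into UNIV p j = j" using permutes_inv[OF p] j by (simp add: permutes_def)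
    then show ?thesis using a b j unfolding g_def upd_a[OF p] upd_b[OF p]
      by (simp add: multilinear_form_def)
  qed
  have g2: "g p (v(j := x + c *s y)) = g p (v(j := x)) + c * g p (v(j := y))"
    if p: "p permutes {..<k+l}" and j: "j < k + l" for p v j x c y
  proof -
    have i: "inv_into UNIV p j < k + l" using permutes_in_image[OF permutes_inv[OF p], of j] j by simp
    show ?thesis
    proof (cases "inv_into UNIV p j < k")
      case True
      then show ?thesis using a unfolding g_def upd_a[OF p] upd_b[OF p]
        by (simp add: multilinear_form_def algebra_simps)
    next
      case False
      then have "inv_into UNIV p j - k < l" using i by auto
      then show ?thesis using a b False unfolding g_def upd_a[OF p] upd_b[OF p]
        by (simp add: multilinear_form_def algebra_simps)
    qed
  qed
  have w: "wedge k l a b v = (\<Sum>p | p permutes {..<k+l}. of_int (sign p) * g p v) / (fact k * fact l)" for v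
    by (simp add: wedge_def g_def mult.assoc)
  show ?thesis unfolding multilinear_form_def w
    using g1 g2 by (auto simp: algebra_simps sum.distrib sum_distrib_left add_divide_distrib
        intro!: sum.cong arg_cong2[of _ _ _ _ "(/)"])
qed

lemma annihilates_wedge:
  assumes a: "annihilates u k a" and b: "annihilates u l b"
  shows "annihilates u (k + l) (wedge k l a b)"
  unfolding annihilates_def
proof (intro allI impI)
  fix v :: "nat \<Rightarrow> complex^'a" and j assume j: "j < k + l" "v j = u"
  have "a (\<lambda>i. v (p i)) * b (\<lambda>i. v (p (k + i))) = 0" if p: "p permutes {..<k+l}" for p
  proof -
    have i: "inv_into UNIV p j < k + l" using permutes_in_image[OF permutes_inv[OF p], of j] j by simp
    have pj: "p (inv_into UNIV p j) = j" using permutes_inverses[OF p] by simp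
    show ?thesis
    proof (cases "inv_into UNIV p j < k")
      case True
      then show ?thesis using a pj j unfolding annihilates_def by simp
    next
      case False
      then have "inv_into UNIV p j - k < l" "k + (inv_into UNIV p j - k) = inv_into UNIV p j" using i by auto
      then show ?thesis using b pj j unfolding annihilates_def by simp
    qed
  qed
  then show "wedge k l a b v = 0" unfolding wedge_def mult.assoc by (simp add: sum.neutral)
qed

text \<open>Composing the summation index with the transposition of i and j flips every sign and
  leaves the arguments unchanged, so the sum equals its negative. The factors may be arbitrary,
  since the sum itself antisymmetrizes.\<close>

lemma wedge_alternating:
  assumes "i < k + l" "j < k + l" "i \<noteq> j" "v i = v j"
  shows "wedge k l a b v = 0"
proof -
  define t where "t = Transposition.transpose i j"
  define g where "g = (\<lambda>p. a (\<lambda>i. v (p i)) * b (\<lambda>i. v (p (k + i))))"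
  have t: "t permutes {..<k+l}" unfolding t_def using assms by (intro permutes_swap_id) auto
  have vt: "v (t m) = v m" for m using assms by (auto simp: t_def Transposition.transpose_def)
  have "(\<Sum>p | p permutes {..<k+l}. of_int (sign p) * g p)
      = (\<Sum>p | p permutes {..<k+l}. of_int (sign (t \<circ> p)) * g (t \<circ> p))"
    by (rule setum_permutations_compose_left[OF t])
  also have "\<dots> = (\<Sum>p | p permutes {..<k+l}. - (of_int (sign p) * g p))"
  proof (rule sum.cong)
    fix p assume "p \<in> {p. p permutes {..<k+l}}"
    then have "permutation p" "permutation t"
      using t permutes_imp_permutation by auto
    then have "sign (t \<circ> p) = - sign p" using assms(3) by (simp add: sign_compose t_def sign_swap_id)
    then show "of_int (sign (t \<circ> p)) * g (t \<circ> p) = - (of_int (sign p) * g p)"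
      by (simp add: g_def vt)
  qed simp
  finally have "(\<Sum>p | p permutes {..<k+l}. of_int (sign p) * g p) = 0"
    by (simp add: sum_negf)
  then show ?thesis by (simp add: wedge_def g_def mult.assoc)
qed

lemma multilinear_form_sum:
  assumes f: "multilinear_form m f" and K: "K < m"
  shows "f (v(K := \<Sum>j\<in>J. c j *s w j)) = (\<Sum>j\<in>J. c j * f (v(K := w j)))"
proof -
  have lin: "f (v(K := x + c *s y)) = f (v(K := x)) + c * f (v(K := y))" for x y c
    using f K by (simp add: multilinear_form_def)
  have 0: "f (v(K := 0)) = 0" using lin[of 0 1 0] by simp
  show ?thesis
  proof (induction J rule: infinite_finite_induct)
    case (insert j J)
    then show ?case using lin[of "\<Sum>j\<in>J. c j *s w j" "c j" "w j"]
      by (simp add: add.commute del: fun_upd_apply)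
  qed (simp_all add: 0 del: fun_upd_apply)
qed

text \<open>Modulo \<open>u\<close>, any \<open>dim\<close> vectors are linearly dependent.\<close>

lemma alternating_top_form_zero:
  fixes f :: "(nat \<Rightarrow> complex^'d::finite) \<Rightarrow> complex"
  assumes f: "multilinear_form CARD('d) f"
    and alt: "\<And>v i j. i < CARD('d) \<Longrightarrow> j < CARD('d) \<Longrightarrow> i \<noteq> j \<Longrightarrow> v i = v j \<Longrightarrow> f v = 0"
    and u: "u \<noteq> 0" "annihilates u CARD('d) f"
  shows "f v = 0"
proof -
  obtain \<iota> :: "'d \<Rightarrow> nat" where \<iota>: "bij_betw \<iota> UNIV {0..<CARD('d)}"
    using ex_bij_betw_finite_nat[of "UNIV :: 'd set"] by auto
  have \<iota>_less: "\<iota> j < CARD('d)" for j using \<iota> by (auto simp: bij_betw_def)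
  define V :: "complex^'d^'d" where "V = (\<chi> i j. v (\<iota> j) $ i)"
  have Vc: "V *v c = (\<Sum>j\<in>UNIV. c $ j *s v (\<iota> j))" for c
    by (simp add: V_def vec_eq_iff matrix_vector_mult_def mult.commute)
  \<comment> \<open>If the vectors are dependent, c is a relation and s = 0; otherwise they form a
    basis, in which u is expanded with s = 1.\<close>
  obtain c s where c: "c \<noteq> 0" "V *v c = s *s u"
  proof (cases "det V = 0")
    case True
    then obtain c where "c \<noteq> 0" "V *v c = 0" using kernel_of_det_zero by blast
    then show ?thesis using that[of c 0] by simp
  next
    case False
    then obtain B where "V ** B = mat 1" by (metis invertible_det_nz invertible_right_inverse)
    then have "V *v (B *v u) = u" by (simp add: matrix_vector_mul_assoc)
    then show ?thesis using that[of "B *v u" 1] u(1) by (metis matrix_vector_mult_0_right vector_smult_lid)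
  qed
  then obtain k where k: "c $ k \<noteq> 0" by (auto simp: vec_eq_iff)
  \<comment> \<open>Slot \<open>\<iota> k\<close> receives the combination of all the vectors. By
    alternation only the term j = k survives, while on the other side u sits in that slot and gives
    0.\<close>
  have "(\<Sum>j\<in>UNIV. c $ j * f (v(\<iota> k := v (\<iota> j)))) = f (v(\<iota> k := s *s u))"
    unfolding multilinear_form_sum[OF f \<iota>_less, symmetric] Vc[symmetric] c(2) ..
  also have "\<dots> = s * f (v(\<iota> k := u))"
    using multilinear_form_sum[OF f \<iota>_less, of v k "\<lambda>_. s" "\<lambda>_. u" "{0::nat}"] by simp
  also have "\<dots> = 0" using u(2) \<iota>_less[of k] by (simp add: annihilates_def)
  also have "(\<Sum>j\<in>UNIV. c $ j * f (v(\<iota> k := v (\<iota> j)))) = (\<Sum>j\<in>UNIV. if j = k then c $ k * f v else 0)"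
  proof (rule sum.cong)
    fix j
    show "c $ j * f (v(\<iota> k := v (\<iota> j))) = (if j = k then c $ k * f v else 0)"
    proof (cases "j = k")
      case False
      then have "\<iota> j \<noteq> \<iota> k" using \<iota> by (auto simp: bij_betw_def inj_on_def)
      then show ?thesis using alt[of "\<iota> j" "\<iota> k"] \<iota>_less False by simp
    qed simp
  qed simp
  finally show ?thesis using k by simp
qed

text \<open>W contributes nothing to the quadratic form, so a kernel vector u of W + a \<otimes> a
  satisfies a(u)^2 = 0. Hence W u = 0 too, and u annihilates every factor of the wedge
  product.\<close>

lemma det_nonzero_of_wedge:
  fixes W :: "complex^'d^'d::finite"
  assumes dim: "CARD('d) = 2 * n + 1" and W: "transpose W = - W"
    and nz: "wedge 1 (2 * n) (covec_form a) (wedge_power (bilin_form W) n) v \<noteq> 0"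
  shows "det (W + outer a a) \<noteq> 0"
proof
  assume "det (W + outer a a) = 0"
  then obtain u where u: "u \<noteq> 0" "(W + outer a a) *v u = 0" by (rule kernel_of_det_zero)
  then have eq: "W *v u + cdot a u *s a = 0" by (simp add: matrix_vector_mult_add_rdistrib outer_mult_vec)
  have "cdot u (W *v u + cdot a u *s a) = (cdot a u)\<^sup>2"
    by (simp add: skew_quadratic_zero[OF W] power2_eq_square cdot_commute[of u])
  then have au: "cdot a u = 0" unfolding eq by simp
  then have Wu: "W *v u = 0" using eq by simp
  have ann_a: "annihilates u 1 (covec_form a)" by (auto simp: annihilates_def covec_form_eq au)
  have uW: "u v* W = 0" using skew_mult_vec[OF W, of u] Wu by simp
  have ann_W: "annihilates u 2 (bilin_form W)"
    unfolding annihilates_def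
  proof (intro allI impI)
    fix w :: "nat \<Rightarrow> complex^'d" and j :: nat assume "j < 2" "w j = u"
    then consider "w 0 = u" | "w 1 = u" by (auto simp: less_2_cases_iff)
    then show "bilin_form W w = 0"
    proof cases
      case 1
      show ?thesis unfolding bilin_form_eq cdot_mult_vec 1 uW by simp
    next
      case 2
      show ?thesis unfolding bilin_form_eq 2 Wu by simp
    qed
  qed
  have "annihilates u (2 * m) (wedge_power (bilin_form W) m) \<and> multilinear_form (2 * m) (wedge_power (bilin_form W) m)" for m
  proof (induction m)
    case 0
    show ?case by (simp add: annihilates_def multilinear_form_def)
  next
    case (Suc m)
    then show ?case
      using annihilates_wedge[OF ann_W, of "2 * m" "wedge_power (bilin_form W) m"]
        multilinear_wedge[OF multilinear_bilin_form, of "2 * m" "wedge_power (bilin_form W) m" W] by simp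
  qed
  then have "annihilates u (1 + 2 * n) (wedge 1 (2 * n) (covec_form a) (wedge_power (bilin_form W) n))"
    "multilinear_form (1 + 2 * n) (wedge 1 (2 * n) (covec_form a) (wedge_power (bilin_form W) n))"
    by (intro annihilates_wedge[OF ann_a] multilinear_wedge[OF multilinear_covec_form]; simp)+
  moreover have "CARD('d) = 1 + 2 * n" using dim by simp
  ultimately have "wedge 1 (2 * n) (covec_form a) (wedge_power (bilin_form W) n) v = 0"
    using alternating_top_form_zero[of "wedge 1 (2 * n) (covec_form a) (wedge_power (bilin_form W) n)" u v]
      wedge_alternating[of _ 1 "2 * n"] u(1) by (simp only:) blast
  then show False using nz by simp
qed

section \<open>Lie derivatives in coordinates\<close>

text \<open>The direction is a single vector and not a field, so linearity in it is available at
  each point; \<open>dir_deriv X f x\<close> is \<open>ddir (X x) f x\<close>. With the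
  componentwise versions \<open>vecD\<close> and \<open>matD\<close> and the Jacobian matrix
  \<open>cjac\<close>, the Lie derivatives become matrix identities.\<close>

definition ddir :: "complex^'d \<Rightarrow> (real^'d::finite \<Rightarrow> complex) \<Rightarrow> real^'d \<Rightarrow> complex" where
  "ddir v f x = (\<Sum>i\<in>UNIV. v $ i * pd i f x)"

definition vecD :: "complex^'d \<Rightarrow> (real^'d::finite \<Rightarrow> complex^'n) \<Rightarrow> real^'d \<Rightarrow> complex^'n" where
  "vecD v F x = (\<chi> k. ddir v (\<lambda>y. F y $ k) x)"

definition matD :: "complex^'d \<Rightarrow> (real^'d::finite \<Rightarrow> complex^'n^'m) \<Rightarrow> real^'d \<Rightarrow> complex^'n^'m" where
  "matD v A x = (\<chi> i j. ddir v (\<lambda>y. A y $ i $ j) x)"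

definition cjac :: "(real^'d::finite \<Rightarrow> complex^'n) \<Rightarrow> real^'d \<Rightarrow> complex^'d^'n" where
  "cjac F x = (\<chi> k i. pd i (\<lambda>y. F y $ k) x)"

lemma vecD_nth [simp]: "vecD v F x $ k = ddir v (\<lambda>y. F y $ k) x"
  by (simp add: vecD_def)

lemma matD_nth [simp]: "matD v A x $ i $ j = ddir v (\<lambda>y. A y $ i $ j) x"
  by (simp add: matD_def)

lemma cjac_nth [simp]: "cjac F x $ k $ i = pd i (\<lambda>y. F y $ k) x"
  by (simp add: cjac_def)

lemma lie_vec_eq: "lie_vec X Y c x = vecD (X c x) (Y c) x - cjac (X c) x *v Y c x"
  by (simp add: vec_eq_iff lie_vec_def ddir_def dir_deriv_def matrix_vector_mult_def mult.commute)

lemma lie_one_form_eq: "lie_one_form X a c x = vecD (X c x) (a c) x + a c x v* cjac (X c) x"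
  by (simp add: vec_eq_iff lie_one_form_def ddir_def dir_deriv_def vector_matrix_mult_def mult.commute)

lemma lie_two_form_eq:
  "lie_two_form X w c x = matD (X c x) (w c) x + transpose (cjac (X c) x) ** w c x + w c x ** cjac (X c) x"
  by (simp add: vec_eq_iff lie_two_form_def ddir_def dir_deriv_def matrix_matrix_mult_def transpose_def mult.commute)

lemma lie_density_eq:
  "lie_density l X f c x = ddir (X c x) (f c) x + of_real l * trace (cjac (X c) x) * f c x"
  by (simp add: lie_density_def ddir_def dir_deriv_def trace_def)

lemma ext_d_skew: "transpose (ext_d a x) = - ext_d a x"
  by (simp add: vec_eq_iff ext_d_def transpose_def)

lemma ddir_cong:
  assumes "open S" "x \<in> S" "\<And>y. y \<in> S \<Longrightarrow> f y = g y" "smooth_on S f"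
  shows "ddir v f x = ddir v g x"
  unfolding ddir_def using pd_cong[OF assms(1-3)] smooth_on_imp_differentiable[OF assms(4,2)] by simp

context
  fixes S :: "(real^'d::finite) set"
  assumes S: "open S"
begin

lemma smooth_on_simps:
  "smooth_on S (\<lambda>_. c)"
  "smooth_on S f \<Longrightarrow> smooth_on S g \<Longrightarrow> smooth_on S (\<lambda>y. f y + g y :: complex)"
  "smooth_on S f \<Longrightarrow> smooth_on S g \<Longrightarrow> smooth_on S (\<lambda>y. f y - g y :: complex)"
  "smooth_on S f \<Longrightarrow> smooth_on S g \<Longrightarrow> smooth_on S (\<lambda>y. f y * g y :: complex)"
  "smooth_on S f \<Longrightarrow> smooth_on S (\<lambda>y. - f y :: complex)"
  "(\<And>k. k \<in> K \<Longrightarrow> smooth_on S (h k)) \<Longrightarrow> smooth_on S (\<lambda>y. \<Sum>k\<in>K. h k y :: complex)"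
  "(\<And>k. k \<in> K \<Longrightarrow> smooth_on S (h k)) \<Longrightarrow> smooth_on S (\<lambda>y. \<Prod>k\<in>K. h k y :: complex)"
  "smooth_on S f \<Longrightarrow> smooth_on S (pd i f)"
  by (rule smooth_on_const[OF S] | (rule smooth_on_add[OF S] smooth_on_diff[OF S] smooth_on_mult[OF S]
      smooth_on_minus[OF S] smooth_on_sum[OF S] smooth_on_prod[OF S] smooth_on_pd; assumption))+

lemma smooth_on_nth_iff:
  "smooth_on S (F :: _ \<Rightarrow> complex^'n) \<Longrightarrow> smooth_on S (\<lambda>y. F y $ k)"
  "smooth_on S (A :: _ \<Rightarrow> complex^'n^'m) \<Longrightarrow> smooth_on S (\<lambda>y. A y $ i $ j)"
  by (intro smooth_on_vec_nth[OF S]; assumption)+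

lemmas smooth_simps = smooth_on_simps smooth_on_nth_iff

lemma smooth_on_vec_ops:
  fixes F G :: "real^'d \<Rightarrow> complex^'n" and A B :: "real^'d \<Rightarrow> complex^'n^'n"
  shows "smooth_on S F \<Longrightarrow> smooth_on S G \<Longrightarrow> smooth_on S (\<lambda>y. cdot (F y) (G y))"
    "smooth_on S A \<Longrightarrow> smooth_on S F \<Longrightarrow> smooth_on S (\<lambda>y. A y *v F y)"
    "smooth_on S A \<Longrightarrow> smooth_on S F \<Longrightarrow> smooth_on S (\<lambda>y. F y v* A y)"
    "smooth_on S A \<Longrightarrow> smooth_on S B \<Longrightarrow> smooth_on S (\<lambda>y. A y ** B y)"
    "smooth_on S F \<Longrightarrow> smooth_on S G \<Longrightarrow> smooth_on S (\<lambda>y. outer (F y) (G y))"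
    "smooth_on S c \<Longrightarrow> smooth_on S A \<Longrightarrow> smooth_on S (\<lambda>y. mscale (c y) (A y))"
    "smooth_on S c \<Longrightarrow> smooth_on S F \<Longrightarrow> smooth_on S (\<lambda>y. c y *s F y)"
    "smooth_on S A \<Longrightarrow> smooth_on S (\<lambda>y. transpose (A y))"
    "smooth_on S A \<Longrightarrow> smooth_on S (\<lambda>y. det (A y))"
    "smooth_on S A \<Longrightarrow> smooth_on S (\<lambda>y. trace (A y))"
  by ((rule smooth_on_vec[OF S])+; simp add: smooth_simps matrix_vector_mult_def vector_matrix_mult_def
      matrix_matrix_mult_def transpose_def
    | simp add: smooth_simps cdot_def det_def trace_def)+

lemma smooth_on_derivs:
  fixes X :: "real^'d \<Rightarrow> complex^'d" and F :: "real^'d \<Rightarrow> complex^'n" and A :: "real^'d \<Rightarrow> complex^'n^'m"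
  shows "smooth_on S F \<Longrightarrow> smooth_on S (cjac F)"
    "smooth_on S X \<Longrightarrow> smooth_on S f \<Longrightarrow> smooth_on S (\<lambda>y. ddir (X y) f y)"
    "smooth_on S X \<Longrightarrow> smooth_on S F \<Longrightarrow> smooth_on S (\<lambda>y. vecD (X y) F y)"
    "smooth_on S X \<Longrightarrow> smooth_on S A \<Longrightarrow> smooth_on S (\<lambda>y. matD (X y) A y)"
    "smooth_on S X \<Longrightarrow> smooth_on S (ext_d X)"
  by ((rule smooth_on_vec[OF S])+; simp add: smooth_simps ddir_def ext_d_def | simp add: smooth_simps ddir_def)+

end

context
  fixes S :: "(real^'d::finite) set" and x :: "real^'d"
  assumes S: "open S" and x: "x \<in> S"
begin

lemmas smooth_simps' = smooth_simps[OF S]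

lemma pd_simps:
  "smooth_on S f \<Longrightarrow> smooth_on S g \<Longrightarrow> pd i (\<lambda>y. f y + g y) x = pd i f x + pd i g x"
  "smooth_on S f \<Longrightarrow> smooth_on S g \<Longrightarrow> pd i (\<lambda>y. f y - g y) x = pd i f x - pd i g x"
  "smooth_on S f \<Longrightarrow> smooth_on S g \<Longrightarrow> pd i (\<lambda>y. f y * g y) x = f x * pd i g x + pd i f x * g x"
  "smooth_on S f \<Longrightarrow> pd i (\<lambda>y. - f y) x = - pd i f x"
  "(\<And>k. k \<in> K \<Longrightarrow> smooth_on S (h k)) \<Longrightarrow> pd i (\<lambda>y. \<Sum>k\<in>K. h k y) x = (\<Sum>k\<in>K. pd i (h k) x)"
  by (rule pd_add pd_diff pd_mult pd_minus pd_sum; (rule smooth_on_imp_differentiable[OF _ x]; assumption))+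

lemma ddir_simps:
  "ddir v (\<lambda>_. c) x = 0"
  "smooth_on S f \<Longrightarrow> smooth_on S g \<Longrightarrow> ddir v (\<lambda>y. f y + g y) x = ddir v f x + ddir v g x"
  "smooth_on S f \<Longrightarrow> smooth_on S g \<Longrightarrow> ddir v (\<lambda>y. f y - g y) x = ddir v f x - ddir v g x"
  "smooth_on S f \<Longrightarrow> smooth_on S g \<Longrightarrow> ddir v (\<lambda>y. f y * g y) x = f x * ddir v g x + ddir v f x * g x"
  "smooth_on S f \<Longrightarrow> ddir v (\<lambda>y. - f y) x = - ddir v f x"
  "(\<And>k. k \<in> K \<Longrightarrow> smooth_on S (h k)) \<Longrightarrow> ddir v (\<lambda>y. \<Sum>k\<in>K. h k y) x = (\<Sum>k\<in>K. ddir v (h k) x)"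
proof -
  show "ddir v (\<lambda>y. \<Sum>k\<in>K. h k y) x = (\<Sum>k\<in>K. ddir v (h k) x)" if "\<And>k. k \<in> K \<Longrightarrow> smooth_on S (h k)"
    by (simp add: ddir_def pd_simps(5) that sum_distrib_left) (rule sum.swap)
qed (simp_all add: ddir_def pd_simps sum.distrib sum_subtractf sum_negf sum_distrib_left algebra_simps)

lemma ddir_cdot:
  assumes "smooth_on S F" "smooth_on S G"
  shows "ddir v (\<lambda>y. cdot (F y) (G y)) x = cdot (vecD v F x) (G x) + cdot (F x) (vecD v G x)"
  using assms by (simp add: cdot_def smooth_simps' ddir_simps sum.distrib add.commute)

lemma vecD_mult_vec:
  assumes "smooth_on S A" "smooth_on S F"
  shows "vecD v (\<lambda>y. A y *v F y) x = matD v A x *v F x + A x *v vecD v F x"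
  using assms by (simp add: vec_eq_iff matrix_vector_mult_def smooth_simps' ddir_simps sum.distrib add.commute)

lemma vecD_vec_mult:
  assumes "smooth_on S A" "smooth_on S F"
  shows "vecD v (\<lambda>y. F y v* A y) x = F x v* matD v A x + vecD v F x v* A x"
  using assms by (simp add: vec_eq_iff vector_matrix_mult_def smooth_simps' ddir_simps sum.distrib add.commute)

lemma matD_mult:
  assumes "smooth_on S A" "smooth_on S B"
  shows "matD v (\<lambda>y. A y ** B y) x = matD v A x ** B x + A x ** matD v B x"
  using assms by (simp add: vec_eq_iff matrix_matrix_mult_def smooth_simps' ddir_simps sum.distrib add.commute)

lemma matD_outer:
  assumes "smooth_on S F" "smooth_on S G"
  shows "matD v (\<lambda>y. outer (F y) (G y)) x = outer (vecD v F x) (G x) + outer (F x) (vecD v G x)"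
  using assms by (simp add: vec_eq_iff smooth_simps' ddir_simps add.commute)

lemma matD_mscale:
  assumes "smooth_on S c" "smooth_on S A"
  shows "matD v (\<lambda>y. mscale (c y) (A y)) x = mscale (ddir v c x) (A x) + mscale (c x) (matD v A x)"
  using assms by (simp add: vec_eq_iff smooth_simps' ddir_simps add.commute)

lemma matD_add_diff:
  assumes "smooth_on S A" "smooth_on S B"
  shows "matD v (\<lambda>y. A y + B y) x = matD v A x + matD v B x"
    "matD v (\<lambda>y. A y - B y) x = matD v A x - matD v B x"
  using assms by (simp_all add: vec_eq_iff smooth_simps' ddir_simps)

text \<open>In form notation d(ga) = g da + dg \<and> a: the difference of the two outer products is
  the matrix of dg \<and> a.\<close>

lemma ext_d_smult:
  assumes "smooth_on S g" "smooth_on S a"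
  shows "ext_d (\<lambda>y. g y *s a y) x = mscale (g x) (ext_d a x)
    + outer (\<chi> i. pd i g x) (a x) - outer (a x) (\<chi> i. pd i g x)"
  using assms by (simp add: vec_eq_iff ext_d_def smooth_simps' pd_simps algebra_simps)

text \<open>This is d L_X = L_X d on 1-forms. Symmetry of second derivatives removes those of X
  under antisymmetrization and identifies those of a with the derivative of da along X.\<close>

lemma ext_d_lie:
  fixes X a :: "real^'d \<Rightarrow> complex^'d"
  assumes X: "smooth_on S X" and a: "smooth_on S a"
  shows "ext_d (\<lambda>y. vecD (X y) a y + a y v* cjac X y) x
    = matD (X x) (ext_d a) x + transpose (cjac X x) ** ext_d a x + ext_d a x ** cjac X x"
proof -
  note sm = smooth_simps' X a
  have pa: "pd i (pd k (\<lambda>y. a y $ j)) x = pd k (pd i (\<lambda>y. a y $ j)) x" for i j k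
    by (rule pd_commute[OF S x]) (simp add: sm)
  have pX: "pd i (pd k (\<lambda>y. X y $ j)) x = pd k (pd i (\<lambda>y. X y $ j)) x" for i j k
    by (rule pd_commute[OF S x]) (simp add: sm)
  show ?thesis
    by (simp add: vec_eq_iff ext_d_def ddir_def matrix_matrix_mult_def vector_matrix_mult_def transpose_def
        sm pd_simps sum.distrib sum_subtractf algebra_simps pa pX)
qed

end

lemma ddir_chain:
  fixes \<phi> :: "real^'d::finite \<Rightarrow> real^'e::finite"
  assumes "\<phi> differentiable (at x)" "f differentiable (at (\<phi> x))"
  shows "ddir v (\<lambda>y. f (\<phi> y)) x = ddir (cjac (\<lambda>y. cvec (\<phi> y)) x *v v) f (\<phi> x)"
  unfolding ddir_def pd_chain[OF assms]
  by (simp add: matrix_vector_mult_def sum_distrib_left sum_distrib_right mult_ac) (rule sum.swap)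

section \<open>Change of coordinates\<close>

lemma ddir_prod:
  assumes S: "open S" "x \<in> S" and f: "finite K" "\<And>k. k \<in> K \<Longrightarrow> smooth_on S (f k)"
  shows "ddir v (\<lambda>y. \<Prod>k\<in>K. f k y) x = (\<Sum>k\<in>K. ddir v (f k) x * (\<Prod>j\<in>K - {k}. f j x))"
  using f
proof (induction K)
  case empty
  show ?case by (simp add: ddir_simps[OF S])
next
  case (insert a K)
  have "(\<Prod>j\<in>insert a K - {k}. f j x) = f a x * (\<Prod>j\<in>K - {k}. f j x)" if "k \<in> K" for k
  proof -
    have "insert a K - {k} = insert a (K - {k})" using insert.hyps that by auto
    then show ?thesis using insert.hyps by simp
  qed
  moreover have "insert a K - {a} = K" using insert.hyps by auto
  moreover have "ddir v (\<lambda>y. \<Prod>k\<in>insert a K. f k y) x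
      = f a x * ddir v (\<lambda>y. \<Prod>k\<in>K. f k y) x + ddir v (f a) x * (\<Prod>k\<in>K. f k x)"
    using insert by (simp add: ddir_simps[OF S] smooth_on_simps[OF S(1)])
  ultimately show ?case
    using insert by (simp add: sum_distrib_left mult_ac)
qed

text \<open>Jacobi's formula. The product rule differentiates one row k at a time; with
  \<open>matD v A x = H ** A x\<close> that row is a combination of the rows of A, and
  \<open>cramer_lemma_transpose\<close> extracts the coefficient of row k, a diagonal entry of
  H.\<close>

lemma ddir_det:
  fixes A :: "real^'d::finite \<Rightarrow> complex^'n^'n::finite"
  assumes S: "open S" "x \<in> S" and A: "smooth_on S A" and B: "B ** A x = mat 1"
  shows "ddir v (\<lambda>y. det (A y)) x = trace (matD v A x ** B) * det (A x)"
proof -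
  define H where "H = matD v A x ** B"
  have HA: "matD v A x = H ** A x" by (simp add: H_def matrix_mul_assoc[symmetric] B)
  have An: "smooth_on S (\<lambda>y. A y $ i $ j)" for i j using smooth_on_nth_iff(2)[OF S(1) A] .
  have "ddir v (\<lambda>y. det (A y)) x
      = (\<Sum>p | p permutes UNIV. of_int (sign p) * (\<Sum>k\<in>UNIV. matD v A x $ k $ p k * (\<Prod>j\<in>UNIV - {k}. A x $ j $ p j)))"
    by (simp add: det_def ddir_simps[OF S] smooth_on_simps[OF S(1)] An ddir_prod[OF S])
  also have "\<dots> = (\<Sum>k\<in>UNIV. det (\<chi> r. if r = k then matD v A x $ k else A x $ r))"
  proof -
    have "matD v A x $ k $ p k * (\<Prod>j\<in>UNIV - {k}. A x $ j $ p j)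
        = (\<Prod>j\<in>UNIV. (if j = k then matD v A x $ k else A x $ j) $ p j)" for k :: 'n and p
    proof -
      have "(\<Prod>j\<in>UNIV. (if j = k then matD v A x $ k else A x $ j) $ p j) =
          (if k = k then matD v A x $ k else A x $ k) $ p k * (\<Prod>j\<in>UNIV - {k}. (if j = k then matD v A x $ k else A x $ j) $ p j)"
        by (rule prod.remove) auto
      also have "(\<Prod>j\<in>UNIV - {k}. (if j = k then matD v A x $ k else A x $ j) $ p j) = (\<Prod>j\<in>UNIV - {k}. A x $ j $ p j)"
        by (rule prod.cong) auto
      finally show ?thesis by simp
    qed
    then have "(\<Sum>p | p permutes UNIV. of_int (sign p) * (\<Sum>k\<in>UNIV. matD v A x $ k $ p k * (\<Prod>j\<in>UNIV - {k}. A x $ j $ p j)))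
        = (\<Sum>p | p permutes UNIV. \<Sum>k\<in>UNIV. of_int (sign p) *
            (\<Prod>j\<in>UNIV. (if j = k then matD v A x $ k else A x $ j) $ p j))"
      by (simp only: sum_distrib_left)
    also have "\<dots> = (\<Sum>k\<in>UNIV. \<Sum>p | p permutes UNIV. of_int (sign p) *
            (\<Prod>j\<in>UNIV. (if j = k then matD v A x $ k else A x $ j) $ p j))"
      by (rule sum.swap)
    finally show ?thesis by (simp add: det_def)
  qed
  also have "\<dots> = (\<Sum>k\<in>UNIV. H $ k $ k * det (A x))"
  proof (rule sum.cong)
    fix k
    have "matD v A x $ k = (\<Sum>i\<in>UNIV. H $ k $ i *s row i (A x))"
      by (simp add: HA vec_eq_iff matrix_matrix_mult_def row_def)
    then have "(\<chi> r. if r = k then matD v A x $ k else A x $ r)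
        = (\<chi> r. if r = k then (\<Sum>i\<in>UNIV. H $ k $ i *s row i (A x)) else row r (A x))"
      by (simp add: vec_eq_iff row_def del: matD_nth)
    then show "det (\<chi> r. if r = k then matD v A x $ k else A x $ r) = H $ k $ k * det (A x)"
      by (simp add: cramer_lemma_transpose)
  qed simp
  finally show ?thesis by (simp add: H_def trace_def sum_distrib_right)
qed

text \<open>Meant for complex numbers that happen to be real, such as determinants of complexified
  Jacobians; the imaginary part is ignored.\<close>

definition abs_powr :: "real \<Rightarrow> complex \<Rightarrow> complex" where
  "abs_powr l z = of_real (\<bar>Re z\<bar> powr l)"

context
  fixes S :: "(real^'d::finite) set" and D :: "real^'d \<Rightarrow> complex"
  assumes S: "open S" and D: "smooth_on S D"
    and real: "\<And>y. y \<in> S \<Longrightarrow> D y \<in> \<real>" and nz: "\<And>y. y \<in> S \<Longrightarrow> D y \<noteq> 0"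
begin

lemma Re_nonzero: "y \<in> S \<Longrightarrow> Re (D y) \<noteq> 0"
  using real nz by (metis Reals_cases Re_complex_of_real of_real_eq_0_iff)

lemma smooth_on_abs_powr_comp: "smooth_on S (\<lambda>y. abs_powr l (D y))"
proof -
  have "smooth_on S (\<lambda>y. \<bar>Re (D y)\<bar> powr l)"
    by (rule smooth_on_compose[OF S smooth_on_abs_powr smooth_on_bounded_linear[OF bounded_linear_Re S D]])
      (use Re_nonzero in auto)
  then show ?thesis unfolding abs_powr_def by (rule smooth_on_bounded_linear[OF bounded_linear_of_real S])
qed

lemma ddir_abs_powr:
  assumes x: "x \<in> S"
  shows "ddir v (\<lambda>y. abs_powr l (D y)) x = of_real l * abs_powr l (D x) * ddir v D x / D x"
proof -
  have D': "(D has_derivative frechet_derivative D (at x)) (at x)" by (rule smooth_on_has_derivative[OF D x])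
  note R = bounded_linear.has_derivative[OF bounded_linear_Re D']
  have Dx: "D x = of_real (Re (D x))" using real[OF x] by simp
  have "pd i (\<lambda>y. abs_powr l (D y)) x = of_real l * abs_powr l (D x) * pd i D x / D x" for i
  proof -
    \<comment> \<open>D is real near x, so replacing it by its real part leaves the derivative
      unchanged and the real rule for absolute powers becomes applicable.\<close>
    have "pd i D x = pd i (\<lambda>y. of_real (Re (D y))) x"
      by (rule pd_cong[OF S x]) (use real smooth_on_imp_differentiable[OF D x] in auto)
    also have "\<dots> = of_real (Re (pd i D x))"
      using pd_eqI[OF bounded_linear.has_derivative[OF bounded_linear_of_real R]] by (simp add: pd_def)
    finally have pdD: "pd i D x = of_real (Re (pd i D x))" .
    have "((\<lambda>y. of_real (\<bar>Re (D y)\<bar> powr l) :: complex) has_derivative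
      (\<lambda>h. of_real ((l * \<bar>Re (D x)\<bar> powr l * inverse (Re (D x))) * Re (frechet_derivative D (at x) h)))) (at x)"
      by (rule bounded_linear.has_derivative[OF bounded_linear_of_real])
        (rule has_derivative_compose[OF R DERIV_abs_powr[OF Re_nonzero[OF x], unfolded has_field_derivative_def]])
    from pd_eqI[OF this, of i] have "pd i (\<lambda>y. abs_powr l (D y)) x
        = of_real (l * \<bar>Re (D x)\<bar> powr l * inverse (Re (D x)) * Re (pd i D x))"
      by (simp add: abs_powr_def pd_def)
    also have "\<dots> = of_real l * abs_powr l (D x) * of_real (Re (pd i D x)) / of_real (Re (D x))"
      by (simp add: abs_powr_def divide_inverse mult_ac)
    finally show ?thesis using pdD Dx by metis
  qed
  then show ?thesis by (simp add: ddir_def sum_distrib_left sum_divide_distrib mult_ac)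
qed

end

section \<open>Naturality of the derivatives under a change of coordinates\<close>

context
  fixes S T :: "(real^'d::finite) set" and \<phi> :: "real^'d \<Rightarrow> real^'d" and J :: "real^'d \<Rightarrow> complex^'d^'d"
    and x :: "real^'d"
  assumes S: "open S" "x \<in> S" and T: "open T" "\<phi> ` S \<subseteq> T" and \<phi>: "smooth_on S \<phi>"
    and J: "\<And>y. y \<in> S \<Longrightarrow> J y = cjac (\<lambda>y. cvec (\<phi> y)) y"
begin

lemma smooth_on_of_real_phi: "smooth_on S (\<lambda>y. complex_of_real (\<phi> y $ a))"
  by (rule smooth_on_bounded_linear[OF bounded_linear_of_real S(1) smooth_on_vec_nth[OF S(1) \<phi>]])

lemma smooth_on_J: "smooth_on S J"
proof (rule smooth_on_cong[OF S(1) J[symmetric]])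
  show "smooth_on S (cjac (\<lambda>y. cvec (\<phi> y)))"
    by (rule smooth_on_derivs(1)[OF S(1)], rule smooth_on_vec[OF S(1)]) (simp add: smooth_on_of_real_phi)
qed auto

lemma J_nth: "y \<in> S \<Longrightarrow> J y $ a $ i = pd i (\<lambda>y. complex_of_real (\<phi> y $ a)) y"
  by (simp add: J)

text \<open>The entries of J are first derivatives of \<phi>. This symmetry is what makes the second
  derivatives of \<phi> drop out of the naturality statements below.\<close>

lemma pd_J_symmetric: "pd i (\<lambda>y. J y $ a $ k) x = pd k (\<lambda>y. J y $ a $ i) x"
proof -
  have "pd i (\<lambda>y. J y $ a $ k) x = pd i (pd k (\<lambda>y. complex_of_real (\<phi> y $ a))) x" for i k
    by (rule pd_cong[OF S]) (auto simp: J_nth smooth_on_imp_differentiable[OF smooth_on_nth_iff(2)[OF S(1) smooth_on_J] S(2)])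
  then show ?thesis using pd_commute[OF S smooth_on_of_real_phi] by simp
qed

lemma phi_in: "\<phi> x \<in> T" using S T by auto

lemma pd_chain_J:
  assumes "smooth_on T f"
  shows "pd i (\<lambda>y. f (\<phi> y)) x = (\<Sum>a\<in>UNIV. pd a f (\<phi> x) * J x $ a $ i)"
  using pd_chain[OF smooth_on_imp_differentiable[OF \<phi> S(2)] smooth_on_imp_differentiable[OF assms phi_in]]
  by (simp add: J_nth[OF S(2)])

lemma ddir_chain_J:
  assumes "smooth_on T f"
  shows "ddir v (\<lambda>y. f (\<phi> y)) x = ddir (J x *v v) f (\<phi> x)"
  using ddir_chain[OF smooth_on_imp_differentiable[OF \<phi> S(2)] smooth_on_imp_differentiable[OF assms phi_in]]
  by (simp add: J[OF S(2)])

lemma smooth_on_comp_phi: "smooth_on T F \<Longrightarrow> smooth_on S (\<lambda>y. F (\<phi> y))"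
  by (rule smooth_on_compose[OF S(1) _ \<phi> T(2)])

lemma vecD_chain:
  assumes "smooth_on T F"
  shows "vecD v (\<lambda>y. F (\<phi> y)) x = vecD (J x *v v) F (\<phi> x)"
  using ddir_chain_J[OF smooth_on_vec_nth[OF T(1) assms]] by (simp add: vec_eq_iff)

lemma matD_chain:
  assumes "smooth_on T A"
  shows "matD v (\<lambda>y. A (\<phi> y)) x = matD (J x *v v) A (\<phi> x)"
  using ddir_chain_J[OF smooth_on_vec_nth[OF T(1) smooth_on_vec_nth[OF T(1) assms]]] by (simp add: vec_eq_iff)

lemma vecD_cong:
  assumes "\<And>y. y \<in> S \<Longrightarrow> F y = G y" "smooth_on S F"
  shows "vecD v F x = vecD v G x"
proof -
  have "ddir v (\<lambda>y. F y $ k) x = ddir v (\<lambda>y. G y $ k) x" for k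
    by (rule ddir_cong[OF S]) (use assms smooth_on_vec_nth[OF S(1) assms(2)] in auto)
  then show ?thesis by (simp add: vec_eq_iff)
qed

lemma matD_cong:
  assumes "\<And>y. y \<in> S \<Longrightarrow> F y = G y" "smooth_on S F"
  shows "matD v F x = matD v G x"
proof -
  have "ddir v (\<lambda>y. F y $ k $ l) x = ddir v (\<lambda>y. G y $ k $ l) x" for k l
    by (rule ddir_cong[OF S]) (use assms smooth_on_vec_nth[OF S(1) smooth_on_vec_nth[OF S(1) assms(2)]] in auto)
  then show ?thesis by (simp add: vec_eq_iff)
qed

text \<open>The Jacobian of a field is not a tensor: differentiating X'(\<phi>(y)) = J(y) X(y)
  produces the derivative of J along X as a correction, once the two lower indices of dJ are
  exchanged.\<close>

lemma cjac_pushforward: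
  assumes X: "smooth_on S X" "smooth_on T X'" "\<And>y. y \<in> S \<Longrightarrow> X' (\<phi> y) = J y *v X y"
  shows "cjac X' (\<phi> x) ** J x = J x ** cjac X x + matD (X x) J x"
proof -
  have "(cjac X' (\<phi> x) ** J x) $ a $ i = (J x ** cjac X x + matD (X x) J x) $ a $ i" for a i
  proof -
    have "(cjac X' (\<phi> x) ** J x) $ a $ i = pd i (\<lambda>y. X' (\<phi> y) $ a) x"
      unfolding pd_chain_J[OF smooth_on_vec_nth[OF T(1) X(2)]] by (simp add: matrix_matrix_mult_def)
    also have "\<dots> = pd i (\<lambda>y. (J y *v X y) $ a) x"
      by (rule pd_cong[OF S]) (use X(3) smooth_on_imp_differentiable[OF smooth_on_vec_nth[OF S(1) smooth_on_comp_phi[OF X(2)]] S(2)] in auto)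
    also have "\<dots> = (J x ** cjac X x + matD (X x) J x) $ a $ i"
      by (simp add: matrix_vector_mult_def matrix_matrix_mult_def pd_simps[OF S] smooth_simps[OF S(1)] smooth_on_J X(1)
          ddir_def sum.distrib pd_J_symmetric[of i a] mult.commute)
    finally show ?thesis .
  qed
  then show ?thesis by (simp add: vec_eq_iff)
qed

text \<open>The correction dJ(X) Y arises once from differentiating Y' = J Y and once from the
  Jacobian of X', with opposite signs.\<close>

lemma lie_vec_pushforward:
  assumes X: "smooth_on S X" "smooth_on T X'" "\<And>y. y \<in> S \<Longrightarrow> X' (\<phi> y) = J y *v X y"
    and Y: "smooth_on S Y" "smooth_on T Y'" "\<And>y. y \<in> S \<Longrightarrow> Y' (\<phi> y) = J y *v Y y"
  shows "vecD (X' (\<phi> x)) Y' (\<phi> x) - cjac X' (\<phi> x) *v Y' (\<phi> x) = J x *v (vecD (X x) Y x - cjac X x *v Y x)"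
proof -
  have "vecD (X' (\<phi> x)) Y' (\<phi> x) = vecD (X x) (\<lambda>y. J y *v Y y) x"
    using vecD_chain[OF Y(2), of "X x"] vecD_cong[OF Y(3) smooth_on_comp_phi[OF Y(2)]] X(3)[OF S(2)] by simp
  also have "\<dots> = matD (X x) J x *v Y x + J x *v vecD (X x) Y x"
    by (rule vecD_mult_vec[OF S smooth_on_J Y(1)])
  finally have 1: "vecD (X' (\<phi> x)) Y' (\<phi> x) = matD (X x) J x *v Y x + J x *v vecD (X x) Y x" .
  have c: "cjac X' (\<phi> x) ** J x = J x ** cjac X x + matD (X x) J x"
    by (rule cjac_pushforward; fact X)
  have "cjac X' (\<phi> x) *v Y' (\<phi> x) = (J x ** cjac X x + matD (X x) J x) *v Y x"
    unfolding Y(3)[OF S(2)] matrix_vector_mul_assoc c ..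
  then show ?thesis unfolding 1
    by (simp add: matrix_vector_mult_add_rdistrib matrix_vector_mul_assoc matrix_vector_mult_diff_distrib)
qed

text \<open>Differentiating J^T w' J gives terms with dJ and its transpose, which are exactly the
  corrections of the two Jacobian terms.\<close>

lemma lie_two_form_pullback:
  assumes X: "smooth_on S X" "smooth_on T X'" "\<And>y. y \<in> S \<Longrightarrow> X' (\<phi> y) = J y *v X y"
    and w: "smooth_on S w" "smooth_on T w'" "\<And>y. y \<in> S \<Longrightarrow> w y = transpose (J y) ** w' (\<phi> y) ** J y"
  shows "matD (X x) w x + transpose (cjac X x) ** w x + w x ** cjac X x
    = transpose (J x) ** (matD (X' (\<phi> x)) w' (\<phi> x) + transpose (cjac X' (\<phi> x)) ** w' (\<phi> x)
        + w' (\<phi> x) ** cjac X' (\<phi> x)) ** J x"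
proof -
  let ?J = "J x" and ?dJ = "matD (X x) J x" and ?w = "w' (\<phi> x)"
  have dT: "matD v (\<lambda>y. transpose (J y)) x = transpose (matD v J x)" for v
    by (simp add: vec_eq_iff transpose_def)
  have sT: "smooth_on S (\<lambda>y. transpose (J y))" by (rule smooth_on_vec_ops(8)[OF S(1) smooth_on_J])
  have sw: "smooth_on S (\<lambda>y. w' (\<phi> y))" by (rule smooth_on_comp_phi[OF w(2)])
  have sTw: "smooth_on S (\<lambda>y. transpose (J y) ** w' (\<phi> y))" by (rule smooth_on_vec_ops(4)[OF S(1) sT sw])
  have "matD (X x) w x = matD (X x) (\<lambda>y. transpose (J y) ** w' (\<phi> y) ** J y) x"
    by (rule matD_cong[OF w(3) w(1)])
  also have "\<dots> = (transpose ?dJ ** ?w + transpose ?J ** matD (X' (\<phi> x)) w' (\<phi> x)) ** ?J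
      + transpose ?J ** ?w ** ?dJ"
    by (simp add: matD_mult[OF S sTw smooth_on_J] matD_mult[OF S sT sw] dT matD_chain[OF w(2)] X(3)[OF S(2)])
  finally have 1: "matD (X x) w x = (transpose ?dJ ** ?w + transpose ?J ** matD (X' (\<phi> x)) w' (\<phi> x)) ** ?J
      + transpose ?J ** ?w ** ?dJ" .
  have c: "cjac X' (\<phi> x) ** ?J = ?J ** cjac X x + ?dJ" by (rule cjac_pushforward; fact X)
  then have "transpose ?J ** transpose (cjac X' (\<phi> x)) = transpose (?J ** cjac X x + ?dJ)"
    by (simp add: matrix_transpose_mul[symmetric])
  also have "\<dots> = transpose (cjac X x) ** transpose ?J + transpose ?dJ"
    by (simp add: matrix_transpose_mul[symmetric]) (simp add: vec_eq_iff transpose_def)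
  finally have ct: "transpose ?J ** transpose (cjac X' (\<phi> x)) = transpose (cjac X x) ** transpose ?J + transpose ?dJ" .
  have "transpose ?J ** (matD (X' (\<phi> x)) w' (\<phi> x) + transpose (cjac X' (\<phi> x)) ** ?w + ?w ** cjac X' (\<phi> x)) ** ?J
    = transpose ?J ** matD (X' (\<phi> x)) w' (\<phi> x) ** ?J + (transpose ?J ** transpose (cjac X' (\<phi> x))) ** ?w ** ?J
     + transpose ?J ** ?w ** (cjac X' (\<phi> x) ** ?J)"
    by (simp add: matrix_add_ldistrib matrix_rdistribs matrix_mul_assoc)
  then show ?thesis unfolding c ct 1 w(3)[OF S(2)]
    by (simp add: matrix_add_ldistrib matrix_rdistribs matrix_mul_assoc)
qed

text \<open>Differentiating a = a' J yields a term in the second derivatives of \<phi>; it is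
  symmetric in the two indices and antisymmetrization removes it.\<close>

lemma ext_d_pullback:
  assumes a: "smooth_on S a" "smooth_on T a'" "\<And>y. y \<in> S \<Longrightarrow> a y = a' (\<phi> y) v* J y"
  shows "ext_d a x = transpose (J x) ** ext_d a' (\<phi> x) ** J x"
proof -
  have an: "smooth_on T (\<lambda>y. a' y $ b)" for b by (rule smooth_on_vec_nth[OF T(1) a(2)])
  have pa: "pd i (\<lambda>y. a y $ j) x = (\<Sum>b\<in>UNIV. (\<Sum>c\<in>UNIV. pd c (\<lambda>y. a' y $ b) (\<phi> x) * J x $ c $ i) * J x $ b $ j)
      + (\<Sum>b\<in>UNIV. a' (\<phi> x) $ b * pd i (\<lambda>y. J y $ b $ j) x)" for i j
  proof -
    have "pd i (\<lambda>y. a y $ j) x = pd i (\<lambda>y. (a' (\<phi> y) v* J y) $ j) x"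
      by (rule pd_cong[OF S]) (use a(3) smooth_on_imp_differentiable[OF smooth_on_vec_nth[OF S(1) a(1)] S(2)] in auto)
    then show ?thesis
      by (simp add: vector_matrix_mult_def pd_simps[OF S] smooth_simps[OF S(1)] smooth_on_J smooth_on_comp_phi[OF a(2)]
          pd_chain_J[OF an] sum.distrib mult.commute)
  qed
  have "(\<Sum>b\<in>UNIV. (\<Sum>c\<in>UNIV. pd b (\<lambda>y. a' y $ c) (\<phi> x) * J x $ b $ i * J x $ c $ j))
      = (\<Sum>b\<in>UNIV. (\<Sum>c\<in>UNIV. pd c (\<lambda>y. a' y $ b) (\<phi> x) * J x $ c $ i * J x $ b $ j))" for i j
    by (rule sum.swap)
  then show ?thesis
    by (simp add: vec_eq_iff ext_d_def pa matrix_matrix_mult_def transpose_def sum_distrib_left sum_distrib_right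
        sum_subtractf algebra_simps pd_J_symmetric)
qed

text \<open>By Jacobi's formula the logarithmic derivative of |det J|^l along X is l times the trace
  of dJ(X) J^-1, and \<open>cjac_pushforward\<close> shows this trace to be the difference of the
  two divergences.\<close>

lemma lie_density_pullback:
  assumes X: "smooth_on S X" "smooth_on T X'" "\<And>y. y \<in> S \<Longrightarrow> X' (\<phi> y) = J y *v X y"
    and f: "smooth_on S f" "smooth_on T f'" "\<And>y. y \<in> S \<Longrightarrow> f y = abs_powr l (det (J y)) * f' (\<phi> y)"
    and nz: "\<And>y. y \<in> S \<Longrightarrow> det (J y) \<noteq> 0" and real: "\<And>y. y \<in> S \<Longrightarrow> det (J y) \<in> \<real>"
  shows "ddir (X x) f x + of_real l * trace (cjac X x) * f x
    = abs_powr l (det (J x)) * (ddir (X' (\<phi> x)) f' (\<phi> x) + of_real l * trace (cjac X' (\<phi> x)) * f' (\<phi> x))"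
proof -
  let ?d = "\<lambda>y. abs_powr l (det (J y))"
  obtain B where B: "J x ** B = mat 1" "B ** J x = mat 1"
    using nz[OF S(2)] by (metis invertible_det_nz invertible_def)
  have sd: "smooth_on S ?d"
    by (rule smooth_on_abs_powr_comp[OF S(1) smooth_on_vec_ops(9)[OF S(1) smooth_on_J] real nz])
  have "ddir (X x) ?d x = of_real l * ?d x * ddir (X x) (\<lambda>y. det (J y)) x / det (J x)"
    by (rule ddir_abs_powr[OF S(1) smooth_on_vec_ops(9)[OF S(1) smooth_on_J] real nz S(2)])
  also have "\<dots> = of_real l * ?d x * trace (matD (X x) J x ** B)"
    using nz[OF S(2)] by (simp add: ddir_det[OF S smooth_on_J B(2)])
  also have "matD (X x) J x ** B = cjac X' (\<phi> x) - J x ** cjac X x ** B"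
  proof -
    have "cjac X' (\<phi> x) ** J x = J x ** cjac X x + matD (X x) J x"
      by (rule cjac_pushforward; fact X)
    then have "cjac X' (\<phi> x) ** J x ** B = (J x ** cjac X x + matD (X x) J x) ** B"
      by simp
    then show ?thesis by (simp add: matrix_mul_assoc[symmetric] B matrix_rdistribs)
  qed
  also have "trace (cjac X' (\<phi> x) - J x ** cjac X x ** B) = trace (cjac X' (\<phi> x)) - trace (B ** (J x ** cjac X x))"
    unfolding trace_sub by (simp only: trace_mul_sym[of "J x ** cjac X x" B])
  also have "B ** (J x ** cjac X x) = cjac X x"
    by (simp add: matrix_mul_assoc B)
  finally have 1: "ddir (X x) ?d x = of_real l * ?d x * (trace (cjac X' (\<phi> x)) - trace (cjac X x))" .
  have "ddir (X x) f x = ddir (X x) (\<lambda>y. ?d y * f' (\<phi> y)) x"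
    by (rule ddir_cong[OF S f(3) f(1)])
  also have "\<dots> = ?d x * ddir (X' (\<phi> x)) f' (\<phi> x) + ddir (X x) ?d x * f' (\<phi> x)"
    by (simp add: ddir_simps(4)[OF S sd smooth_on_comp_phi[OF f(2)]] ddir_chain_J[OF f(2)] X(3)[OF S(2)])
  finally show ?thesis unfolding 1 f(3)[OF S(2)] by (simp add: algebra_simps)
qed

end

section \<open>Charts and fields\<close>

lemma det_cmat: "det (cmat J) = complex_of_real (det J)"
  by (simp add: det_def)

lemma density_law_eq: "density_law l J f f' \<longleftrightarrow> f = abs_powr l (det (cmat J)) * f'"
  by (simp add: density_law_def abs_powr_def det_cmat)

declare split_paired_All [simp del] split_paired_Ex [simp del]

lemma D_zero [simp]: "ddir 0 f x = 0" "vecD 0 F x = 0" "matD 0 A x = 0"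
  by (simp_all add: ddir_def vec_eq_iff)

lemma matrix_zero_mult: "A ** 0 = 0" "0 ** A = 0"
  by (simp_all add: vec_eq_iff matrix_matrix_mult_def)

locale atlas =
  fixes A :: "('m::{t2_space,second_countable_topology}, 'd::finite) chart set"
  assumes atlas: "smooth_atlas A"
begin

lemma chart_cover: obtains c where "c \<in> A" "p \<in> dom_of c"
proof -
  have "p \<in> (\<Union>c\<in>A. dom_of c)" using atlas unfolding smooth_atlas_def by simp
  then show ?thesis using that by blast
qed

lemma open_dom: "c \<in> A \<Longrightarrow> open (dom_of c)"
  and open_img: "c \<in> A \<Longrightarrow> open (img_of c)"
  and chart_homeo: "c \<in> A \<Longrightarrow> homeomorphism (dom_of c) (img_of c) (crd c) (icrd c)"
  using atlas unfolding smooth_atlas_def by blast+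

lemma icrd_crd: "c \<in> A \<Longrightarrow> p \<in> dom_of c \<Longrightarrow> icrd c (crd c p) = p"
  using chart_homeo homeomorphism_apply1 by metis

lemma icrd_in_dom: "x \<in> img_of c \<Longrightarrow> icrd c x \<in> dom_of c"
  by (rule inv_into_into)

lemma crd_icrd: "x \<in> img_of c \<Longrightarrow> crd c (icrd c x) = x"
  by (rule f_inv_into_f)

lemma open_chart_image:
  assumes "c \<in> A" "open U"
  shows "open (crd c ` (dom_of c \<inter> U))"
proof -
  have "openin (top_of_set (img_of c)) (crd c ` (dom_of c \<inter> U))"
    by (rule homeomorphism_imp_open_map[OF chart_homeo[OF assms(1)]]) (use assms in \<open>auto simp: openin_open\<close>)
  then show ?thesis using open_img[OF assms(1)] openin_open_trans by blast
qed

lemma in_chart_image_iff: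
  assumes "c \<in> A"
  shows "x \<in> crd c ` (dom_of c \<inter> U) \<longleftrightarrow> x \<in> img_of c \<and> icrd c x \<in> U"
  using icrd_crd[OF assms] icrd_in_dom crd_icrd by (auto 4 3 simp: image_iff)

lemma transition_smooth:
  "c \<in> A \<Longrightarrow> c' \<in> A \<Longrightarrow> smooth_on (crd c ` (dom_of c \<inter> dom_of c')) (crd c' \<circ> icrd c)"
  using atlas unfolding smooth_atlas_def by blast

lemma cmat_jac:
  assumes c: "c \<in> A" "c' \<in> A" and p: "p \<in> dom_of c" "p \<in> dom_of c'"
  shows "cmat (jac c c' p) = cjac (\<lambda>y. cvec ((crd c' \<circ> icrd c) y)) (crd c p)"
proof -
  let ?\<phi> = "crd c' \<circ> icrd c" and ?x = "crd c p"
  have d: "(?\<phi> has_derivative frechet_derivative ?\<phi> (at ?x)) (at ?x)"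
    by (rule smooth_on_has_derivative[OF transition_smooth[OF c]]) (use p in auto)
  have "pd i (\<lambda>y. of_real (?\<phi> y $ a)) ?x = of_real (frechet_derivative ?\<phi> (at ?x) (axis i 1) $ a)" for a i
    using pd_eqI[OF bounded_linear.has_derivative[OF bounded_linear_of_real
          bounded_linear.has_derivative[OF bounded_linear_vec_nth d]]] .
  then show ?thesis by (simp add: vec_eq_iff jac_def matrix_def)
qed

text \<open>The chain rule. The direct change from c to c'' and the one through c' agree only where
  c' is defined, hence the passage to the open overlap.\<close>

lemma transition_cocycle:
  assumes c: "c \<in> A" "c' \<in> A" "c'' \<in> A" and p: "p \<in> dom_of c" "p \<in> dom_of c'" "p \<in> dom_of c''"
  shows "jac c c'' p = jac c' c'' p ** jac c c' p"
proof -
  let ?f = "crd c' \<circ> icrd c" and ?g = "crd c'' \<circ> icrd c'" and ?h = "crd c'' \<circ> icrd c" and ?x = "crd c p"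
  have fx: "?f ?x = crd c' p" using icrd_crd[OF c(1) p(1)] by simp
  have df: "(?f has_derivative frechet_derivative ?f (at ?x)) (at ?x)"
    by (rule smooth_on_has_derivative[OF transition_smooth[OF c(1,2)]]) (use p in auto)
  have dg: "(?g has_derivative frechet_derivative ?g (at (?f ?x))) (at (?f ?x))"
    unfolding fx by (rule smooth_on_has_derivative[OF transition_smooth[OF c(2,3)]]) (use p in auto)
  have "((\<lambda>y. ?g (?f y)) has_derivative (\<lambda>v. frechet_derivative ?g (at (?f ?x)) (frechet_derivative ?f (at ?x) v))) (at ?x)"
    by (rule has_derivative_compose[OF df dg])
  then have "(?h has_derivative (\<lambda>v. frechet_derivative ?g (at (?f ?x)) (frechet_derivative ?f (at ?x) v))) (at ?x)"
  proof (rule has_derivative_transform_within_open)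
    show "open (crd c ` (dom_of c \<inter> dom_of c'))" using open_chart_image c open_dom by blast
    show "?x \<in> crd c ` (dom_of c \<inter> dom_of c')" using p by auto
    show "?g (?f y) = ?h y" if "y \<in> crd c ` (dom_of c \<inter> dom_of c')" for y
      using that icrd_crd c by auto
  qed
  then have "frechet_derivative ?h (at ?x) = frechet_derivative ?g (at (?f ?x)) \<circ> frechet_derivative ?f (at ?x)"
    by (simp add: frechet_derivative_at[symmetric] comp_def)
  then show ?thesis
    using matrix_compose[OF has_derivative_linear[OF df] has_derivative_linear[OF dg]]
    unfolding jac_def fx by simp
qed

lemma jac_self:
  assumes c: "c \<in> A" and p: "p \<in> dom_of c"
  shows "jac c c p = mat 1"
proof -
  let ?x = "crd c p"
  have "((\<lambda>y. y) has_derivative (\<lambda>v. v)) (at ?x)" by (rule has_derivative_ident)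
  then have "((crd c \<circ> icrd c) has_derivative (\<lambda>v. v)) (at ?x)"
  proof (rule has_derivative_transform_within_open[OF _ open_img[OF c]])
    show "?x \<in> img_of c" using p by simp
    show "y = (crd c \<circ> icrd c) y" if "y \<in> img_of c" for y using crd_icrd[OF that] by simp
  qed
  then have "frechet_derivative (crd c \<circ> icrd c) (at ?x) = id"
    unfolding id_def by (rule frechet_derivative_at[symmetric])
  then show ?thesis unfolding jac_def by (simp only: matrix_id_mat_1)
qed

lemma jac_inverse:
  assumes "c \<in> A" "c' \<in> A" "p \<in> dom_of c" "p \<in> dom_of c'"
  shows "jac c' c p ** jac c c' p = mat 1"
  using transition_cocycle[of c c' c p] jac_self assms by simp

lemma det_jac_nonzero:
  assumes "c \<in> A" "c' \<in> A" "p \<in> dom_of c" "p \<in> dom_of c'"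
  shows "det (cmat (jac c c' p)) \<noteq> 0"
  using arg_cong[OF jac_inverse[OF assms], of det] by (auto simp: det_mul det_cmat)

end

text \<open>Supplies the data of the naturality statements: \<phi> is \<open>chg\<close> from
  \<open>src\<close> into \<open>tgt\<close>, and \<open>tjac\<close> its complexified Jacobian. The
  open set U is the domain of a local field such as a contact form, or \<open>UNIV\<close> for
  global fields.\<close>

locale transition = atlas A
  for A :: "('m::{t2_space,second_countable_topology}, 'd::finite) chart set" +
  fixes c c' :: "('m, 'd) chart" and U :: "'m set"
  assumes c: "c \<in> A" "c' \<in> A" and U: "open U"
begin

definition "src = crd c ` (dom_of c \<inter> (dom_of c' \<inter> U))"
definition "tgt = crd c' ` (dom_of c' \<inter> U)"
definition "chg = crd c' \<circ> icrd c"
definition "tjac y = cmat (jac c c' (icrd c y))"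

lemma src_iff: "y \<in> src \<longleftrightarrow> y \<in> img_of c \<and> icrd c y \<in> dom_of c' \<and> icrd c y \<in> U"
  unfolding src_def using in_chart_image_iff[OF c(1)] by auto

lemma open_src: "open src" and open_tgt: "open tgt"
  unfolding src_def tgt_def using c U open_dom open_chart_image by blast+

lemma src_subset: "src \<subseteq> crd c ` (dom_of c \<inter> U)"
  by (auto simp: src_def)

lemma trans_src: "chg ` src \<subseteq> tgt"
  using src_iff by (auto simp: chg_def tgt_def)

lemma smooth_on_trans: "smooth_on src chg"
  unfolding chg_def by (rule smooth_on_subset[OF transition_smooth[OF c]]) (auto simp: src_def)

lemma tjac_eq: "y \<in> src \<Longrightarrow> tjac y = cjac (\<lambda>y. cvec (chg y)) y"
  using cmat_jac[OF c, of "icrd c y"] by (simp add: src_iff icrd_in_dom crd_icrd tjac_def chg_def)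

lemma smooth_on_tjac: "smooth_on src tjac"
proof (rule smooth_on_cong[OF open_src tjac_eq[symmetric]])
  have "smooth_on src (\<lambda>y. complex_of_real (chg y $ a))" for a
    by (rule smooth_on_bounded_linear[OF bounded_linear_of_real open_src smooth_on_vec_nth[OF open_src smooth_on_trans]])
  then show "smooth_on src (cjac (\<lambda>y. cvec (chg y)))"
    by (intro smooth_on_derivs(1) smooth_on_vec open_src) simp
qed

lemma tjac_det: "y \<in> src \<Longrightarrow> det (tjac y) \<noteq> 0" "det (tjac y) \<in> \<real>"
  using det_jac_nonzero[OF c, of "icrd c y"] by (auto simp: src_iff icrd_in_dom tjac_def det_cmat)

lemma point_in_src: "p \<in> dom_of c \<Longrightarrow> p \<in> dom_of c' \<Longrightarrow> p \<in> U \<Longrightarrow> crd c p \<in> src"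
  by (auto simp: src_def)

lemma trans_point: "p \<in> dom_of c \<Longrightarrow> chg (crd c p) = crd c' p" "p \<in> dom_of c \<Longrightarrow> tjac (crd c p) = cmat (jac c c' p)"
  using icrd_crd[OF c(1)] by (auto simp: chg_def tjac_def)

lemma field_on_trans:
  assumes "field_on A U L s" "y \<in> src"
  shows "L (jac c c' (icrd c y)) (s c y) (s c' (chg y))"
proof -
  have "icrd c y \<in> dom_of c \<inter> dom_of c' \<inter> U" "crd c (icrd c y) = y"
    using assms(2) by (auto simp: src_iff icrd_in_dom crd_icrd)
  then show ?thesis using assms(1) c unfolding field_on_def chg_def comp_def by metis
qed

lemma field_on_smooth:
  assumes "field_on A U L s"
  shows "smooth_on src (s c)" "smooth_on tgt (s c')"
  using assms c src_subset smooth_on_subset unfolding field_on_def tgt_def by blast+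

lemma vec_chg:
  assumes "field_on A U vec_law X" "y \<in> src"
  shows "X c' (chg y) = tjac y *v X c y"
  using field_on_trans[OF assms] by (simp add: vec_law_def tjac_def)

lemma covec_chg:
  assumes "field_on A U covec_law a" "y \<in> src"
  shows "a c y = a c' (chg y) v* tjac y"
  using field_on_trans[OF assms] by (simp add: covec_law_def tjac_def)

lemma bilin_chg:
  assumes "field_on A U bilin_law w" "y \<in> src"
  shows "w c y = transpose (tjac y) ** w c' (chg y) ** tjac y"
  using field_on_trans[OF assms] by (simp add: bilin_law_def tjac_def)

lemma density_chg:
  assumes "field_on A U (density_law l) f" "y \<in> src"
  shows "f c y = abs_powr l (det (tjac y)) * f c' (chg y)"
  using field_on_trans[OF assms] by (simp add: density_law_eq tjac_def)

end

context atlas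
begin

lemma transitionI: "c \<in> A \<Longrightarrow> c' \<in> A \<Longrightarrow> open U \<Longrightarrow> transition A c c' U"
  by unfold_locales

lemma fields_iff:
  "s \<in> fields A L \<longleftrightarrow> field_on A UNIV L s \<and> (\<forall>c x. c \<notin> A \<or> x \<notin> img_of c \<longrightarrow> s c x = 0)"
  by (simp add: fields_def)

lemma fields_smooth: "s \<in> fields A L \<Longrightarrow> c \<in> A \<Longrightarrow> smooth_on (img_of c) (s c)"
  by (auto simp: fields_def field_on_def)

lemma fields_outside: "s \<in> fields A L \<Longrightarrow> c \<notin> A \<or> x \<notin> img_of c \<Longrightarrow> s c x = 0"
  by (simp add: fields_def)

lemma fieldsI:
  assumes "\<And>c. c \<in> A \<Longrightarrow> smooth_on (img_of c) (s c)"
    and "\<And>c c' p. c \<in> A \<Longrightarrow> c' \<in> A \<Longrightarrow> p \<in> dom_of c \<Longrightarrow> p \<in> dom_of c' \<Longrightarrow>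
      L (jac c c' p) (s c (crd c p)) (s c' (crd c' p))"
    and "\<And>c x. c \<notin> A \<or> x \<notin> img_of c \<Longrightarrow> s c x = 0"
  shows "s \<in> fields A L"
  using assms by (auto simp: fields_def field_on_def)

lemma lie_vec_in_vector_fields:
  assumes X: "X \<in> vector_fields A" and Y: "Y \<in> vector_fields A"
  shows "lie_vec X Y \<in> vector_fields A"
  unfolding vector_fields_def
proof (rule fieldsI)
  note XY = X[unfolded vector_fields_def] Y[unfolded vector_fields_def]
  show "smooth_on (img_of c) (lie_vec X Y c)" if "c \<in> A" for c
    unfolding lie_vec_eq[abs_def]
    by (intro smooth_on_diff smooth_on_derivs smooth_on_vec_ops open_img fields_smooth[OF XY(1)] fields_smooth[OF XY(2)] that)
  \<comment> \<open>Off the chart both values are 0, and a derivative in direction 0 vanishes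
    whatever the components do near that point, for instance at the boundary of the image.\<close>
  show "lie_vec X Y c x = 0" if "c \<notin> A \<or> x \<notin> img_of c" for c x
    using fields_outside[OF XY(1) that] fields_outside[OF XY(2) that]
    by (simp add: lie_vec_eq)
  fix c c' p assume *: "c \<in> A" "c' \<in> A" "p \<in> dom_of c" "p \<in> dom_of c'"
  interpret transition A c c' UNIV by (rule transitionI) (use * in auto)
  have f: "field_on A UNIV vec_law X" "field_on A UNIV vec_law Y" using XY by (auto simp only: fields_iff)
  note l = vec_chg[OF f(1)] vec_chg[OF f(2)]
  have sm: "smooth_on src (X c)" "smooth_on tgt (X c')" "smooth_on src (Y c)" "smooth_on tgt (Y c')"
    using field_on_smooth[OF f(1)] field_on_smooth[OF f(2)] by blast+
  have x: "crd c p \<in> src" using * point_in_src by simp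
  show "vec_law (jac c c' p) (lie_vec X Y c (crd c p)) (lie_vec X Y c' (crd c' p))"
    using lie_vec_pushforward[OF open_src x open_tgt trans_src smooth_on_trans tjac_eq sm(1,2) l(1) sm(3,4) l(2)] *
    by (simp add: vec_law_def lie_vec_eq trans_point)
qed

lemma lie_two_form_in_two_forms:
  assumes X: "X \<in> vector_fields A" and w: "w \<in> two_forms A"
  shows "lie_two_form X w \<in> two_forms A"
proof -
  have skew: "w c y $ i $ j = - w c y $ j $ i" for c y i j using w unfolding two_forms_def by blast
  have Xw: "X \<in> fields A vec_law" "w \<in> fields A bilin_law"
    using X w unfolding vector_fields_def two_forms_def by blast+
  have out: "lie_two_form X w c x = 0" if "c \<notin> A \<or> x \<notin> img_of c" for c x
    using fields_outside[OF Xw(1) that] fields_outside[OF Xw(2) that]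
    by (simp add: lie_two_form_eq matrix_zero_mult)
  have "lie_two_form X w \<in> fields A bilin_law"
  proof (rule fieldsI)
    show "smooth_on (img_of c) (lie_two_form X w c)" if "c \<in> A" for c
      unfolding lie_two_form_eq[abs_def]
      by (intro smooth_on_add smooth_on_derivs smooth_on_vec_ops open_img fields_smooth[OF Xw(1)] fields_smooth[OF Xw(2)] that)
    show "lie_two_form X w c x = 0" if "c \<notin> A \<or> x \<notin> img_of c" for c x by (rule out[OF that])
    fix c c' p assume *: "c \<in> A" "c' \<in> A" "p \<in> dom_of c" "p \<in> dom_of c'"
    interpret transition A c c' UNIV by (rule transitionI) (use * in auto)
    have f: "field_on A UNIV vec_law X" "field_on A UNIV bilin_law w" using Xw by (auto simp only: fields_iff)
    note l = vec_chg[OF f(1)] bilin_chg[OF f(2)]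
    have sm: "smooth_on src (X c)" "smooth_on tgt (X c')" "smooth_on src (w c)" "smooth_on tgt (w c')"
      using field_on_smooth[OF f(1)] field_on_smooth[OF f(2)] by blast+
    have x: "crd c p \<in> src" using * point_in_src by simp
    show "bilin_law (jac c c' p) (lie_two_form X w c (crd c p)) (lie_two_form X w c' (crd c' p))"
      using lie_two_form_pullback[OF open_src x open_tgt trans_src smooth_on_trans tjac_eq sm(1,2) l(1) sm(3,4) l(2)] *
      by (simp add: bilin_law_def lie_two_form_eq trans_point)
  qed
  \<comment> \<open>\<open>two_forms\<close> demands skewness at every c and x, so points outside
    the charts are treated as well.\<close>
  moreover have "lie_two_form X w c x $ i $ j = - lie_two_form X w c x $ j $ i" for c x i j
  proof (cases "c \<in> A \<and> x \<in> img_of c")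
    case True
    have sm: "smooth_on (img_of c) (w c)" using True fields_smooth[OF Xw(2)] by blast
    have sk: "matD (X c x) (w c) x $ i $ j = - matD (X c x) (w c) x $ j $ i" for i j
    proof -
      have "(\<lambda>y. w c y $ i $ j) = (\<lambda>y. - w c y $ j $ i)" by (rule ext) (rule skew)
      then show ?thesis
        using ddir_simps(5)[OF open_img _ smooth_on_nth_iff(2)[OF open_img sm]] True by simp
    qed
    have d: "transpose (matD (X c x) (w c) x) = - matD (X c x) (w c) x"
      by (simp add: vec_eq_iff transpose_def del: matD_nth) (intro allI sk)
    have wT: "transpose (w c x) = - w c x"
      by (simp add: vec_eq_iff transpose_def) (intro allI skew)
    have tr: "transpose (A + B) = transpose A + transpose B" "(- A) ** B = - (A ** B)" "B ** (- A) = - (B ** A)"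
      for A B :: "complex^'d^'d"
      by (simp_all add: vec_eq_iff transpose_def matrix_matrix_mult_def sum_negf)
    have "transpose (lie_two_form X w c x) = - lie_two_form X w c x"
      by (simp add: lie_two_form_eq tr(1) d matrix_transpose_mul wT tr(2,3))
    then have "transpose (lie_two_form X w c x) $ j $ i = (- lie_two_form X w c x) $ j $ i" by simp
    then show ?thesis by (simp add: transpose_def)
  next
    case False
    then have "lie_two_form X w c x = 0" using out by blast
    then show ?thesis by simp
  qed
  ultimately show ?thesis unfolding two_forms_def by blast
qed

lemma lie_density_in_densities:
  assumes X: "X \<in> vector_fields A" and f: "f \<in> densities A l"
  shows "lie_density l X f \<in> densities A l"
  unfolding densities_def
proof (rule fieldsI)
  note Xf = X[unfolded vector_fields_def] f[unfolded densities_def]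
  show "smooth_on (img_of c) (lie_density l X f c)" if "c \<in> A" for c
    unfolding lie_density_eq[abs_def]
    by (intro smooth_on_add smooth_on_mult smooth_on_const smooth_on_derivs smooth_on_vec_ops open_img
        fields_smooth[OF Xf(1)] fields_smooth[OF Xf(2)] that)
  show "lie_density l X f c x = 0" if "c \<notin> A \<or> x \<notin> img_of c" for c x
    using fields_outside[OF Xf(1) that] fields_outside[OF Xf(2) that]
    by (simp add: lie_density_eq)
  fix c c' p assume *: "c \<in> A" "c' \<in> A" "p \<in> dom_of c" "p \<in> dom_of c'"
  interpret transition A c c' UNIV by (rule transitionI) (use * in auto)
  have f: "field_on A UNIV vec_law X" "field_on A UNIV (density_law l) f" using Xf by (auto simp only: fields_iff)
  note l = vec_chg[OF f(1)] density_chg[OF f(2)]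
  have sm: "smooth_on src (X c)" "smooth_on tgt (X c')" "smooth_on src (f c)" "smooth_on tgt (f c')"
    using field_on_smooth[OF f(1)] field_on_smooth[OF f(2)] by blast+
  have x: "crd c p \<in> src" using * point_in_src by simp
  show "density_law l (jac c c' p) (lie_density l X f c (crd c p)) (lie_density l X f c' (crd c' p))"
    using lie_density_pullback[OF open_src x open_tgt trans_src smooth_on_trans tjac_eq sm(1,2) l(1) sm(3,4) l(2)
      tjac_det] *
    by (simp add: density_law_eq lie_density_eq trans_point)
qed

end

section \<open>A nowhere vanishing density\<close>

lemma smooth_on_inner:
  fixes f g :: "'a::real_normed_vector \<Rightarrow> 'b::real_inner"
  shows "open S \<Longrightarrow> smooth_on S f \<Longrightarrow> smooth_on S g \<Longrightarrow> smooth_on S (\<lambda>x. f x \<bullet> g x)"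
  by (simp add: smooth_on_def Ck_on_bilinear[OF bounded_bilinear_inner])

lemma smooth_on_imp_continuous_on: "smooth_on S f \<Longrightarrow> continuous_on S f"
  unfolding smooth_on_def by (metis Ck_on.simps(1))

lemma smooth_on_flat_exp_comp:
  "open S \<Longrightarrow> smooth_on S f \<Longrightarrow> smooth_on S (\<lambda>x. flat_exp m (f x))"
  using smooth_on_compose[OF _ smooth_on_flat_exp] by blast

context atlas
begin

definition smooth_real :: "('m \<Rightarrow> real) \<Rightarrow> bool" where
  "smooth_real f \<longleftrightarrow> (\<forall>c\<in>A. smooth_on (img_of c) (\<lambda>x. f (icrd c x)))"

lemma smooth_real_continuous:
  assumes "smooth_real f"
  shows "continuous_on UNIV f"
proof (rule continuous_at_imp_continuous_on, rule ballI)
  fix p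
  obtain c where c: "c \<in> A" "p \<in> dom_of c" by (rule chart_cover)
  have "continuous_on (img_of c) (\<lambda>x. f (icrd c x))"
    using assms c smooth_on_imp_continuous_on unfolding smooth_real_def by blast
  moreover have "continuous_on (dom_of c) (crd c)"
    using chart_homeo[OF c(1)] by (simp add: homeomorphism_def)
  ultimately have "continuous_on (dom_of c) (\<lambda>q. f (icrd c (crd c q)))"
    by (rule continuous_on_compose2) auto
  then have "continuous_on (dom_of c) f"
    by (rule continuous_on_cong[THEN iffD1, rotated -1]) (auto simp: icrd_crd[OF c(1)])
  then show "isCont f p"
    using c open_dom by (simp add: continuous_on_eq_continuous_at)
qed

text \<open>The flat function of r^2 - |x - x0|^2 in a chart, extended by 0. It is smooth across the
  edge of the chart because it vanishes off the preimage of a closed ball, which is compact and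
  hence closed in a Hausdorff space.\<close>

lemma bump_exists:
  obtains c K f where "c \<in> A" "closed K" "K \<subseteq> dom_of c" "smooth_real f"
    "\<And>q. f q \<ge> 0" "f p > 0" "\<And>q. q \<notin> K \<Longrightarrow> f q = 0"
proof -
  obtain c where c: "c \<in> A" "p \<in> dom_of c" by (rule chart_cover)
  let ?x0 = "crd c p"
  obtain r where r: "r > 0" "cball ?x0 r \<subseteq> img_of c"
    using open_img[OF c(1)] c(2) by (meson imageI open_contains_cball_eq)
  define f where "f = (\<lambda>q. if q \<in> dom_of c then flat_exp 0 (r\<^sup>2 - (crd c q - ?x0) \<bullet> (crd c q - ?x0)) else 0)"
  define K where "K = icrd c ` cball ?x0 r"
  have Kc: "closed K" unfolding K_def
  proof (rule compact_imp_closed, rule compact_continuous_image)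
    have "continuous_on (img_of c) (icrd c)" using chart_homeo[OF c(1)] by (simp add: homeomorphism_def)
    then show "continuous_on (cball ?x0 r) (icrd c)" using r(2) by (rule continuous_on_subset)
  qed simp
  have Kd: "K \<subseteq> dom_of c" unfolding K_def
    by (rule image_subsetI, rule icrd_in_dom, rule subsetD[OF r(2)])
  have out: "f q = 0" if "q \<notin> K" for q
  proof (cases "q \<in> dom_of c")
    case True
    have "crd c q \<notin> cball ?x0 r"
    proof
      assume "crd c q \<in> cball ?x0 r"
      then have "icrd c (crd c q) \<in> K" unfolding K_def by blast
      then show False using that icrd_crd[OF c(1) True] by simp
    qed
    then have "r < norm (crd c q - ?x0)" by (simp add: dist_norm norm_minus_commute)
    then have "r\<^sup>2 < (norm (crd c q - ?x0))\<^sup>2" using r(1) by (intro power_strict_mono) auto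
    then show ?thesis using True by (simp add: f_def flat_exp_def power2_norm_eq_inner)
  qed (simp add: f_def)
  have sm: "smooth_real f" unfolding smooth_real_def
  proof (intro ballI smooth_on_local)
    fix c' y assume c': "c' \<in> A" and y: "y \<in> img_of c'"
    show "\<exists>V. open V \<and> y \<in> V \<and> smooth_on V (\<lambda>x. f (icrd c' x))"
    proof (cases "icrd c' y \<in> dom_of c")
      case True
      interpret transition A c' c UNIV by (rule transitionI) (use c c' in auto)
      have "smooth_on src (\<lambda>z. flat_exp 0 (r\<^sup>2 - (chg z - ?x0) \<bullet> (chg z - ?x0)))"
        by (intro smooth_on_flat_exp_comp smooth_on_diff smooth_on_inner smooth_on_const smooth_on_trans open_src)
      then have "smooth_on src (\<lambda>x. f (icrd c' x))"
        by (rule smooth_on_cong[OF open_src, rotated]) (simp add: src_iff f_def chg_def)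
      moreover have "y \<in> src" using True y by (simp add: src_iff)
      ultimately show ?thesis using open_src by blast
    next
      case False
      then have "icrd c' y \<in> - K" using Kd by blast
      then have "y \<in> crd c' ` (dom_of c' \<inter> - K)" using y by (simp add: in_chart_image_iff[OF c'])
      moreover have o: "open (crd c' ` (dom_of c' \<inter> - K))" using Kc by (intro open_chart_image c') auto
      moreover have "smooth_on (crd c' ` (dom_of c' \<inter> - K)) (\<lambda>x. f (icrd c' x))"
        by (rule smooth_on_cong[OF o _ smooth_on_const[OF o, of 0]])
          (use out in \<open>auto simp: in_chart_image_iff[OF c'] simp del: image_Int_subset\<close>)
      ultimately show ?thesis by blast
    qed
  qed
  have nn: "f q \<ge> 0" for q by (simp add: f_def flat_exp_nonneg)
  have pos: "f p > 0" using c r by (simp add: f_def flat_exp_pos_iff)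
  show ?thesis by (rule that[OF c(1) Kc Kd sm nn pos out])
qed

text \<open>The open sets where the bumps are positive cover the manifold; second countability
  yields a countable subcover by the Lindelof property.\<close>

lemma countable_bumps:
  obtains c K f where "\<And>k::nat. c k \<in> A" "\<And>k. closed (K k)" "\<And>k. K k \<subseteq> dom_of (c k)" "\<And>k. smooth_real (f k)"
    "\<And>k q. f k q \<ge> (0::real)" "\<And>k q. q \<notin> K k \<Longrightarrow> f k q = 0" "\<And>q. \<exists>k. f k q > 0"
proof -
  have "\<exists>c K f. c \<in> A \<and> closed K \<and> K \<subseteq> dom_of c \<and> smooth_real f \<and> (\<forall>q. f q \<ge> 0) \<and> f p > 0 \<and> (\<forall>q. q \<notin> K \<longrightarrow> f q = 0)" for p
    using bump_exists[of p] by metis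
  then obtain c K f where *: "\<And>p. c p \<in> A \<and> closed (K p) \<and> K p \<subseteq> dom_of (c p) \<and> smooth_real (f p) \<and>
      (\<forall>q. f p q \<ge> 0) \<and> f p p > 0 \<and> (\<forall>q. q \<notin> K p \<longrightarrow> f p q = 0)"
    by metis
  define G where "G = (\<lambda>p. {q. f p q > 0})"
  have "open (G p)" for p
  proof -
    have "open (f p -` {0<..} \<inter> UNIV)"
      by (rule continuous_on_open_vimage[THEN iffD1, rule_format, OF open_UNIV smooth_real_continuous])
        (use * in auto)
    moreover have "f p -` {0<..} \<inter> UNIV = G p" by (auto simp: G_def)
    ultimately show ?thesis by simp
  qed
  then have op: "\<And>S. S \<in> range G \<Longrightarrow> open S" by auto
  obtain F where F: "F \<subseteq> range G" "countable F" "\<Union>F = \<Union>(range G)"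
    by (rule Lindelof[OF op])
  then obtain P where P: "countable P" "F = G ` P"
    using countable_subset_image[of F G UNIV] by auto
  have "p \<in> \<Union>(range G)" for p using * by (auto simp: G_def)
  then have cover: "\<exists>p\<in>P. f p q > 0" for q using F(3) P(2) by (auto simp: G_def set_eq_iff)
  then have "P \<noteq> {}" by blast
  then have rng: "range (from_nat_into P) = P" using P(1) by (rule range_from_nat_into)
  show ?thesis
  proof (rule that[of "\<lambda>k. c (from_nat_into P k)" "\<lambda>k. K (from_nat_into P k)" "\<lambda>k. f (from_nat_into P k)"])
    show "\<exists>k. f (from_nat_into P k) q > 0" for q using cover[of q] rng by (metis rangeE)
  qed (use * in auto)
qed

text \<open>The factors with index \<open>j < k\<close> cut off the \<open>k\<close>-th bump function where an earlier one exceeds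
  \<open>1 / (k + 1)\<close>; this makes the family locally finite without using local compactness.\<close>

lemma locally_finite_bumps:
  obtains c K g where "\<And>k::nat. c k \<in> A" "\<And>k. closed (K k)" "\<And>k. K k \<subseteq> dom_of (c k)" "\<And>k. smooth_real (g k)"
    "\<And>k q. g k q \<ge> (0::real)" "\<And>k q. q \<notin> K k \<Longrightarrow> g k q = 0" "\<And>q. \<exists>k. g k q > 0"
    "\<And>q. \<exists>U N. open U \<and> q \<in> U \<and> (\<forall>q'\<in>U. \<forall>k\<ge>N. g k q' = 0)"
proof -
  obtain c K f where f: "\<And>k::nat. c k \<in> A" "\<And>k. closed (K k)" "\<And>k. K k \<subseteq> dom_of (c k)" "\<And>k. smooth_real (f k)"
    "\<And>k q. f k q \<ge> (0::real)" "\<And>k q. q \<notin> K k \<Longrightarrow> f k q = 0" "\<And>q. \<exists>k. f k q > 0"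
    using countable_bumps by metis
  define g where "g = (\<lambda>k q. f k q * (\<Prod>j<k. flat_exp 0 (1 / (real k + 1) - f j q)))"
  have sm: "smooth_real (g k)" for k
    unfolding smooth_real_def g_def
    using f(4) by (auto simp: smooth_real_def intro!: smooth_on_mult smooth_on_prod smooth_on_flat_exp_comp
        smooth_on_diff smooth_on_const open_img)
  have pos: "\<exists>k. g k q > 0" for q
  proof -
    \<comment> \<open>At the first index whose bump is positive at q, all earlier bumps vanish at q,
      so every cut-off factor is positive there.\<close>
    define k where "k = (LEAST k. f k q > 0)"
    have k: "f k q > 0" unfolding k_def using f(7) by (rule LeastI_ex)
    have "f j q = 0" if "j < k" for j
      using not_less_Least[of j "\<lambda>k. f k q > 0"] that f(5)[of j q] unfolding k_def by simp
    then have "g k q > 0" using k by (auto simp: g_def flat_exp_pos_iff intro!: mult_pos_pos prod_pos)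
    then show ?thesis by blast
  qed
  have fin: "\<exists>U N. open U \<and> q \<in> U \<and> (\<forall>q'\<in>U. \<forall>k\<ge>N. g k q' = 0)" for q
  proof -
    obtain m where m: "f m q > 0" using f(7) by blast
    \<comment> \<open>Half of a positive value: on the neighbourhood U bump m stays above e, so as
      soon as 1 / (k + 1) < e and m < k, the factor with index m kills the k-th function.\<close>
    define e where "e = f m q / 2"
    have e: "e > 0" "e < f m q" using m by (auto simp: e_def)
    define U where "U = f m -` {e<..} \<inter> UNIV"
    have "open U" unfolding U_def
      by (rule continuous_on_open_vimage[THEN iffD1, rule_format, OF open_UNIV smooth_real_continuous[OF f(4)]]) auto
    moreover have "q \<in> U" using e by (simp add: U_def)
    moreover obtain N where N: "inverse (real (Suc N)) < e" using reals_Archimedean[OF e(1)] by blast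
    have "g k q' = 0" if "q' \<in> U" "max N (Suc m) \<le> k" for q' k
    proof -
      have "1 / (real k + 1) \<le> inverse (real (Suc N))"
        using that(2) by (simp add: divide_inverse)
      then have "1 / (real k + 1) - f m q' \<le> 0" using that(1) N by (simp add: U_def)
      then have "flat_exp 0 (1 / (real k + 1) - f m q') = 0" by (simp add: flat_exp_def)
      moreover have "m \<in> {..<k}" using that(2) by simp
      ultimately have "(\<Prod>j<k. flat_exp 0 (1 / (real k + 1) - f j q')) = 0"
        by (meson finite_lessThan prod_zero)
      then show ?thesis by (simp add: g_def)
    qed
    ultimately show ?thesis by blast
  qed
  have nn: "g k q \<ge> 0" for k q by (simp add: g_def f(5) flat_exp_nonneg prod_nonneg)
  have out: "g k q = 0" if "q \<notin> K k" for k q using f(6)[OF that] by (simp add: g_def)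
  show ?thesis by (rule that[OF f(1-3) sm nn out pos fin])
qed

text \<open>The coordinate densities |dx|^l of the charts \<open>c k\<close> are weighted by the
  bumps and summed. Every summand transforms correctly by the cocycle rule, and the sum cannot
  vanish because nonnegative terms do not cancel.\<close>

lemma positive_density_exists:
  obtains \<mu> where "\<mu> \<in> densities A l" "\<And>c x. c \<in> A \<Longrightarrow> x \<in> img_of c \<Longrightarrow> \<mu> c x \<noteq> 0"
proof -
  obtain c K g where g: "\<And>k::nat. c k \<in> A" "\<And>k. closed (K k)" "\<And>k. K k \<subseteq> dom_of (c k)" "\<And>k. smooth_real (g k)"
    "\<And>k q. g k q \<ge> (0::real)" "\<And>k q. q \<notin> K k \<Longrightarrow> g k q = 0" "\<And>q. \<exists>k. g k q > 0"
    "\<And>q. \<exists>U N. open U \<and> q \<in> U \<and> (\<forall>q'\<in>U. \<forall>k\<ge>N. g k q' = 0)"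
    using locally_finite_bumps by metis
  \<comment> \<open>Outside the domain of \<open>c k\<close> the Jacobian is meaningless, but there
    the bump is 0.\<close>
  define D where "D = (\<lambda>k b q. g k q * \<bar>det (jac b (c k) q)\<bar> powr l)"
  define s where "s = (\<lambda>b q. \<Sum>k | g k q \<noteq> 0. D k b q)"
  define \<mu> where "\<mu> = (\<lambda>b x. if b \<in> A \<and> x \<in> img_of b then complex_of_real (s b (icrd b x)) else 0)"
  have fin: "finite {k. g k q \<noteq> 0}" for q
  proof -
    obtain N where "\<forall>k\<ge>N. g k q = 0" using g(8)[of q] by blast
    then have "{k. g k q \<noteq> 0} \<subseteq> {..<N}" by (metis (mono_tags, lifting) lessThan_iff mem_Collect_eq not_le subsetI)
    then show ?thesis using finite_subset by blast
  qed
  have in_dom: "q \<in> dom_of (c k)" if "g k q \<noteq> 0" for k q using that g(3,6) by blast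
  have s_pos: "s b q > 0" if b: "b \<in> A" "q \<in> dom_of b" for b q
  proof -
    have "D k b q > 0" if "g k q \<noteq> 0" for k
    proof -
      have "det (jac b (c k) q) \<noteq> 0"
        using det_jac_nonzero[OF b(1) g(1) b(2) in_dom[OF that]] by (auto simp: det_cmat)
      then show ?thesis using that g(5)[of k q] by (auto simp: D_def intro!: mult_pos_pos)
    qed
    moreover have "{k. g k q \<noteq> 0} \<noteq> {}" using g(7)[of q] by force
    ultimately show ?thesis unfolding s_def using fin by (intro sum_pos) auto
  qed
  have D_smooth: "smooth_on (img_of b) (\<lambda>x. complex_of_real (D k b (icrd b x)))" if b: "b \<in> A" for b k
  proof (rule smooth_on_local)
    fix y assume y: "y \<in> img_of b"
    show "\<exists>V. open V \<and> y \<in> V \<and> smooth_on V (\<lambda>x. complex_of_real (D k b (icrd b x)))"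
    proof (cases "icrd b y \<in> dom_of (c k)")
      case True
      interpret transition A b "c k" UNIV by (rule transitionI) (use b g(1) in auto)
      have "src \<subseteq> img_of b" by (auto simp: src_def)
      then have "smooth_on src (\<lambda>x. complex_of_real (g k (icrd b x)))"
        using g(4)[of k] b smooth_on_bounded_linear[OF bounded_linear_of_real open_src] smooth_on_subset
        unfolding smooth_real_def by metis
      moreover have "smooth_on src (\<lambda>x. abs_powr l (det (tjac x)))"
        by (rule smooth_on_abs_powr_comp[OF open_src smooth_on_vec_ops(9)[OF open_src smooth_on_tjac] tjac_det(2) tjac_det(1)])
      ultimately have "smooth_on src (\<lambda>x. complex_of_real (g k (icrd b x)) * abs_powr l (det (tjac x)))"
        by (rule smooth_on_mult[OF open_src])
      moreover have "(\<lambda>x. complex_of_real (g k (icrd b x)) * abs_powr l (det (tjac x)))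
          = (\<lambda>x. complex_of_real (D k b (icrd b x)))"
        by (simp add: D_def tjac_def abs_powr_def det_cmat)
      moreover have "y \<in> src" using True y by (simp add: src_iff)
      ultimately show ?thesis using open_src by metis
    next
      case False
      then have "icrd b y \<in> - K k" using g(3) by blast
      then have "y \<in> crd b ` (dom_of b \<inter> - K k)" using y by (simp add: in_chart_image_iff[OF b])
      moreover have o: "open (crd b ` (dom_of b \<inter> - K k))" using g(2) by (intro open_chart_image b) auto
      moreover have "smooth_on (crd b ` (dom_of b \<inter> - K k)) (\<lambda>x. complex_of_real (D k b (icrd b x)))"
      proof (rule smooth_on_cong[OF o _ smooth_on_const[OF o, of 0]])
        fix x assume "x \<in> crd b ` (dom_of b \<inter> - K k)"
        then have "icrd b x \<notin> K k" unfolding in_chart_image_iff[OF b] by simp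
        then show "0 = complex_of_real (D k b (icrd b x))" using g(6) by (simp add: D_def)
      qed
      ultimately show ?thesis by blast
    qed
  qed
  have "\<mu> \<in> densities A l" unfolding densities_def
  proof (rule fieldsI)
    fix b assume b: "b \<in> A"
    show "smooth_on (img_of b) (\<mu> b)"
    proof (rule smooth_on_local)
      fix y assume y: "y \<in> img_of b"
      obtain U N where U: "open U" "icrd b y \<in> U" "\<forall>q'\<in>U. \<forall>k\<ge>N. g k q' = 0" using g(8) by blast
      let ?V = "crd b ` (dom_of b \<inter> U)"
      have V: "open ?V" "y \<in> ?V" using U y open_chart_image[OF b] by (auto simp: in_chart_image_iff[OF b])
      have "?V \<subseteq> img_of b" by auto
      then have "smooth_on ?V (\<lambda>x. \<Sum>k<N. complex_of_real (D k b (icrd b x)))"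
        using D_smooth[OF b] smooth_on_subset by (intro smooth_on_sum V) blast
      then have "smooth_on ?V (\<mu> b)"
      proof (rule smooth_on_cong[OF V(1), rotated])
        fix x assume "x \<in> ?V"
        then have x: "x \<in> img_of b" "icrd b x \<in> U" unfolding in_chart_image_iff[OF b] by auto
        have "s b (icrd b x) = (\<Sum>k<N. D k b (icrd b x))"
          unfolding s_def
        proof (rule sum.mono_neutral_left)
          show "{k. g k (icrd b x) \<noteq> 0} \<subseteq> {..<N}"
            using U(3) x(2) by (metis (mono_tags, lifting) lessThan_iff mem_Collect_eq not_le subsetI)
        qed (auto simp: D_def)
        then show "(\<Sum>k<N. complex_of_real (D k b (icrd b x))) = \<mu> b x"
          using x b by (simp add: \<mu>_def)
      qed
      then show "\<exists>V. open V \<and> y \<in> V \<and> smooth_on V (\<mu> b)" using V by blast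
    qed
  next
    show "\<mu> b x = 0" if "b \<notin> A \<or> x \<notin> img_of b" for b x using that by (auto simp: \<mu>_def)
    fix b b' p assume b: "b \<in> A" "b' \<in> A" "p \<in> dom_of b" "p \<in> dom_of b'"
    have "D k b p = \<bar>det (jac b b' p)\<bar> powr l * D k b' p" if "g k p \<noteq> 0" for k
      using transition_cocycle[OF b(1,2) g(1) b(3,4) in_dom[OF that]]
      by (simp add: D_def det_mul abs_mult powr_mult mult_ac)
    then have "s b p = \<bar>det (jac b b' p)\<bar> powr l * s b' p"
      by (simp add: s_def sum_distrib_left)
    then show "density_law l (jac b b' p) (\<mu> b (crd b p)) (\<mu> b' (crd b' p))"
      using b by (simp add: density_law_def \<mu>_def icrd_crd)
  qed
  moreover have "\<mu> b x \<noteq> 0" if "b \<in> A" "x \<in> img_of b" for b x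
    using that s_pos[OF that(1) icrd_in_dom[OF that(2)]] by (simp add: \<mu>_def)
  ultimately show ?thesis by (rule that)
qed

end

section \<open>Tensor product with a free module of rank one\<close>

text \<open>The axioms describe N through a generator \<mu> and a coordinate map d. The aim is to
  replace cosets in the tensor product by elements of M, through x \<otimes> y = d(y) x \<otimes>
  \<mu>.\<close>

locale tensor_rank_one = Module.module R M
  for R :: "('r, 'k) ring_scheme" (structure) and M :: "('r, 'a, 'p) module_scheme" (structure) +
  fixes N :: "('r, 'b, 'q) module_scheme" and \<mu> :: 'b and d :: "'b \<Rightarrow> 'r"
  assumes gen: "\<mu> \<in> carrier N" and coord: "\<And>y. y \<in> carrier N \<Longrightarrow> d y \<in> carrier R"
    and coord_gen: "\<And>y. y \<in> carrier N \<Longrightarrow> d y \<odot>\<^bsub>N\<^esub> \<mu> = y" "d \<mu> = \<one>\<^bsub>R\<^esub>"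
    and add_N: "\<And>y y'. y \<in> carrier N \<Longrightarrow> y' \<in> carrier N \<Longrightarrow> y \<oplus>\<^bsub>N\<^esub> y' \<in> carrier N"
      "\<And>y y'. y \<in> carrier N \<Longrightarrow> y' \<in> carrier N \<Longrightarrow> d (y \<oplus>\<^bsub>N\<^esub> y') = d y \<oplus>\<^bsub>R\<^esub> d y'"
    and smult_N: "\<And>r y. r \<in> carrier R \<Longrightarrow> y \<in> carrier N \<Longrightarrow> r \<odot>\<^bsub>N\<^esub> y \<in> carrier N"
      "\<And>r y. r \<in> carrier R \<Longrightarrow> y \<in> carrier N \<Longrightarrow> d (r \<odot>\<^bsub>N\<^esub> y) = r \<otimes>\<^bsub>R\<^esub> d y"
begin

abbreviation "F \<equiv> tensor_free M N"
abbreviation "K \<equiv> tensor_kernel R M N"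

lemma carrier_F: "z \<in> carrier F \<longleftrightarrow> Poly_Mapping.keys z \<subseteq> carrier M \<times> carrier N"
  by (simp add: tensor_free_def)

lemma F_mult [simp]: "x \<otimes>\<^bsub>F\<^esub> y = x + y" and F_one [simp]: "\<one>\<^bsub>F\<^esub> = 0"
  by (simp_all add: tensor_free_def)

lemma frag_in_F [simp]: "frag_of p \<in> carrier F \<longleftrightarrow> p \<in> carrier M \<times> carrier N"
  by (simp add: tensor_free_def)

lemma comm_group_F: "comm_group F"
  by (simp add: tensor_free_def abelian_free_Abelian_group)

lemma group_F: "group F"
  by (simp add: tensor_free_def)

lemma F_closed:
  assumes "x \<in> carrier F" "y \<in> carrier F"
  shows "x + y \<in> carrier F" "x - y \<in> carrier F" "- x \<in> carrier F" "0 \<in> carrier F"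
  using assms keys_add[of x y] keys_diff[of x y] by (auto simp: carrier_F)

lemma relators_in_F: "tensor_relators R M N \<subseteq> carrier F"
  unfolding tensor_relators_def by (auto intro!: F_closed simp: add_N smult_N)

lemma K_subgroup: "subgroup K F"
  unfolding tensor_kernel_def by (rule group.generate_is_subgroup[OF group_F relators_in_F])

lemma K_normal: "K \<lhd> F"
  using comm_group.normal_iff_subgroup[OF comm_group_F] K_subgroup by blast

lemma inv_F: "x \<in> carrier F \<Longrightarrow> inv\<^bsub>F\<^esub> x = - x"
  by (simp add: carrier_F tensor_free_def)

lemma K_closed:
  assumes "x \<in> K" "y \<in> K"
  shows "x + y \<in> K" "- x \<in> K" "x - y \<in> K" "0 \<in> K" "x \<in> carrier F"
proof -
  have c: "x \<in> carrier F" "y \<in> carrier F" using assms subgroup.subset[OF K_subgroup] by auto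
  have m: "- z \<in> K" if "z \<in> K" for z
    using subgroup.m_inv_closed[OF K_subgroup that] subgroup.subset[OF K_subgroup] that inv_F[of z] by auto
  show "- x \<in> K" using m assms by blast
  show "x + y \<in> K" "0 \<in> K"
    using subgroup.m_closed[OF K_subgroup assms] subgroup.one_closed[OF K_subgroup] by simp_all
  show "x - y \<in> K" using subgroup.m_closed[OF K_subgroup assms(1) m[OF assms(2)]] by simp
  show "x \<in> carrier F" by (rule c)
qed

lemma relator_in_K: "z \<in> tensor_relators R M N \<Longrightarrow> z \<in> K"
  unfolding tensor_kernel_def by (rule generate.incl)

lemma K_relators:
  "x \<in> carrier M \<Longrightarrow> x' \<in> carrier M \<Longrightarrow> y \<in> carrier N \<Longrightarrow>
    frag_of (x \<oplus>\<^bsub>M\<^esub> x', y) - frag_of (x, y) - frag_of (x', y) \<in> K"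
  "r \<in> carrier R \<Longrightarrow> x \<in> carrier M \<Longrightarrow> y \<in> carrier N \<Longrightarrow>
    frag_of (r \<odot>\<^bsub>M\<^esub> x, y) - frag_of (x, r \<odot>\<^bsub>N\<^esub> y) \<in> K"
  by (rule relator_in_K; unfold tensor_relators_def; blast)+

lemma comm_group_M: "comm_group (add_monoid M)"
  by (rule M.a_comm_group)

text \<open>The additive map sending x \<otimes> y to d(y) x on the free group; it is obtained from
  a universal property that asserts existence, hence the choice operator.\<close>

definition contraction :: "('a \<times> 'b \<Rightarrow>\<^sub>0 int) \<Rightarrow> 'a" where
  "contraction = (SOME h. h \<in> hom F (add_monoid M) \<and>
     (\<forall>x\<in>carrier M. \<forall>y\<in>carrier N. h (frag_of (x, y)) = d y \<odot>\<^bsub>M\<^esub> x))"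

lemma contraction_props:
  "contraction \<in> hom F (add_monoid M)"
  "x \<in> carrier M \<Longrightarrow> y \<in> carrier N \<Longrightarrow> contraction (frag_of (x, y)) = d y \<odot>\<^bsub>M\<^esub> x"
proof -
  have im: "(\<lambda>(x, y). d y \<odot>\<^bsub>M\<^esub> x) ` (carrier M \<times> carrier N) \<subseteq> carrier (add_monoid M)"
    using coord smult_closed by auto
  obtain h where h: "h \<in> hom (free_Abelian_group (carrier M \<times> carrier N)) (add_monoid M)"
    "\<And>p. p \<in> carrier M \<times> carrier N \<Longrightarrow> h (frag_of p) = (\<lambda>(x, y). d y \<odot>\<^bsub>M\<^esub> x) p"
    using comm_group.free_Abelian_group_universal[OF comm_group_M im] by metis
  have ex: "\<exists>h. h \<in> hom F (add_monoid M) \<and> (\<forall>x\<in>carrier M. \<forall>y\<in>carrier N. h (frag_of (x, y)) = d y \<odot>\<^bsub>M\<^esub> x)"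
    using h by (intro exI[of _ h]) (simp add: tensor_free_def)
  have *: "contraction \<in> hom F (add_monoid M) \<and>
     (\<forall>x\<in>carrier M. \<forall>y\<in>carrier N. contraction (frag_of (x, y)) = d y \<odot>\<^bsub>M\<^esub> x)"
    using someI_ex[OF ex] unfolding contraction_def .
  then show "contraction \<in> hom F (add_monoid M)" by blast
  show "x \<in> carrier M \<Longrightarrow> y \<in> carrier N \<Longrightarrow> contraction (frag_of (x, y)) = d y \<odot>\<^bsub>M\<^esub> x"
    using * by blast
qed

lemma contraction_closed: "z \<in> carrier F \<Longrightarrow> contraction z \<in> carrier M"
  using hom_in_carrier[OF contraction_props(1)] by simp

lemma contraction_add:
  "x \<in> carrier F \<Longrightarrow> y \<in> carrier F \<Longrightarrow> contraction (x + y) = contraction x \<oplus>\<^bsub>M\<^esub> contraction y"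
  using hom_mult[OF contraction_props(1)] by simp

lemma contraction_0: "contraction 0 = \<zero>\<^bsub>M\<^esub>"
  using contraction_add[of 0 0] contraction_closed[of 0] by (simp add: carrier_F)

lemma contraction_minus:
  assumes "x \<in> carrier F" "y \<in> carrier F"
  shows "contraction (x - y) = contraction x \<ominus>\<^bsub>M\<^esub> contraction y"
proof -
  have "contraction x = contraction (x - y) \<oplus>\<^bsub>M\<^esub> contraction y"
    using contraction_add[of "x - y" y] F_closed[OF assms] assms by simp
  then show ?thesis
    using contraction_closed F_closed[OF assms] assms by (simp add: M.minus_eq M.a_assoc M.r_neg)
qed

lemma contraction_gen: "x \<in> carrier M \<Longrightarrow> contraction (frag_of (x, \<mu>)) = x"
  by (simp add: contraction_props(2) gen coord_gen)

text \<open>The elements contracting to 0 form a subgroup containing all three kinds of relators,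
  hence the subgroup they generate. So contraction is constant on cosets.\<close>

lemma contraction_K:
  assumes "k \<in> K"
  shows "contraction k = \<zero>\<^bsub>M\<^esub>"
proof -
  define H where "H = {z \<in> carrier F. contraction z = \<zero>\<^bsub>M\<^esub>}"
  have sub: "subgroup H F"
  proof (rule group.subgroupI[OF group_F])
    show "H \<subseteq> carrier F" "H \<noteq> {}" using contraction_0 F_closed(4)[of 0 0] by (auto simp: H_def carrier_F)
    show "inv\<^bsub>F\<^esub> z \<in> H" if "z \<in> H" for z
      using that contraction_minus[of 0 z] contraction_0 F_closed(3)[of z z] F_closed(4)[of z z]
      by (simp add: H_def inv_F M.minus_eq)
    show "x \<otimes>\<^bsub>F\<^esub> y \<in> H" if "x \<in> H" "y \<in> H" for x y
      using that contraction_add[of x y] F_closed(1)[of x y] by (simp add: H_def)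
  qed
  have "tensor_relators R M N \<subseteq> H"
  proof
    fix z assume z: "z \<in> tensor_relators R M N"
    have c: "z \<in> carrier F" using z relators_in_F by blast
    have "contraction z = \<zero>\<^bsub>M\<^esub>"
      using z unfolding tensor_relators_def
    proof (elim UnE CollectE exE conjE)
      fix x x' y assume *: "z = frag_of (x \<oplus>\<^bsub>M\<^esub> x', y) - frag_of (x, y) - frag_of (x', y)"
        "x \<in> carrier M" "x' \<in> carrier M" "y \<in> carrier N"
      have "contraction z = d y \<odot>\<^bsub>M\<^esub> (x \<oplus>\<^bsub>M\<^esub> x') \<ominus>\<^bsub>M\<^esub> d y \<odot>\<^bsub>M\<^esub> x \<ominus>\<^bsub>M\<^esub> d y \<odot>\<^bsub>M\<^esub> x'"
        unfolding *(1) using * by (simp add: contraction_minus contraction_props(2) F_closed)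
      then show ?thesis
        using * coord by (simp add: smult_r_distr M.minus_eq M.a_assoc M.a_comm M.r_neg M.minus_add M.a_lcomm M.r_neg1 M.r_neg2)
    next
      fix x y y' assume *: "z = frag_of (x, y \<oplus>\<^bsub>N\<^esub> y') - frag_of (x, y) - frag_of (x, y')"
        "x \<in> carrier M" "y \<in> carrier N" "y' \<in> carrier N"
      have "contraction z = d (y \<oplus>\<^bsub>N\<^esub> y') \<odot>\<^bsub>M\<^esub> x \<ominus>\<^bsub>M\<^esub> d y \<odot>\<^bsub>M\<^esub> x \<ominus>\<^bsub>M\<^esub> d y' \<odot>\<^bsub>M\<^esub> x"
        unfolding *(1) using * by (simp add: contraction_minus contraction_props(2) F_closed add_N)
      then show ?thesis
        using * coord by (simp add: add_N smult_l_distr M.minus_eq M.a_assoc M.a_comm M.r_neg M.minus_add M.a_lcomm M.r_neg1 M.r_neg2)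
    next
      fix r x y assume *: "z = frag_of (r \<odot>\<^bsub>M\<^esub> x, y) - frag_of (x, r \<odot>\<^bsub>N\<^esub> y)"
        "r \<in> carrier R" "x \<in> carrier M" "y \<in> carrier N"
      have "contraction z = d y \<odot>\<^bsub>M\<^esub> (r \<odot>\<^bsub>M\<^esub> x) \<ominus>\<^bsub>M\<^esub> d (r \<odot>\<^bsub>N\<^esub> y) \<odot>\<^bsub>M\<^esub> x"
        unfolding *(1) using * by (simp add: contraction_minus contraction_props(2) F_closed smult_N)
      then show ?thesis
        using * coord by (simp add: smult_N smult_assoc1[symmetric] M.minus_eq M.r_neg R.m_comm)
    qed
    then show "z \<in> H" using c by (simp add: H_def)
  qed
  then have "K \<subseteq> H" unfolding tensor_kernel_def
    using group.generate_subgroup_incl[OF group_F _ sub] by blast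
  then show ?thesis using assms by (auto simp: H_def)
qed

lemma coset_eqI:
  assumes "z - w \<in> K"
  shows "K #>\<^bsub>F\<^esub> z = K #>\<^bsub>F\<^esub> w"
proof -
  have "K #>\<^bsub>F\<^esub> z \<subseteq> K #>\<^bsub>F\<^esub> w" if "z - w \<in> K" for z w
  proof
    fix u assume "u \<in> K #>\<^bsub>F\<^esub> z"
    then obtain k where k: "k \<in> K" "u = k + z" by (auto simp: r_coset_def)
    show "u \<in> K #>\<^bsub>F\<^esub> w" unfolding r_coset_def k(2)
      using K_closed(1)[OF k(1) that] by (auto intro!: bexI[of _ "k + (z - w)"])
  qed
  from this[OF assms] this[of w z] K_closed(2)[OF assms assms] show ?thesis by auto
qed

definition tensor_gen :: "'a \<Rightarrow> ('a \<times> 'b \<Rightarrow>\<^sub>0 int) set" where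
  "tensor_gen x = K #>\<^bsub>F\<^esub> frag_of (x, \<mu>)"

text \<open>A generator x \<otimes> y is brought to the form x' \<otimes> \<mu> by moving the scalar
  d(y) across; additivity in the first factor extends this to all of the free group.\<close>

lemma coset_eq_tensor_gen:
  assumes "z \<in> carrier F"
  shows "K #>\<^bsub>F\<^esub> z = tensor_gen (contraction z)"
proof -
  have "z - frag_of (contraction z, \<mu>) \<in> K"
  proof (rule free_Abelian_group_induct[OF assms[unfolded carrier_F]])
    have "frag_of (\<zero>\<^bsub>M\<^esub> \<oplus>\<^bsub>M\<^esub> \<zero>\<^bsub>M\<^esub>, \<mu>) - frag_of (\<zero>\<^bsub>M\<^esub>, \<mu>) - frag_of (\<zero>\<^bsub>M\<^esub>, \<mu>) \<in> K"
      by (rule K_relators(1)) (simp_all add: gen)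
    then show "0 - frag_of (contraction 0, \<mu>) \<in> K" by (simp add: contraction_0)
  next
    fix x y assume 2: "Poly_Mapping.keys x \<subseteq> carrier M \<times> carrier N" "Poly_Mapping.keys y \<subseteq> carrier M \<times> carrier N"
      "x - frag_of (contraction x, \<mu>) \<in> K" "y - frag_of (contraction y, \<mu>) \<in> K"
    then have c: "x \<in> carrier F" "y \<in> carrier F" by (simp_all add: carrier_F)
    \<comment> \<open>The induction rule steps through differences, whereas the relators concern
      sums; hence x is read as (x - y) + y.\<close>
    have eq: "contraction x = contraction (x - y) \<oplus>\<^bsub>M\<^esub> contraction y"
      using contraction_add[of "x - y" y] F_closed[OF c] c by simp
    have "frag_of (contraction x, \<mu>) - frag_of (contraction (x - y), \<mu>) - frag_of (contraction y, \<mu>) \<in> K"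
      unfolding eq by (rule K_relators(1)) (use contraction_closed F_closed[OF c] c gen in auto)
    from K_closed(1)[OF K_closed(3)[OF 2(3,4)] this]
    show "x - y - frag_of (contraction (x - y), \<mu>) \<in> K" by (simp add: algebra_simps)
  next
    fix p assume "p \<in> carrier M \<times> carrier N"
    then obtain x y where p: "p = (x, y)" "x \<in> carrier M" "y \<in> carrier N" by auto
    have "frag_of (d y \<odot>\<^bsub>M\<^esub> x, \<mu>) - frag_of (x, d y \<odot>\<^bsub>N\<^esub> \<mu>) \<in> K"
      by (rule K_relators(2)) (use p coord gen in auto)
    from K_closed(2)[OF this this] show "frag_of p - frag_of (contraction (frag_of p), \<mu>) \<in> K"
      using p by (simp add: contraction_props(2) coord_gen)
  qed
  then show ?thesis unfolding tensor_gen_def by (rule coset_eqI)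
qed

lemma in_tensor_gen:
  assumes x: "x \<in> carrier M" and z: "z \<in> tensor_gen x"
  shows "z \<in> carrier F" "contraction z = x"
proof -
  obtain k where k: "k \<in> K" "z = k + frag_of (x, \<mu>)"
    using z by (auto simp: tensor_gen_def r_coset_def)
  have c: "k \<in> carrier F" "frag_of (x, \<mu>) \<in> carrier F" using K_closed(5)[OF k(1) k(1)] x gen by auto
  show "z \<in> carrier F" unfolding k(2) by (rule F_closed(1)[OF c])
  show "contraction z = x"
    unfolding k(2) contraction_add[OF c] contraction_K[OF k(1)] contraction_gen[OF x] using x by simp
qed

lemma frag_in_tensor_gen: "frag_of (x, \<mu>) \<in> tensor_gen x"
  using subgroup.one_closed[OF K_subgroup] unfolding tensor_gen_def r_coset_def
  by (auto intro!: bexI[of _ 0])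

lemma carrier_tensor: "carrier (tensor_product R M N) = tensor_gen ` carrier M"
proof -
  have "carrier (tensor_product R M N) = (\<lambda>z. K #>\<^bsub>F\<^esub> z) ` carrier F"
    by (auto simp: tensor_product_def Let_def FactGroup_def RCOSETS_def)
  also have "\<dots> = tensor_gen ` carrier M"
  proof
    show "(\<lambda>z. K #>\<^bsub>F\<^esub> z) ` carrier F \<subseteq> tensor_gen ` carrier M"
      using coset_eq_tensor_gen contraction_closed by auto
    show "tensor_gen ` carrier M \<subseteq> (\<lambda>z. K #>\<^bsub>F\<^esub> z) ` carrier F"
      using gen by (auto simp: tensor_gen_def)
  qed
  finally show ?thesis .
qed

lemma bij_tensor_gen: "bij_betw tensor_gen (carrier M) (carrier (tensor_product R M N))"
proof -
  have "x = x'" if "x \<in> carrier M" "x' \<in> carrier M" "tensor_gen x = tensor_gen x'" for x x'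
    using in_tensor_gen(2)[OF that(2), of "frag_of (x, \<mu>)"] frag_in_tensor_gen[of x] that contraction_gen[OF that(1)]
    by metis
  then show ?thesis by (auto simp: bij_betw_def carrier_tensor inj_on_def)
qed

lemma tensor_gen_add:
  assumes "x \<in> carrier M" "x' \<in> carrier M"
  shows "tensor_gen x \<oplus>\<^bsub>tensor_product R M N\<^esub> tensor_gen x' = tensor_gen (x \<oplus>\<^bsub>M\<^esub> x')"
proof -
  have c: "frag_of (x, \<mu>) \<in> carrier F" "frag_of (x', \<mu>) \<in> carrier F" using assms gen by auto
  have "tensor_gen x \<oplus>\<^bsub>tensor_product R M N\<^esub> tensor_gen x' = K #>\<^bsub>F\<^esub> (frag_of (x, \<mu>) + frag_of (x', \<mu>))"
    using normal.rcos_sum[OF K_normal c] by (simp add: tensor_product_def Let_def FactGroup_def tensor_gen_def)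
  also have "\<dots> = tensor_gen (x \<oplus>\<^bsub>M\<^esub> x')"
    using coset_eq_tensor_gen[OF F_closed(1)[OF c]] contraction_add[OF c] assms by (simp add: contraction_gen)
  finally show ?thesis .
qed

text \<open>On generators e has to agree with L only after contraction. Its extension then sends all
  representatives of a coset into one coset, so the union in \<open>tensor_lift\<close> is a genuine
  coset.\<close>

lemma tensor_lift_gen:
  assumes e: "\<And>x y. x \<in> carrier M \<Longrightarrow> y \<in> carrier N \<Longrightarrow> e (x, y) \<in> carrier F"
    and L: "\<And>x. x \<in> carrier M \<Longrightarrow> L x \<in> carrier M"
      "\<And>x x'. x \<in> carrier M \<Longrightarrow> x' \<in> carrier M \<Longrightarrow> L (x \<oplus>\<^bsub>M\<^esub> x') = L x \<oplus>\<^bsub>M\<^esub> L x'"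
    and eL: "\<And>x y. x \<in> carrier M \<Longrightarrow> y \<in> carrier N \<Longrightarrow> contraction (e (x, y)) = L (d y \<odot>\<^bsub>M\<^esub> x)"
    and x: "x \<in> carrier M"
  shows "tensor_lift R M N e (tensor_gen x) = tensor_gen (L x)"
proof -
  have L0: "L \<zero>\<^bsub>M\<^esub> = \<zero>\<^bsub>M\<^esub>" using L(2)[of "\<zero>\<^bsub>M\<^esub>" "\<zero>\<^bsub>M\<^esub>"] L(1)[of "\<zero>\<^bsub>M\<^esub>"] by simp
  have *: "frag_extend e z \<in> carrier F \<and> contraction (frag_extend e z) = L (contraction z)" if "z \<in> carrier F" for z
  proof (rule free_Abelian_group_induct[OF that[unfolded carrier_F]])
    show "frag_extend e 0 \<in> carrier F \<and> contraction (frag_extend e 0) = L (contraction 0)"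
      by (simp add: contraction_0 L0 carrier_F)
  next
    fix y z assume 2: "Poly_Mapping.keys y \<subseteq> carrier M \<times> carrier N" "Poly_Mapping.keys z \<subseteq> carrier M \<times> carrier N"
      "frag_extend e y \<in> carrier F \<and> contraction (frag_extend e y) = L (contraction y)"
      "frag_extend e z \<in> carrier F \<and> contraction (frag_extend e z) = L (contraction z)"
    then have c: "y \<in> carrier F" "z \<in> carrier F" by (simp_all add: carrier_F)
    have "L (contraction y) = L (contraction (y - z) \<oplus>\<^bsub>M\<^esub> contraction z)"
      using contraction_add[of "y - z" z] F_closed[OF c] c by simp
    also have "\<dots> = L (contraction (y - z)) \<oplus>\<^bsub>M\<^esub> L (contraction z)"
      by (rule L(2)) (use contraction_closed F_closed[OF c] c in auto)
    finally have "L (contraction (y - z)) = L (contraction y) \<ominus>\<^bsub>M\<^esub> L (contraction z)"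
      using contraction_closed F_closed[OF c] c L(1) by (simp add: M.minus_eq M.a_assoc M.r_neg)
    then show "frag_extend e (y - z) \<in> carrier F \<and> contraction (frag_extend e (y - z)) = L (contraction (y - z))"
      using 2(3,4) F_closed by (simp add: frag_extend_diff contraction_minus)
  next
    fix p assume "p \<in> carrier M \<times> carrier N"
    then obtain x y where "p = (x, y)" "x \<in> carrier M" "y \<in> carrier N" by auto
    then show "frag_extend e (frag_of p) \<in> carrier F \<and> contraction (frag_extend e (frag_of p)) = L (contraction (frag_of p))"
      using e eL by (simp add: contraction_props(2))
  qed
  have "K #>\<^bsub>F\<^esub> frag_extend e z = tensor_gen (L x)" if "z \<in> tensor_gen x" for z
    using coset_eq_tensor_gen[of "frag_extend e z"] *[of z] in_tensor_gen[OF x that] by simp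
  then show ?thesis unfolding tensor_lift_def using frag_in_tensor_gen[of x] by auto
qed

lemma tensor_gen_smult:
  assumes r: "r \<in> carrier R" and x: "x \<in> carrier M"
  shows "r \<odot>\<^bsub>tensor_product R M N\<^esub> tensor_gen x = tensor_gen (r \<odot>\<^bsub>M\<^esub> x)"
proof -
  have "tensor_lift R M N (\<lambda>(x, y). frag_of (r \<odot>\<^bsub>M\<^esub> x, y)) (tensor_gen x) = tensor_gen (r \<odot>\<^bsub>M\<^esub> x)"
  proof (rule tensor_lift_gen[OF _ _ _ _ x])
    show "contraction ((\<lambda>(x, y). frag_of (r \<odot>\<^bsub>M\<^esub> x, y)) (x, y)) = r \<odot>\<^bsub>M\<^esub> (d y \<odot>\<^bsub>M\<^esub> x)"
      if "x \<in> carrier M" "y \<in> carrier N" for x y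
      using that r coord by (simp add: contraction_props(2) smult_assoc1[symmetric] R.m_comm)
  qed (use r in \<open>auto simp: smult_r_distr\<close>)
  then show ?thesis by (simp add: tensor_product_def Let_def)
qed

text \<open>Assumption \<open>DE\<close> is the Leibniz rule seen through contraction: D x \<otimes>
  y + x \<otimes> E y contracts to d(y) D x + d(E y) x.\<close>

lemma tensor_gen_leibniz:
  assumes D: "\<And>x. x \<in> carrier M \<Longrightarrow> D x \<in> carrier M" and E: "\<And>y. y \<in> carrier N \<Longrightarrow> E y \<in> carrier N"
    and L: "\<And>x x'. x \<in> carrier M \<Longrightarrow> x' \<in> carrier M \<Longrightarrow> L (x \<oplus>\<^bsub>M\<^esub> x') = L x \<oplus>\<^bsub>M\<^esub> L x'"
      "\<And>x. x \<in> carrier M \<Longrightarrow> L x \<in> carrier M"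
    and DE: "\<And>x y. x \<in> carrier M \<Longrightarrow> y \<in> carrier N \<Longrightarrow>
      d y \<odot>\<^bsub>M\<^esub> D x \<oplus>\<^bsub>M\<^esub> d (E y) \<odot>\<^bsub>M\<^esub> x = L (d y \<odot>\<^bsub>M\<^esub> x)"
    and x: "x \<in> carrier M"
  shows "tensor_leibniz R M N D E (tensor_gen x) = tensor_gen (L x)"
  unfolding tensor_leibniz_def
proof (rule tensor_lift_gen[OF _ L(2,1) _ x])
  show "(\<lambda>(x, y). frag_of (D x, y) + frag_of (x, E y)) (x, y) \<in> carrier F"
    "contraction ((\<lambda>(x, y). frag_of (D x, y) + frag_of (x, E y)) (x, y)) = L (d y \<odot>\<^bsub>M\<^esub> x)"
    if "x \<in> carrier M" "y \<in> carrier N" for x y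
    using that D E DE[OF that] by (simp_all add: F_closed contraction_add contraction_props(2))
qed

end

section \<open>Pointwise contact geometry\<close>

text \<open>The matrix of a \<and> i_Y W, the row vector \<open>Y v* W\<close> being the covector
  W(Y, .).\<close>

definition kappa :: "complex^'d \<Rightarrow> complex^'d^'d \<Rightarrow> complex^'d \<Rightarrow> complex^'d^'d::finite" where
  "kappa a W Y = outer a (Y v* W) - outer (Y v* W) a"

lemma outer_simps:
  fixes a b c :: "complex^'d::finite"
  shows "outer (a + b) c = outer a c + outer b c" "outer a (b + c) = outer a b + outer a c"
    "outer (k *s a) b = mscale k (outer a b)" "outer a (k *s b) = mscale k (outer a b)"
    "outer (- a) b = - outer a b" "outer a (- b) = - outer a b"
  by (simp_all add: vec_eq_iff algebra_simps)

lemma mscale_simps: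
  fixes A B :: "complex^'d^'d::finite"
  shows "mscale k (A + B) = mscale k A + mscale k B" "mscale k (A - B) = mscale k A - mscale k B"
    "mscale k (- A) = - mscale k A" "mscale k (mscale k' A) = mscale (k * k') A" "mscale 1 A = A"
    "mscale (k + k') A = mscale k A + mscale k' A" "mscale 0 A = 0"
  by (simp_all add: vec_eq_iff algebra_simps)

lemma vec_mult_add:
  fixes A B :: "complex^'d^'d::finite"
  shows "v v* (A + B) = v v* A + v v* B" "v v* (A - B) = v v* A - v v* B" "v v* mscale k A = k *s (v v* A)"
    "(u + v) v* A = u v* A + v v* A" "(u - v) v* A = u v* A - v v* A" "(k *s v) v* A = k *s (v v* A)"
    "(- v) v* A = - (v v* A)"
  by (simp_all add: vec_eq_iff vector_matrix_mult_def algebra_simps sum.distrib sum_subtractf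
      sum_distrib_left sum_negf)

lemma kappa_linear:
  "kappa a W (Y + Y') = kappa a W Y + kappa a W Y'" "kappa a W (k *s Y) = mscale k (kappa a W Y)"
  by (simp_all add: kappa_def vec_mult_add) (simp_all add: vec_eq_iff algebra_simps)

lemma kappa_skew: "kappa a W Y $ i $ j = - kappa a W Y $ j $ i"
  by (simp add: kappa_def)

lemma bilinear_outer: "cdot u (outer a b *v v) = cdot a u * cdot b (v :: complex^'d::finite)"
  by (simp add: outer_mult_vec cdot_commute)

lemma kappa_kernel:
  assumes "cdot a u = 0" "cdot a v = 0"
  shows "cdot u (kappa a W Y *v v) = 0"
  using assms by (simp add: kappa_def matrix_vector_mult_diff_rdistrib bilinear_outer)

text \<open>Contracting a \<and> i_Y W with the Reeb vector returns i_Y W up to sign, so W Y = 0;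
  together with a(Y) = 0 this puts Y into the kernel of the invertible W + a \<otimes> a.\<close>

lemma kappa_injective:
  fixes W :: "complex^'d^'d::finite"
  assumes W: "transpose W = - W" and odd: "odd CARD('d)" and D: "det (W + outer a a) \<noteq> 0"
    and Y: "cdot a Y = 0" "kappa a W Y = 0"
  shows "Y = 0"
proof -
  obtain R where R: "W *v R = 0" "R v* W = 0" "cdot a R = 1" using Reeb_vector[OF W odd D] .
  let ?b = "Y v* W"
  have bR: "cdot ?b R = 0" using cdot_mult_vec[of Y W R] R by simp
  have "kappa a W Y *v R = - ?b"
    by (simp add: kappa_def matrix_vector_mult_diff_rdistrib outer_mult_vec R bR)
  then have "?b = 0" using Y by simp
  then have "W *v Y = 0" using skew_mult_vec[OF W, of Y] by simp
  then have "(W + outer a a) *v Y = 0" by (simp add: matrix_vector_mult_add_rdistrib outer_mult_vec Y)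
  then show ?thesis using D by (metis invertible_det_nz invertible_left_inverse matrix_left_invertible_ker)
qed

lemma cdot_axis: "cdot a (axis j 1) = (a :: complex^'d::finite) $ j"
  by (simp add: cdot_def axis_def if_distrib if_distribR cong: if_cong)

lemma matrix_entry: "cdot (axis i 1) (w *v axis j 1) = (w :: complex^'d^'d::finite) $ i $ j"
  by (simp add: cdot_def matrix_vector_mult_def axis_def if_distrib if_distribR cong: if_cong)

text \<open>Subtracting multiples of R moves both arguments into the kernel of a, where w vanishes;
  what is left over is a \<and> i_R w, because w(R, R) = 0.\<close>

lemma two_form_decompose:
  fixes w :: "complex^'d^'d::finite"
  assumes w: "transpose w = - w" and R: "cdot a R = 1"
    and ker: "\<And>u v. cdot a u = 0 \<Longrightarrow> cdot a v = 0 \<Longrightarrow> cdot u (w *v v) = 0"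
  shows "w = outer a (R v* w) - outer (R v* w) a"
proof -
  let ?b = "R v* w"
  have bR: "cdot ?b R = 0" using cdot_mult_vec[of R w R] skew_quadratic_zero[OF w, of R] by simp
  have wR: "w *v R = - ?b" using skew_mult_vec[OF w, of R] by simp
  have "cdot u (w *v v) = cdot a u * cdot ?b v - cdot a v * cdot ?b u" for u v
  proof -
    have "w *v (v - cdot a v *s R) = w *v v + cdot a v *s ?b"
      by (simp add: matrix_vector_mult_diff_distrib vector_scalar_commute wR)
    moreover have "cdot (u - cdot a u *s R) (w *v (v - cdot a v *s R)) = 0"
      by (rule ker) (simp_all add: R)
    ultimately have "cdot (u - cdot a u *s R) (w *v v + cdot a v *s ?b) = 0" by simp
    then show ?thesis
      using cdot_mult_vec[of R w v] bR cdot_commute[of R ?b] cdot_commute[of u ?b] by (simp add: algebra_simps)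
  qed
  then have "w $ i $ j = (outer a ?b - outer ?b a) $ i $ j" for i j
    unfolding matrix_entry[symmetric, of w]
    by (simp add: cdot_axis)
  then show ?thesis by (simp add: vec_eq_iff)
qed

text \<open>The inverse of \<open>kappa\<close> in closed form. With M = W + a \<otimes> a, the
  vector M^-1 a is the Reeb vector R, and the equation M Y = - i_R w forces a(Y) = 0 and i_Y W = i_R
  w. Written with matrix inverses, the formula is visibly smooth in a, W and w.\<close>

definition tangent_of :: "complex^'d \<Rightarrow> complex^'d^'d \<Rightarrow> complex^'d^'d \<Rightarrow> complex^'d::finite" where
  "tangent_of a W w = - (matrix_inv (W + outer a a) *v ((matrix_inv (W + outer a a) *v a) v* w))"

lemma matrix_inv_det:
  fixes A :: "complex^'d^'d::finite"
  assumes "det A \<noteq> 0"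
  shows "A ** matrix_inv A = mat 1" "matrix_inv A ** A = mat 1"
proof -
  have "\<exists>B. A ** B = mat 1 \<and> B ** A = mat 1" using assms invertible_det_nz[of A] unfolding invertible_def by blast
  from someI_ex[OF this] show "A ** matrix_inv A = mat 1" "matrix_inv A ** A = mat 1"
    unfolding matrix_inv_def by auto
qed

text \<open>The last conclusion is the decomposition of w with R given by the matrix inverse; it
  provides a smooth second factor when w has to be differentiated.\<close>

lemma kappa_tangent_of:
  fixes W :: "complex^'d^'d::finite"
  assumes W: "transpose W = - W" and odd: "odd CARD('d)" and D: "det (W + outer a a) \<noteq> 0"
    and w: "transpose w = - w" and ker: "\<And>u v. cdot a u = 0 \<Longrightarrow> cdot a v = 0 \<Longrightarrow> cdot u (w *v v) = 0"
  shows "cdot a (tangent_of a W w) = 0" "kappa a W (tangent_of a W w) = w"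
    "w = outer a ((matrix_inv (W + outer a a) *v a) v* w) - outer ((matrix_inv (W + outer a a) *v a) v* w) a"
proof -
  let ?M = "W + outer a a" and ?Y = "tangent_of a W w"
  let ?B = "matrix_inv ?M"
  obtain R where R: "W *v R = 0" "R v* W = 0" "cdot a R = 1" using Reeb_vector[OF W odd D] .
  note B = matrix_inv_det[OF D]
  have MR: "?M *v R = a" by (simp add: matrix_vector_mult_add_rdistrib outer_mult_vec R)
  have Ba: "?B *v a = R" using matrix_vector_mul_assoc[of ?B ?M R] by (simp add: MR B)
  have RM: "R v* ?M = a" by (simp add: vec_mult_add R vec_mult_outer cdot_commute[of R])
  let ?b = "R v* w"
  have bR: "cdot ?b R = 0" using cdot_mult_vec[of R w R] skew_quadratic_zero[OF w, of R] by simp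
  have Y: "?Y = - (?B *v ?b)" by (simp add: tangent_of_def Ba)
  have MY: "?M *v ?Y = - ?b"
  proof -
    have "?M *v ?Y = - (?M *v (?B *v ?b))"
      unfolding Y by (simp add: vec_eq_iff matrix_vector_mult_def sum_negf)
    then show ?thesis by (simp add: matrix_vector_mul_assoc B)
  qed
  show aY: "cdot a ?Y = 0"
    using cdot_mult_vec[of R ?M ?Y] bR by (simp add: RM MY cdot_commute[of R])
  have "W *v ?Y = - ?b" using MY by (simp add: matrix_vector_mult_add_rdistrib outer_mult_vec aY)
  then have YW: "?Y v* W = ?b" using skew_mult_vec[OF W, of ?Y] by simp
  have dec: "w = outer a ?b - outer ?b a" by (rule two_form_decompose[OF w R(3) ker])
  then show "kappa a W ?Y = w" by (simp add: kappa_def YW)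
  show "w = outer a ((?B *v a) v* w) - outer ((?B *v a) v* w) a" unfolding Ba by (rule dec)
qed

text \<open>By Cramer's rule each entry is a quotient of determinants of smooth matrices.\<close>

lemma smooth_on_matrix_inv:
  fixes A :: "real^'e::finite \<Rightarrow> complex^'d^'d::finite"
  assumes S: "open S" and A: "smooth_on S A" and nz: "\<And>y. y \<in> S \<Longrightarrow> det (A y) \<noteq> 0"
  shows "smooth_on S (\<lambda>y. matrix_inv (A y))"
proof (rule smooth_on_vec[OF S], rule smooth_on_vec[OF S])
  fix i j
  let ?C = "\<lambda>y. (\<chi> r s. if s = i then (axis j 1 :: complex^'d) $ r else A y $ r $ s) :: complex^'d^'d"
  have "smooth_on S ?C"
  proof (rule smooth_on_vec[OF S], rule smooth_on_vec[OF S])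
    show "smooth_on S (\<lambda>y. ?C y $ r $ s)" for r s
      by (cases "s = i") (simp_all add: smooth_on_const[OF S] smooth_on_nth_iff(2)[OF S A])
  qed
  then have "smooth_on S (\<lambda>y. det (?C y) / det (A y))"
    by (intro smooth_on_divide smooth_on_vec_ops(9) S A nz)
  then show "smooth_on S (\<lambda>y. matrix_inv (A y) $ i $ j)"
  proof (rule smooth_on_cong[OF S, rotated])
    fix y assume y: "y \<in> S"
    have e: "A y *v (matrix_inv (A y) *v axis j 1) = axis j 1"
      by (simp add: matrix_vector_mul_assoc matrix_inv_det[OF nz[OF y]])
    have "matrix_inv (A y) *v axis j 1 = (\<chi> k. det (\<chi> r s. if s = k then axis j 1 $ r else A y $ r $ s) / det (A y))"
      by (rule cramer[OF nz[OF y], THEN iffD1, OF e])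
    from arg_cong[OF this, of "\<lambda>v. v $ i"]
    have "(matrix_inv (A y) *v axis j 1) $ i = det (?C y) / det (A y)"
      by (simp only: vec_lambda_beta)
    moreover have "(matrix_inv (A y) *v axis j 1) $ i = matrix_inv (A y) $ i $ j"
      using cdot_axis[of "matrix_inv (A y) $ i" j] by (simp only: matrix_vector_mult_def cdot_def vec_lambda_beta)
    ultimately show "det (?C y) / det (A y) = matrix_inv (A y) $ i $ j"
      by (simp only:)
  qed
qed

text \<open>Contracting b \<and> a with a tangent Y leaves a multiple of a, which the outer factor a
  kills. The two factors g come from the rescaled a and the rescaled W; b stands for dg.\<close>

lemma kappa_gauge:
  assumes "cdot a Y = 0" "W' = mscale g W + outer b a - outer a b"
  shows "kappa (g *s a) W' Y = mscale (g\<^sup>2) (kappa a W Y)"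
proof -
  have "Y v* W' = g *s (Y v* W) + cdot Y b *s a"
    unfolding assms(2) by (simp add: vec_mult_add vec_mult_outer assms(1) cdot_commute[of Y a])
  then show ?thesis by (simp add: kappa_def vec_eq_iff algebra_simps power2_eq_square)
qed

lemma kappa_pullback:
  "kappa (a v* J) (transpose J ** W ** J) Y = transpose J ** kappa a W (J *v Y) ** J"
proof -
  have "Y v* (transpose J ** W ** J) = ((J *v Y) v* W) v* J"
    by (simp add: vector_matrix_mul_assoc[symmetric])
  moreover have "outer (p v* J) (q v* J) = transpose J ** outer p q ** J" for p q
    by (simp add: mult_outer outer_mult)
  moreover have "transpose J ** (A - B) ** J = transpose J ** A ** J - transpose J ** B ** J" for A B
    by (simp add: vec_eq_iff matrix_matrix_mult_def algebra_simps sum_subtractf)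
  ultimately show ?thesis by (simp add: kappa_def)
qed

lemma outer_pullback: "outer (p v* J) (q v* J) = transpose J ** outer p q ** (J :: complex^'d^'d::finite)"
  by (simp add: mult_outer outer_mult)

lemma abs_powr_mult_of_real: "abs_powr m (of_real r * z) = of_real (\<bar>r\<bar> powr m) * abs_powr m z"
  by (simp add: abs_powr_def abs_mult powr_mult)

lemma abs_powr_nonzero: "z \<in> \<real> \<Longrightarrow> z \<noteq> 0 \<Longrightarrow> abs_powr m z \<noteq> 0"
  by (auto simp: abs_powr_def elim!: Reals_cases)

lemma pd_real:
  assumes "open S" "x \<in> S" "smooth_on S f" "\<And>y. y \<in> S \<Longrightarrow> f y \<in> \<real>"
  shows "pd i f x \<in> \<real>"
proof -
  have R: "((\<lambda>y. Re (f y)) has_derivative (\<lambda>h. Re (frechet_derivative f (at x) h))) (at x)"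
    by (rule bounded_linear.has_derivative[OF bounded_linear_Re smooth_on_has_derivative[OF assms(3,2)]])
  have "pd i f x = pd i (\<lambda>y. of_real (Re (f y))) x"
    by (rule pd_cong[OF assms(1,2)]) (use assms smooth_on_imp_differentiable in auto)
  also have "\<dots> = of_real (Re (frechet_derivative f (at x) (axis i 1)))"
    by (rule pd_eqI[OF bounded_linear.has_derivative[OF bounded_linear_of_real R]])
  finally show ?thesis by simp
qed

lemma det_real: "(\<And>i j. A $ i $ j \<in> \<real>) \<Longrightarrow> det (A :: complex^'d^'d::finite) \<in> \<real>"
  by (auto simp: det_def intro!: sum_in_Reals Reals_mult prod_in_Reals)

section \<open>Lie derivatives along a field with L_X a = f a\<close>

context
  fixes S :: "(real^'d::finite) set" and x :: "real^'d" and X a :: "real^'d \<Rightarrow> complex^'d"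
    and f :: "real^'d \<Rightarrow> complex"
  assumes S: "open S" "x \<in> S" and X: "smooth_on S X" and a: "smooth_on S a" and f: "smooth_on S f"
    and La: "\<And>y. y \<in> S \<Longrightarrow> vecD (X y) a y + a y v* cjac X y = f y *s a y"
begin

lemma lie_outer:
  assumes "smooth_on S p" "smooth_on S q"
  shows "matD (X x) (\<lambda>y. outer (p y) (q y)) x + transpose (cjac X x) ** outer (p x) (q x) + outer (p x) (q x) ** cjac X x
    = outer (vecD (X x) p x + p x v* cjac X x) (q x) + outer (p x) (vecD (X x) q x + q x v* cjac X x)"
  by (simp add: matD_outer[OF S assms] mult_outer outer_mult outer_simps)

text \<open>Both sides are d applied to L_X a = f a, the left one because d commutes with
  L_X.\<close>

lemma lie_ext_d:
  "matD (X x) (ext_d a) x + transpose (cjac X x) ** ext_d a x + ext_d a x ** cjac X x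
    = mscale (f x) (ext_d a x) + outer (\<chi> i. pd i f x) (a x) - outer (a x) (\<chi> i. pd i f x)"
proof -
  have "ext_d (\<lambda>y. vecD (X y) a y + a y v* cjac X y) x = ext_d (\<lambda>y. f y *s a y) x"
  proof -
    have sm: "smooth_on S (\<lambda>y. f y *s a y)" by (rule smooth_on_vec_ops(7)[OF S(1) f a])
    have "pd i (\<lambda>y. (f y *s a y) $ j) x = pd i (\<lambda>y. (vecD (X y) a y + a y v* cjac X y) $ j) x" for i j
      by (rule pd_cong[OF S]) (use La smooth_on_imp_differentiable[OF smooth_on_vec_nth[OF S(1) sm] S(2)] in auto)
    then show ?thesis unfolding ext_d_def by (simp only:)
  qed
  then show ?thesis unfolding ext_d_lie[OF S X a] ext_d_smult[OF S f a] .
qed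

text \<open>The product rule for a \<and> i_Y da. Each of a and da contributes a factor f,
  differentiating Y contributes the bracket, and the df-part of L_X da contributes df(Y) a, which
  vanishes in the wedge with a.\<close>

lemma lie_kappa:
  assumes Y: "smooth_on S Y" and aY: "cdot (a x) (Y x) = 0"
  shows "matD (X x) (\<lambda>y. kappa (a y) (ext_d a y) (Y y)) x + transpose (cjac X x) ** kappa (a x) (ext_d a x) (Y x)
      + kappa (a x) (ext_d a x) (Y x) ** cjac X x
    = mscale (2 * f x) (kappa (a x) (ext_d a x) (Y x))
      + kappa (a x) (ext_d a x) (vecD (X x) Y x - cjac X x *v Y x)"
proof -
  let ?T = "cjac X x" and ?W = "ext_d a" and ?v = "X x"
  let ?b = "\<lambda>y. Y y v* ext_d a y" and ?Z = "vecD (X x) Y x - cjac X x *v Y x" and ?df = "\<chi> i. pd i f x"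
  have W: "smooth_on S ?W" by (rule smooth_on_derivs(5)[OF S(1) a])
  have b: "smooth_on S ?b" by (rule smooth_on_vec_ops(3)[OF S(1) W Y])
  have YT: "Y x v* (transpose ?T ** A) = (?T *v Y x) v* A" for A
    by (simp add: vector_matrix_mul_assoc[symmetric])
  have "vecD ?v ?b x + ?b x v* ?T = Y x v* (matD ?v ?W x + transpose ?T ** ?W x + ?W x ** ?T) + ?Z v* ?W x"
    by (simp add: vecD_vec_mult[OF S W Y] vec_mult_add YT vector_matrix_mul_assoc del: transpose_matrix_vector)
  also have "\<dots> = f x *s ?b x + cdot (Y x) ?df *s a x + ?Z v* ?W x"
    unfolding lie_ext_d by (simp add: vec_mult_add vec_mult_outer aY cdot_commute[of "Y x" "a x"])
  finally have Lb: "vecD ?v ?b x + ?b x v* ?T = f x *s ?b x + cdot (Y x) ?df *s a x + ?Z v* ?W x" .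
  have "matD ?v (\<lambda>y. kappa (a y) (ext_d a y) (Y y)) x + transpose ?T ** kappa (a x) (?W x) (Y x) + kappa (a x) (?W x) (Y x) ** ?T
    = (matD ?v (\<lambda>y. outer (a y) (?b y)) x + transpose ?T ** outer (a x) (?b x) + outer (a x) (?b x) ** ?T)
      - (matD ?v (\<lambda>y. outer (?b y) (a y)) x + transpose ?T ** outer (?b x) (a x) + outer (?b x) (a x) ** ?T)"
  proof -
    have "matD ?v (\<lambda>y. outer (a y) (?b y) - outer (?b y) (a y)) x
      = matD ?v (\<lambda>y. outer (a y) (?b y)) x - matD ?v (\<lambda>y. outer (?b y) (a y)) x"
      by (rule matD_add_diff(2)[OF S smooth_on_vec_ops(5)[OF S(1) a b] smooth_on_vec_ops(5)[OF S(1) b a]])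
    moreover have "C ** (A - B) = C ** A - C ** B" for A B C :: "complex^'d^'d"
      by (simp add: vec_eq_iff matrix_matrix_mult_def algebra_simps sum_subtractf)
    ultimately show ?thesis by (simp add: kappa_def matrix_rdistribs)
  qed
  also have "\<dots> = mscale (2 * f x) (kappa (a x) (ext_d a x) (Y x)) + kappa (a x) (ext_d a x) ?Z"
    unfolding lie_outer[OF a b] lie_outer[OF b a] Lb La[OF S(2)]
    by (simp add: kappa_def vec_eq_iff algebra_simps)
  finally show ?thesis .
qed

text \<open>Jacobi's formula combined with \<open>trace_gauge\<close>; the derivative of the matrix
  is read off from L_X da and L_X (a \<otimes> a).\<close>

lemma ddir_contact_volume:
  assumes odd: "odd CARD('d)" and D: "det (ext_d a x + outer (a x) (a x)) \<noteq> 0"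
  shows "ddir (X x) (\<lambda>y. det (ext_d a y + outer (a y) (a y))) x
    = ((of_nat CARD('d) + 1) * f x - 2 * trace (cjac X x)) * det (ext_d a x + outer (a x) (a x))"
proof -
  let ?M = "\<lambda>y. ext_d a y + outer (a y) (a y)"
  have W: "smooth_on S (ext_d a)" by (rule smooth_on_derivs(5)[OF S(1) a])
  have aa: "smooth_on S (\<lambda>y. outer (a y) (a y))" by (rule smooth_on_vec_ops(5)[OF S(1) a a])
  have M: "smooth_on S ?M" by (rule smooth_on_add[OF S(1) W aa])
  note B = matrix_inv_det[OF D]
  have "matD (X x) ?M x + transpose (cjac X x) ** ?M x + ?M x ** cjac X x
    = (matD (X x) (ext_d a) x + transpose (cjac X x) ** ext_d a x + ext_d a x ** cjac X x)
     + (matD (X x) (\<lambda>y. outer (a y) (a y)) x + transpose (cjac X x) ** outer (a x) (a x) + outer (a x) (a x) ** cjac X x)"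
    by (simp add: matD_add_diff[OF S W aa] matrix_add_ldistrib matrix_rdistribs)
  also have "\<dots> = mscale (f x) (ext_d a x) + outer (\<chi> i. pd i f x) (a x) - outer (a x) (\<chi> i. pd i f x)
      + mscale (2 * f x) (outer (a x) (a x))"
    unfolding lie_ext_d lie_outer[OF a a] La[OF S(2)] by (simp add: vec_eq_iff)
  finally show ?thesis
    using ddir_det[OF S M B(2)] trace_gauge[OF ext_d_skew odd B(1)] by simp
qed

end

section \<open>Independence of the contact form\<close>

lemma ext_d_cong:
  assumes S: "open S" "x \<in> S" and eq: "\<And>y. y \<in> S \<Longrightarrow> a y = b y" and a: "smooth_on S a"
  shows "ext_d a x = ext_d b x"
proof -
  have "pd i (\<lambda>y. a y $ j) x = pd i (\<lambda>y. b y $ j) x" for i j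
    by (rule pd_cong[OF S]) (use eq smooth_on_imp_differentiable[OF smooth_on_vec_nth[OF S(1) a] S(2)] in auto)
  then show ?thesis unfolding ext_d_def by (simp only:)
qed

text \<open>A complex vector in the kernel of a real covector has its real and imaginary parts there.\<close>

lemma complexify_kernel:
  fixes w :: "complex^'d^'d::finite"
  assumes a: "\<And>i. a $ i \<in> \<real>"
    and w: "\<And>u v. cdot a (cvec u) = 0 \<Longrightarrow> cdot a (cvec v) = 0 \<Longrightarrow> cdot (cvec u) (w *v cvec v) = 0"
    and uv: "cdot a u = 0" "cdot a v = 0"
  shows "cdot u (w *v v) = 0"
proof -
  have split: "z = cvec (\<chi> i. Re (z $ i)) + \<i> *s cvec (\<chi> i. Im (z $ i))" for z :: "complex^'d"
    by (simp add: vec_eq_iff complex_eq)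
  have parts: "cdot a (cvec (\<chi> i. Re (z $ i))) = 0 \<and> cdot a (cvec (\<chi> i. Im (z $ i))) = 0" if z: "cdot a z = 0" for z
  proof -
    have "a $ i = of_real (Re (a $ i))" for i using a[of i] by simp
    then have "cdot a (cvec (\<chi> i. Re (z $ i))) = of_real (\<Sum>i\<in>UNIV. Re (a $ i) * Re (z $ i))"
      "cdot a (cvec (\<chi> i. Im (z $ i))) = of_real (\<Sum>i\<in>UNIV. Re (a $ i) * Im (z $ i))"
      unfolding cdot_def of_real_sum by (auto intro!: sum.cong)
    moreover have "Re (cdot a z) = (\<Sum>i\<in>UNIV. Re (a $ i) * Re (z $ i))"
      "Im (cdot a z) = (\<Sum>i\<in>UNIV. Re (a $ i) * Im (z $ i))"
      using a by (simp_all add: cdot_def complex_is_Real_iff)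
    then have "(\<Sum>i\<in>UNIV. Re (a $ i) * Re (z $ i)) = 0" "(\<Sum>i\<in>UNIV. Re (a $ i) * Im (z $ i)) = 0"
      using z by auto
    ultimately show ?thesis by (simp only: of_real_0 simp_thms)
  qed
  let ?R = "\<lambda>z::complex^'d. cvec (\<chi> i. Re (z $ i))" and ?I = "\<lambda>z::complex^'d. cvec (\<chi> i. Im (z $ i))"
  note p = parts[OF uv(1), THEN conjunct1] parts[OF uv(1), THEN conjunct2]
    parts[OF uv(2), THEN conjunct1] parts[OF uv(2), THEN conjunct2]
  have "cdot (?R u + \<i> *s ?I u) (w *v (?R v + \<i> *s ?I v)) = 0"
    unfolding matrix_vector_right_distrib vector_scalar_commute cdot_simps
      w[OF p(1,3)] w[OF p(1,4)] w[OF p(2,3)] w[OF p(2,4)] by simp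
  then show ?thesis unfolding split[of u, symmetric] split[of v, symmetric] .
qed

text \<open>The nowhere vanishing density \<mu> is a parameter, so that all coefficients below refer
  to one fixed generator of the densities.\<close>

locale contact_manifold = atlas A
  for A :: "('m::{t2_space,second_countable_topology}, 'd::finite) chart set" +
  fixes \<xi> :: "('m, 'd, (real^'d) set) field" and n :: nat and \<mu> :: "('m, 'd, complex) field"
  assumes dim: "CARD('d) = 2 * n + 1" and contact: "contact_structure A n \<xi>"
    and mu: "\<mu> \<in> densities A (- (2 / (real n + 1)))"
    and mu_nonzero: "\<And>c x. c \<in> A \<Longrightarrow> x \<in> img_of c \<Longrightarrow> \<mu> c x \<noteq> 0"
begin

abbreviation "is_cform \<equiv> contact_form_on A n \<xi>"
abbreviation "\<Lambda> \<equiv> - (2 / (real n + 1))"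

definition "vol \<alpha> c x = det (ext_d (\<alpha> c) x + outer (\<alpha> c x) (\<alpha> c x :: complex^'d))"
text \<open>The exponent is half of \<open>\<Lambda>\<close> because \<open>vol\<close> has weight
  2; \<open>weight \<alpha>\<close> is thus a local density of degree
  \<open>\<Lambda>\<close>.\<close>

definition "weight \<alpha> c x = abs_powr (- (1 / (real n + 1))) (vol \<alpha> c x)"
text \<open>The 2-form w for which w \<otimes> \<mu> is the image of Y. Weight and \<mu> are
  densities of the same degree, so their quotient is a function.\<close>

definition "phi \<alpha> c x Y = mscale (weight \<alpha> c x / \<mu> c x) (kappa (\<alpha> c x) (ext_d (\<alpha> c) x) Y)"

lemma odd_dim: "odd CARD('d)" by (simp add: dim)

text \<open>The wedge condition is converted here into \<open>vol \<alpha> c x \<noteq> 0\<close>,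
  the form of nondegeneracy in which all later arguments are phrased.\<close>

lemma cform:
  assumes cf: "is_cform U \<alpha>" and c: "c \<in> A"
  shows "open U" "open (crd c ` (dom_of c \<inter> U))" "field_on A U covec_law \<alpha>" "smooth_on (crd c ` (dom_of c \<inter> U)) (\<alpha> c)"
    "x \<in> crd c ` (dom_of c \<inter> U) \<Longrightarrow> \<alpha> c x $ i \<in> \<real>"
    "x \<in> crd c ` (dom_of c \<inter> U) \<Longrightarrow> u \<in> \<xi> c x \<longleftrightarrow> cdot (\<alpha> c x) (cvec u) = 0"
    "x \<in> crd c ` (dom_of c \<inter> U) \<Longrightarrow> vol \<alpha> c x \<noteq> 0"
    "x \<in> crd c ` (dom_of c \<inter> U) \<Longrightarrow> vol \<alpha> c x \<in> \<real>"
proof -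
  let ?S = "crd c ` (dom_of c \<inter> U)"
  have U: "open U" and fo: "field_on A U covec_law \<alpha>"
    and pt: "\<And>x. x \<in> ?S \<Longrightarrow> (\<forall>i. \<alpha> c x $ i \<in> \<real>) \<and> \<xi> c x = {u. covec_form (\<alpha> c x) (\<lambda>_. cvec u) = 0} \<and>
        (\<exists>v. wedge 1 (2 * n) (covec_form (\<alpha> c x)) (wedge_power (bilin_form (ext_d (\<alpha> c) x)) n) v \<noteq> 0)"
    using cf c unfolding contact_form_on_def by blast+
  show "open U" "field_on A U covec_law \<alpha>" by fact+
  show oS: "open ?S" by (rule open_chart_image[OF c U])
  show sm: "smooth_on ?S (\<alpha> c)" using fo c unfolding field_on_def by blast
  show "x \<in> ?S \<Longrightarrow> \<alpha> c x $ i \<in> \<real>" using pt by blast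
  show "x \<in> ?S \<Longrightarrow> u \<in> \<xi> c x \<longleftrightarrow> cdot (\<alpha> c x) (cvec u) = 0" using pt[of x] by (simp add: covec_form_eq)
  show "x \<in> ?S \<Longrightarrow> vol \<alpha> c x \<noteq> 0"
    unfolding vol_def using pt[of x] det_nonzero_of_wedge[OF dim ext_d_skew] by blast
  show "x \<in> ?S \<Longrightarrow> vol \<alpha> c x \<in> \<real>"
    unfolding vol_def
  proof (rule det_real)
    fix i j assume x: "x \<in> ?S"
    have "pd i (\<lambda>y. \<alpha> c y $ j) x \<in> \<real>" for i j
      by (rule pd_real[OF oS x smooth_on_vec_nth[OF oS sm]]) (use pt in blast)
    then show "(ext_d (\<alpha> c) x + outer (\<alpha> c x) (\<alpha> c x)) $ i $ j \<in> \<real>"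
      using pt[OF x] by (simp add: ext_d_def)
  qed
qed

lemma cform_nonzero:
  assumes "is_cform U \<alpha>" "c \<in> A" "x \<in> crd c ` (dom_of c \<inter> U)"
  shows "\<alpha> c x \<noteq> 0"
proof
  assume 0: "\<alpha> c x = 0"
  then have "outer (\<alpha> c x) (\<alpha> c x) = 0" by (simp add: vec_eq_iff)
  then have "vol \<alpha> c x = 0" using det_odd_skew[OF ext_d_skew odd_dim, of "\<alpha> c" x] by (simp add: vol_def)
  then show False using cform(7)[OF assms] by blast
qed

lemma cform_at: obtains U \<alpha> where "is_cform U \<alpha>" "p \<in> U"
  using contact unfolding contact_structure_def by blast

lemma weight_nonzero:
  assumes "is_cform U \<alpha>" "c \<in> A" "x \<in> crd c ` (dom_of c \<inter> U)"
  shows "weight \<alpha> c x \<noteq> 0"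
  unfolding weight_def by (rule abs_powr_nonzero[OF cform(8)[OF assms] cform(7)[OF assms]])

lemma forms_proportional:
  assumes cf: "is_cform U \<alpha>" "is_cform U' \<alpha>'" and c: "c \<in> A"
    and x: "x \<in> crd c ` (dom_of c \<inter> U)" "x \<in> crd c ` (dom_of c \<inter> U')" and k: "\<alpha> c x $ k \<noteq> 0"
  shows "\<alpha>' c x = (\<alpha>' c x $ k / \<alpha> c x $ k) *s \<alpha> c x"
proof -
  have "\<alpha>' c x $ j * \<alpha> c x $ k = \<alpha>' c x $ k * \<alpha> c x $ j" for j
  proof -
    \<comment> \<open>This vector lies in the kernel of \<alpha>, hence in that of \<alpha>';
      evaluating \<alpha>' on it shows that a 2-by-2 minor of the two covectors vanishes.\<close>
    define u :: "real^'d" where "u = Re (\<alpha> c x $ k) *s axis j 1 - Re (\<alpha> c x $ j) *s axis k 1"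
    have r: "complex_of_real (Re (\<alpha> c x $ i)) = \<alpha> c x $ i" for i using cform(5)[OF cf(1) c x(1), of i] by simp
    have u: "cvec u = (\<alpha> c x $ k) *s axis j 1 - (\<alpha> c x $ j) *s axis k 1"
      by (simp add: u_def vec_eq_iff axis_def r)
    have "cdot (\<alpha> c x) (cvec u) = 0" unfolding u by (simp add: cdot_axis)
    then have "cdot (\<alpha>' c x) (cvec u) = 0"
      using cform(6)[OF cf(1) c x(1)] cform(6)[OF cf(2) c x(2)] by blast
    then show ?thesis unfolding u by (simp add: cdot_axis mult.commute)
  qed
  then show ?thesis using k by (simp add: vec_eq_iff field_simps)
qed

lemma tangent_indep:
  assumes cf: "is_cform U \<alpha>" "is_cform U' \<alpha>'" and c: "c \<in> A"
    and x: "x \<in> crd c ` (dom_of c \<inter> U)" "x \<in> crd c ` (dom_of c \<inter> U')" and Y: "cdot (\<alpha> c x) Y = 0"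
  shows "cdot (\<alpha>' c x) Y = 0"
proof -
  obtain k where k: "\<alpha> c x $ k \<noteq> 0" using cform_nonzero[OF cf(1) c x(1)] by (auto simp: vec_eq_iff)
  have "cdot (\<alpha>' c x) Y = cdot ((\<alpha>' c x $ k / \<alpha> c x $ k) *s \<alpha> c x) Y"
    using forms_proportional[OF cf c x k] by simp
  then show ?thesis by (simp add: Y)
qed

lemma phi_indep:
  assumes cf: "is_cform U \<alpha>" "is_cform U' \<alpha>'" and c: "c \<in> A"
    and x: "x \<in> crd c ` (dom_of c \<inter> U)" "x \<in> crd c ` (dom_of c \<inter> U')" and Y: "cdot (\<alpha> c x) Y = 0"
  shows "phi \<alpha>' c x Y = phi \<alpha> c x Y"
proof -
  let ?S0 = "crd c ` (dom_of c \<inter> U) \<inter> crd c ` (dom_of c \<inter> U')"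
  obtain k where k: "\<alpha> c x $ k \<noteq> 0" using cform_nonzero[OF cf(1) c x(1)] by (auto simp: vec_eq_iff)
  \<comment> \<open>On this open set the quotient of the k-th components is a smooth g with
    \<alpha>' = g\<alpha>. A neighbourhood is required and not just the point x, since dg enters
    through d\<alpha>'.\<close>
  define S where "S = (\<lambda>y. \<alpha> c y $ k) -` (- {0}) \<inter> ?S0"
  have o: "open ?S0" by (intro open_Int cform(2)[OF cf(1) c] cform(2)[OF cf(2) c])
  have sm0: "smooth_on ?S0 (\<alpha> c)" "smooth_on ?S0 (\<alpha>' c)"
    using cform(4)[OF cf(1) c] cform(4)[OF cf(2) c] smooth_on_subset by blast+
  have "open S" unfolding S_def
    by (rule continuous_on_open_vimage[THEN iffD1, rule_format, OF o smooth_on_imp_continuous_on[OF smooth_on_vec_nth[OF o sm0(1)]]]) auto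
  moreover have "x \<in> S" using x k by (simp add: S_def)
  ultimately have S: "open S" "x \<in> S" .
  have sm: "smooth_on S (\<alpha> c)" "smooth_on S (\<alpha>' c)" using sm0 smooth_on_subset[of ?S0 _ S] by (auto simp: S_def)
  define g where "g = (\<lambda>y. \<alpha>' c y $ k / \<alpha> c y $ k)"
  have g: "smooth_on S g" unfolding g_def
    by (intro smooth_on_divide smooth_on_vec_nth S sm) (simp add: S_def)
  have proportional: "\<alpha>' c y = g y *s \<alpha> c y" if "y \<in> S" for y
    unfolding g_def by (rule forms_proportional[OF cf c]) (use that in \<open>auto simp: S_def\<close>)
  have g0: "g x \<noteq> 0" using proportional[OF S(2)] cform_nonzero[OF cf(2) c x(2)] by auto
  \<comment> \<open>The ratio is real because contact forms have real entries, but its sign is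
    unknown.\<close>
  obtain r where r: "g x = of_real r"
    using cform(5)[OF cf(1) c x(1), of k] cform(5)[OF cf(2) c x(2), of k] unfolding g_def
    by (metis Reals_divide Reals_cases)
  have r0: "r \<noteq> 0" using g0 r by auto
  let ?dg = "\<chi> i. pd i g x"
  have W: "ext_d (\<alpha>' c) x = mscale (g x) (ext_d (\<alpha> c) x) + outer ?dg (\<alpha> c x) - outer (\<alpha> c x) ?dg"
    using ext_d_cong[OF S proportional sm(2)] ext_d_smult[OF S g sm(1)] by simp
  have "vol \<alpha>' c x = g x ^ (CARD('d) + 1) * vol \<alpha> c x"
  proof -
    have "vol \<alpha>' c x = det (mscale (g x) (ext_d (\<alpha> c) x) + outer ?dg (\<alpha> c x) - outer (\<alpha> c x) ?dg
        + mscale ((g x)\<^sup>2) (outer (\<alpha> c x) (\<alpha> c x)))"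
      unfolding vol_def W proportional[OF S(2)] by (simp add: outer_simps mscale_simps power2_eq_square)
    then show ?thesis
      using det_gauge[OF ext_d_skew odd_dim cform(7)[OF cf(1) c x(1), unfolded vol_def] g0] by (simp add: vol_def)
  qed
  also have "\<dots> = of_real (r ^ (2 * n + 2)) * vol \<alpha> c x" by (simp add: r dim)
  finally have v: "vol \<alpha>' c x = of_real (r ^ (2 * n + 2)) * vol \<alpha> c x" .
  \<comment> \<open>The factor is (r^2)^(n+1), positive for either sign of r. The exponent turns it
    into r^-2, which cancels the r^2 coming from \<open>kappa\<close>.\<close>
  have "\<bar>r ^ (2 * n + 2)\<bar> powr (- (1 / (real n + 1))) = inverse (r\<^sup>2)"
  proof -
    have "\<bar>r ^ (2 * n + 2)\<bar> = (r\<^sup>2) powr (real n + 1)"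
    proof -
      have "r ^ (2 * n + 2) = (r\<^sup>2) ^ (n + 1)" using power_mult[of r 2 "n + 1"] by simp
      then have "\<bar>r ^ (2 * n + 2)\<bar> = (r\<^sup>2) ^ (n + 1)" by (simp only: abs_of_nonneg zero_le_power zero_le_power2)
      also have "\<dots> = (r\<^sup>2) powr real (n + 1)" using r0 by (intro powr_realpow[symmetric]) simp
      finally show ?thesis by (simp add: add.commute)
    qed
    then have "\<bar>r ^ (2 * n + 2)\<bar> powr (- (1 / (real n + 1))) = (r\<^sup>2) powr (- 1)"
      by (simp add: powr_powr)
    also have "\<dots> = inverse (r\<^sup>2)" by (simp add: powr_minus)
    finally show ?thesis .
  qed
  then have w: "weight \<alpha>' c x = inverse ((g x)\<^sup>2) * weight \<alpha> c x"
    unfolding weight_def v abs_powr_mult_of_real by (simp add: r)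
  have "kappa (\<alpha>' c x) (ext_d (\<alpha>' c) x) Y = mscale ((g x)\<^sup>2) (kappa (\<alpha> c x) (ext_d (\<alpha> c) x) Y)"
    unfolding proportional[OF S(2)] by (rule kappa_gauge[OF Y W])
  moreover have "weight \<alpha>' c x / \<mu> c x * (g x)\<^sup>2 = weight \<alpha> c x / \<mu> c x"
    using g0 by (simp add: w)
  ultimately show ?thesis unfolding phi_def by (simp only: mscale_simps)
qed

text \<open>Both \<alpha> and d\<alpha> pull back by J, so \<open>vol\<close> acquires (det J)^2 and
  \<open>weight\<close> the factor |det J| to the power \<open>\<Lambda>\<close>. This is also the
  factor of \<mu>, hence their quotient is a scalar.\<close>

lemma form_chg:
  assumes cf: "is_cform U \<alpha>" and c: "c \<in> A" "c' \<in> A" and p: "p \<in> dom_of c" "p \<in> dom_of c'" "p \<in> U"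
  defines "J \<equiv> cmat (jac c c' p)"
  shows "cdot (\<alpha> c (crd c p)) Y = cdot (\<alpha> c' (crd c' p)) (J *v Y)"
    "phi \<alpha> c (crd c p) Y = transpose J ** phi \<alpha> c' (crd c' p) (J *v Y) ** J"
proof -
  interpret transition A c c' U by (rule transitionI[OF c cform(1)[OF cf c(1)]])
  let ?x = "crd c p" and ?x' = "crd c' p"
  have x: "?x \<in> src" by (rule point_in_src[OF p])
  note fo = cform(3)[OF cf c(1)]
  have eq: "\<alpha> c y = \<alpha> c' (chg y) v* tjac y" if "y \<in> src" for y by (rule covec_chg[OF fo that])
  have Jx: "tjac ?x = J" "chg ?x = ?x'" using trans_point[OF p(1)] by (simp_all add: J_def)
  have a: "\<alpha> c ?x = \<alpha> c' ?x' v* J" using eq[OF x] Jx by simp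
  show "cdot (\<alpha> c ?x) Y = cdot (\<alpha> c' ?x') (J *v Y)" unfolding a by (rule cdot_mult_vec[symmetric])
  have W: "ext_d (\<alpha> c) ?x = transpose J ** ext_d (\<alpha> c') ?x' ** J"
    using ext_d_pullback[OF open_src x open_tgt trans_src smooth_on_trans tjac_eq
        field_on_smooth(1)[OF fo] field_on_smooth(2)[OF fo] eq] by (simp add: Jx)
  have M: "ext_d (\<alpha> c) ?x + outer (\<alpha> c ?x) (\<alpha> c ?x) = transpose J ** (ext_d (\<alpha> c') ?x' + outer (\<alpha> c' ?x') (\<alpha> c' ?x')) ** J"
    unfolding W a outer_pullback by (simp add: matrix_add_ldistrib matrix_rdistribs)
  let ?d = "det (jac c c' p)"
  have "vol \<alpha> c ?x = of_real (?d\<^sup>2) * vol \<alpha> c' ?x'"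
    unfolding vol_def M by (simp add: det_mul J_def det_cmat power2_eq_square)
  moreover have "\<bar>?d\<^sup>2\<bar> powr (- (1 / (real n + 1))) = \<bar>?d\<bar> powr \<Lambda>"
  proof -
    have "?d \<noteq> 0" using det_jac_nonzero[OF c p(1,2)] by (auto simp: det_cmat)
    then have "\<bar>?d\<^sup>2\<bar> = \<bar>?d\<bar> powr 2" by simp
    then show ?thesis by (simp only: powr_powr) simp
  qed
  ultimately have w: "weight \<alpha> c ?x = of_real (\<bar>?d\<bar> powr \<Lambda>) * weight \<alpha> c' ?x'"
    unfolding weight_def by (simp only: abs_powr_mult_of_real)
  have m: "\<mu> c ?x = of_real (\<bar>?d\<bar> powr \<Lambda>) * \<mu> c' ?x'"
    using mu c p unfolding densities_def fields_def field_on_def density_law_def by blast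
  have "?d \<noteq> 0" using det_jac_nonzero[OF c p(1,2)] by (auto simp: det_cmat)
  then have "weight \<alpha> c ?x / \<mu> c ?x = weight \<alpha> c' ?x' / \<mu> c' ?x'" unfolding w m by simp
  then show "phi \<alpha> c ?x Y = transpose J ** phi \<alpha> c' ?x' (J *v Y) ** J"
    unfolding phi_def a W kappa_pullback by (simp add: mscale_mult)
qed

lemma smooth_vol:
  assumes cf: "is_cform U \<alpha>" and c: "c \<in> A"
  shows "smooth_on (crd c ` (dom_of c \<inter> U)) (vol \<alpha> c)" "smooth_on (crd c ` (dom_of c \<inter> U)) (weight \<alpha> c)"
    "smooth_on (crd c ` (dom_of c \<inter> U)) (\<mu> c)"
    "smooth_on (crd c ` (dom_of c \<inter> U)) (\<lambda>x. ext_d (\<alpha> c) x + outer (\<alpha> c x) (\<alpha> c x))"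
proof -
  note o = cform(2)[OF cf c] and a = cform(4)[OF cf c]
  show M: "smooth_on (crd c ` (dom_of c \<inter> U)) (\<lambda>x. ext_d (\<alpha> c) x + outer (\<alpha> c x) (\<alpha> c x))"
    by (rule smooth_on_add[OF o smooth_on_derivs(5)[OF o a] smooth_on_vec_ops(5)[OF o a a]])
  show v: "smooth_on (crd c ` (dom_of c \<inter> U)) (vol \<alpha> c)"
    unfolding vol_def[abs_def] by (rule smooth_on_vec_ops(9)[OF o M])
  show "smooth_on (crd c ` (dom_of c \<inter> U)) (weight \<alpha> c)"
    unfolding weight_def[abs_def]
    by (rule smooth_on_abs_powr_comp[OF o v cform(8)[OF cf c] cform(7)[OF cf c]])
  show "smooth_on (crd c ` (dom_of c \<inter> U)) (\<mu> c)"
    by (rule smooth_on_subset[OF fields_smooth[OF mu[unfolded densities_def] c] image_mono[OF Int_lower1]])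
qed

lemma smooth_phi:
  assumes cf: "is_cform U \<alpha>" and c: "c \<in> A" and Y: "smooth_on (crd c ` (dom_of c \<inter> U)) Y"
  shows "smooth_on (crd c ` (dom_of c \<inter> U)) (\<lambda>x. phi \<alpha> c x (Y x))"
    "smooth_on (crd c ` (dom_of c \<inter> U)) (\<lambda>x. kappa (\<alpha> c x) (ext_d (\<alpha> c) x) (Y x))"
    "smooth_on (crd c ` (dom_of c \<inter> U)) (\<lambda>x. weight \<alpha> c x / \<mu> c x)"
proof -
  note o = cform(2)[OF cf c] and a = cform(4)[OF cf c] and v = smooth_vol[OF cf c]
  have b: "smooth_on (crd c ` (dom_of c \<inter> U)) (\<lambda>x. Y x v* ext_d (\<alpha> c) x)"
    by (rule smooth_on_vec_ops(3)[OF o smooth_on_derivs(5)[OF o a] Y])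
  show k: "smooth_on (crd c ` (dom_of c \<inter> U)) (\<lambda>x. kappa (\<alpha> c x) (ext_d (\<alpha> c) x) (Y x))"
    unfolding kappa_def by (rule smooth_on_diff[OF o smooth_on_vec_ops(5)[OF o a b] smooth_on_vec_ops(5)[OF o b a]])
  show h: "smooth_on (crd c ` (dom_of c \<inter> U)) (\<lambda>x. weight \<alpha> c x / \<mu> c x)"
    by (rule smooth_on_divide[OF o v(2,3)]) (use mu_nonzero[OF c] in blast)
  show "smooth_on (crd c ` (dom_of c \<inter> U)) (\<lambda>x. phi \<alpha> c x (Y x))"
    unfolding phi_def by (rule smooth_on_vec_ops(6)[OF o h k])
qed

end

section \<open>Tangent fields and two-forms\<close>

lemma matD_eq_on:
  assumes S: "open S" "x \<in> S" and eq: "\<And>y. y \<in> S \<Longrightarrow> F y = G y" and F: "smooth_on S F"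
  shows "matD v F x = matD v G x"
proof -
  have "ddir v (\<lambda>y. F y $ k $ l) x = ddir v (\<lambda>y. G y $ k $ l) x" for k l
    by (rule ddir_cong[OF S]) (use eq smooth_on_nth_iff(2)[OF S(1) F] in auto)
  then show ?thesis by (simp add: vec_eq_iff)
qed

context atlas
begin

lemma smooth_functions_iff:
  "r \<in> carrier (smooth_functions A) \<longleftrightarrow> (\<forall>c\<in>A. smooth_on (img_of c) (\<lambda>x. r (icrd c x)))"
  by (simp add: smooth_functions_def smooth_fun_on_def comp_def)

lemma cring_smooth_functions: "cring (smooth_functions A)"
proof (rule cringI)
  show "abelian_group (smooth_functions A)"
  proof (rule abelian_groupI)
    fix f assume f: "f \<in> carrier (smooth_functions A)"
    have "(\<lambda>p. - f p) \<in> carrier (smooth_functions A)"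
      using f unfolding smooth_functions_iff by (auto intro!: smooth_on_minus open_img)
    moreover have "(\<lambda>p. - f p) \<oplus>\<^bsub>smooth_functions A\<^esub> f = \<zero>\<^bsub>smooth_functions A\<^esub>"
      by (simp add: smooth_functions_def)
    ultimately show "\<exists>g\<in>carrier (smooth_functions A). g \<oplus>\<^bsub>smooth_functions A\<^esub> f = \<zero>\<^bsub>smooth_functions A\<^esub>" by blast
  next
    show "f \<oplus>\<^bsub>smooth_functions A\<^esub> g \<in> carrier (smooth_functions A)"
      if "f \<in> carrier (smooth_functions A)" "g \<in> carrier (smooth_functions A)" for f g
      using that unfolding smooth_functions_iff
      by (simp add: smooth_functions_def) (auto intro!: smooth_on_add open_img)
    show "\<zero>\<^bsub>smooth_functions A\<^esub> \<in> carrier (smooth_functions A)"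
      unfolding smooth_functions_iff by (simp add: smooth_functions_def) (auto intro!: smooth_on_const open_img)
  qed (simp_all add: smooth_functions_def add_ac)
  show "Group.comm_monoid (smooth_functions A)"
  proof (rule comm_monoidI)
    show "f \<otimes>\<^bsub>smooth_functions A\<^esub> g \<in> carrier (smooth_functions A)"
      if "f \<in> carrier (smooth_functions A)" "g \<in> carrier (smooth_functions A)" for f g
      using that unfolding smooth_functions_iff
      by (simp add: smooth_functions_def) (auto intro!: smooth_on_mult open_img)
    show "\<one>\<^bsub>smooth_functions A\<^esub> \<in> carrier (smooth_functions A)"
      unfolding smooth_functions_iff by (simp add: smooth_functions_def) (auto intro!: smooth_on_const open_img)
  qed (simp_all add: smooth_functions_def mult_ac)
qed (simp_all add: smooth_functions_def algebra_simps)

end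

context contact_manifold
begin

abbreviation "R \<equiv> smooth_functions A"
abbreviation "TV \<equiv> TVect A n \<xi>"
abbreviation "OM \<equiv> Omega20 A \<xi>"
abbreviation "DN \<equiv> Density A \<Lambda>"

lemma TVect_iff:
  "Y \<in> carrier TV \<longleftrightarrow> Y \<in> vector_fields A \<and>
    (\<forall>U \<alpha> c x. is_cform U \<alpha> \<longrightarrow> c \<in> A \<longrightarrow> x \<in> crd c ` (dom_of c \<inter> U) \<longrightarrow> cdot (\<alpha> c x) (Y c x) = 0)"
  unfolding TVect_def covec_form_eq by (simp only: partial_object.simps mem_Collect_eq Ball_def) blast

lemma Omega20_iff:
  "w \<in> carrier OM \<longleftrightarrow> w \<in> two_forms A \<and>
    (\<forall>c\<in>A. \<forall>x\<in>img_of c. \<forall>u\<in>\<xi> c x. \<forall>v\<in>\<xi> c x. cdot (cvec u) (w c x *v cvec v) = 0)"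
  unfolding Omega20_def by (simp add: bilin_form_eq)

lemma TV_tangent:
  "Y \<in> carrier TV \<Longrightarrow> is_cform U \<alpha> \<Longrightarrow> c \<in> A \<Longrightarrow> x \<in> crd c ` (dom_of c \<inter> U) \<Longrightarrow> cdot (\<alpha> c x) (Y c x) = 0"
  unfolding TVect_iff by blast

lemma TV_field: "Y \<in> carrier TV \<Longrightarrow> Y \<in> fields A vec_law"
  unfolding TVect_iff vector_fields_def by blast

lemma OM_field: "w \<in> carrier OM \<Longrightarrow> w \<in> fields A bilin_law"
  unfolding Omega20_iff two_forms_def by blast

lemma OM_skew: "w \<in> carrier OM \<Longrightarrow> transpose (w c x) = - w c x"
proof -
  assume w: "w \<in> carrier OM"
  have "w c x $ i $ j = - w c x $ j $ i" for i j using w unfolding Omega20_iff two_forms_def by blast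
  then show ?thesis unfolding vec_eq_iff transpose_def vec_lambda_beta vector_uminus_component by (intro allI)
qed

text \<open>\<open>Omega20\<close> tests only real vectors of the hyperplane; the contact form being
  real, the vanishing extends to complex vectors.\<close>

lemma OM_kernel:
  assumes w: "w \<in> carrier OM" and cf: "is_cform U \<alpha>" and c: "c \<in> A" and x: "x \<in> crd c ` (dom_of c \<inter> U)"
    and uv: "cdot (\<alpha> c x) u = 0" "cdot (\<alpha> c x) v = 0"
  shows "cdot u (w c x *v v) = 0"
proof (rule complexify_kernel[OF cform(5)[OF cf c x] _ uv])
  have "x \<in> img_of c" using x by blast
  then show "cdot (cvec u) (w c x *v cvec v) = 0"
    if "cdot (\<alpha> c x) (cvec u) = 0" "cdot (\<alpha> c x) (cvec v) = 0" for u v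
    using w that c cform(6)[OF cf c x] unfolding Omega20_iff by blast
qed

text \<open>A contact form near each point, as there need not be a global one. The choice depends on
  the point of the manifold and not on the chart, so that one form serves all charts at that
  point.\<close>

definition "pick p = (SOME q. is_cform (fst q) (snd q) \<and> p \<in> fst q)"

lemma pick: "is_cform (fst (pick p)) (snd (pick p))" "p \<in> fst (pick p)"
proof -
  obtain U \<alpha> where "is_cform U \<alpha>" "p \<in> U" by (rule cform_at)
  then have "\<exists>q. is_cform (fst q) (snd q) \<and> p \<in> fst q" by (intro exI[of _ "(U, \<alpha>)"]) simp
  from someI_ex[OF this] show "is_cform (fst (pick p)) (snd (pick p))" "p \<in> fst (pick p)"
    unfolding pick_def by blast+
qed

lemma pick_point:
  assumes "c \<in> A" "x \<in> img_of c"
  shows "x \<in> crd c ` (dom_of c \<inter> fst (pick (icrd c x)))"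
  using in_chart_image_iff[OF assms(1)] pick(2) assms(2) by blast

text \<open>Every point uses its own contact form; although this choice may jump, the result is
  smooth and tensorial because \<open>phi\<close> does not depend on the form for tangent
  vectors.\<close>

definition "Phi Y c x = (if c \<in> A \<and> x \<in> img_of c then phi (snd (pick (icrd c x))) c x (Y c x) else 0)"

definition "tangent_vec \<alpha> c x w = tangent_of (\<alpha> c x) (ext_d (\<alpha> c) x) (mscale (\<mu> c x / weight \<alpha> c x) w)"

definition "Psi w c x = (if c \<in> A \<and> x \<in> img_of c then tangent_vec (snd (pick (icrd c x))) c x (w c x) else 0)"

lemma Phi_eq:
  assumes Y: "Y \<in> carrier TV" and cf: "is_cform U \<alpha>" and c: "c \<in> A" and x: "x \<in> crd c ` (dom_of c \<inter> U)"
  shows "Phi Y c x = phi \<alpha> c x (Y c x)"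
proof -
  have i: "x \<in> img_of c" using x by blast
  have "phi (snd (pick (icrd c x))) c x (Y c x) = phi \<alpha> c x (Y c x)"
    by (rule phi_indep[OF cf pick(1) c x pick_point[OF c i] TV_tangent[OF Y cf c x]])
  then show ?thesis using c i unfolding Phi_def by (simp only: simp_thms if_True)
qed

lemma phi_injective:
  assumes cf: "is_cform U \<alpha>" and c: "c \<in> A" and x: "x \<in> crd c ` (dom_of c \<inter> U)"
    and Y: "cdot (\<alpha> c x) Y = 0" "cdot (\<alpha> c x) Y' = 0" and eq: "phi \<alpha> c x Y = phi \<alpha> c x Y'"
  shows "Y = Y'"
proof -
  have i: "x \<in> img_of c" using x by blast
  have h: "weight \<alpha> c x / \<mu> c x \<noteq> 0" using weight_nonzero[OF cf c x] mu_nonzero[OF c i] by simp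
  have "kappa (\<alpha> c x) (ext_d (\<alpha> c) x) Y = kappa (\<alpha> c x) (ext_d (\<alpha> c) x) Y'"
    using eq h unfolding phi_def vec_eq_iff mscale_nth by (simp only: mult_cancel_left) blast
  moreover have "kappa (\<alpha> c x) (ext_d (\<alpha> c) x) (Y - Y')
      = kappa (\<alpha> c x) (ext_d (\<alpha> c) x) Y + mscale (- 1) (kappa (\<alpha> c x) (ext_d (\<alpha> c) x) Y')"
    unfolding kappa_linear[symmetric] by (rule arg_cong) (simp add: vec_eq_iff)
  moreover have "B + mscale (- 1) B = 0" for B :: "complex^'d^'d" by (simp add: vec_eq_iff)
  ultimately have "kappa (\<alpha> c x) (ext_d (\<alpha> c) x) (Y - Y') = 0" by (simp only:)
  moreover have "cdot (\<alpha> c x) (Y - Y') = 0" by (simp add: Y)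
  ultimately have "Y - Y' = 0"
    using kappa_injective[OF ext_d_skew odd_dim cform(7)[OF cf c x, unfolded vol_def]] by blast
  then show ?thesis by simp
qed

lemma tangent_vec_props:
  assumes w: "w \<in> carrier OM" and cf: "is_cform U \<alpha>" and c: "c \<in> A" and x: "x \<in> crd c ` (dom_of c \<inter> U)"
  shows "cdot (\<alpha> c x) (tangent_vec \<alpha> c x (w c x)) = 0" "phi \<alpha> c x (tangent_vec \<alpha> c x (w c x)) = w c x"
    "w c x = outer (\<alpha> c x) ((matrix_inv (ext_d (\<alpha> c) x + outer (\<alpha> c x) (\<alpha> c x)) *v \<alpha> c x) v* w c x)
       - outer ((matrix_inv (ext_d (\<alpha> c) x + outer (\<alpha> c x) (\<alpha> c x)) *v \<alpha> c x) v* w c x) (\<alpha> c x)"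
proof -
  have i: "x \<in> img_of c" using x by blast
  let ?k = "\<mu> c x / weight \<alpha> c x"
  have sk: "transpose (mscale ?k (w c x)) = - mscale ?k (w c x)"
  proof -
    have "transpose (mscale ?k (w c x)) = mscale ?k (transpose (w c x))" by (simp add: vec_eq_iff transpose_def)
    then show ?thesis unfolding OM_skew[OF w] mscale_simps(3) .
  qed
  have ker: "cdot u (mscale ?k (w c x) *v v) = 0" if "cdot (\<alpha> c x) u = 0" "cdot (\<alpha> c x) v = 0" for u v
    using OM_kernel[OF w cf c x that] by (simp add: mscale_mult_vec)
  note D = cform(7)[OF cf c x, unfolded vol_def]
  note t = kappa_tangent_of[OF ext_d_skew odd_dim D sk ker]
  show "cdot (\<alpha> c x) (tangent_vec \<alpha> c x (w c x)) = 0" unfolding tangent_vec_def by (rule t(1))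
  have k: "kappa (\<alpha> c x) (ext_d (\<alpha> c) x) (tangent_vec \<alpha> c x (w c x)) = mscale ?k (w c x)"
    unfolding tangent_vec_def by (rule t(2))
  have e: "weight \<alpha> c x / \<mu> c x * ?k = 1" using weight_nonzero[OF cf c x] mu_nonzero[OF c i] by simp
  show "phi \<alpha> c x (tangent_vec \<alpha> c x (w c x)) = w c x"
    unfolding phi_def k mscale_simps(4) e by (rule mscale_simps(5))
  show "w c x = outer (\<alpha> c x) ((matrix_inv (ext_d (\<alpha> c) x + outer (\<alpha> c x) (\<alpha> c x)) *v \<alpha> c x) v* w c x)
       - outer ((matrix_inv (ext_d (\<alpha> c) x + outer (\<alpha> c x) (\<alpha> c x)) *v \<alpha> c x) v* w c x) (\<alpha> c x)"
    by (rule kappa_tangent_of(3)[OF ext_d_skew odd_dim D OM_skew[OF w] OM_kernel[OF w cf c x]])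
qed

text \<open>Independence of the form is carried over from \<open>phi\<close>: both candidates are
  tangent and have the same image under an injective map. The matrix inverses for two different
  forms are never compared directly.\<close>

lemma Psi_eq:
  assumes w: "w \<in> carrier OM" and cf: "is_cform U \<alpha>" and c: "c \<in> A" and x: "x \<in> crd c ` (dom_of c \<inter> U)"
  shows "Psi w c x = tangent_vec \<alpha> c x (w c x)"
proof -
  have i: "x \<in> img_of c" using x by blast
  let ?\<alpha>' = "snd (pick (icrd c x))"
  note p = pick_point[OF c i] note cf' = pick(1)[of "icrd c x"]
  have t: "cdot (\<alpha> c x) (tangent_vec ?\<alpha>' c x (w c x)) = 0"
    by (rule tangent_indep[OF cf' cf c p x tangent_vec_props(1)[OF w cf' c p]])
  have "phi \<alpha> c x (tangent_vec ?\<alpha>' c x (w c x)) = phi ?\<alpha>' c x (tangent_vec ?\<alpha>' c x (w c x))"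
    by (rule phi_indep[OF cf' cf c p x tangent_vec_props(1)[OF w cf' c p]])
  then have "phi \<alpha> c x (tangent_vec ?\<alpha>' c x (w c x)) = phi \<alpha> c x (tangent_vec \<alpha> c x (w c x))"
    unfolding tangent_vec_props(2)[OF w cf' c p] tangent_vec_props(2)[OF w cf c x] .
  then have "tangent_vec ?\<alpha>' c x (w c x) = tangent_vec \<alpha> c x (w c x)"
    by (rule phi_injective[OF cf c x t tangent_vec_props(1)[OF w cf c x]])
  then show ?thesis using c i unfolding Psi_def by (simp only: simp_thms if_True)
qed

lemma Phi_in_Omega20:
  assumes Y: "Y \<in> carrier TV"
  shows "Phi Y \<in> carrier OM"
proof -
  note Yf = TV_field[OF Y]
  have out: "Phi Y c x = 0" if "c \<notin> A \<or> x \<notin> img_of c" for c x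
    using that unfolding Phi_def by (simp only: if_False de_Morgan_conj[symmetric])
  have "Phi Y \<in> fields A bilin_law"
  proof (rule fieldsI)
    fix c assume c: "c \<in> A"
    show "smooth_on (img_of c) (Phi Y c)"
    proof (rule smooth_on_local)
      fix y assume y: "y \<in> img_of c"
      let ?S = "crd c ` (dom_of c \<inter> fst (pick (icrd c y)))"
      note cf = pick(1)[of "icrd c y"]
      have "smooth_on ?S (Y c)"
        by (rule smooth_on_subset[OF fields_smooth[OF Yf c] image_mono[OF Int_lower1]])
      from smooth_on_cong[OF cform(2)[OF cf c] Phi_eq[OF Y cf c, symmetric] smooth_phi(1)[OF cf c this]]
      have "smooth_on ?S (Phi Y c)" .
      then show "\<exists>T. open T \<and> y \<in> T \<and> smooth_on T (Phi Y c)"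
        using cform(2)[OF cf c] pick_point[OF c y] by blast
    qed
  next
    fix c c' p assume c: "c \<in> A" "c' \<in> A" and p: "p \<in> dom_of c" "p \<in> dom_of c'"
    note cf = pick(1)[of p]
    have x: "crd c p \<in> crd c ` (dom_of c \<inter> fst (pick p))" "crd c' p \<in> crd c' ` (dom_of c' \<inter> fst (pick p))"
      using p pick(2)[of p] by blast+
    have "Y c' (crd c' p) = cmat (jac c c' p) *v Y c (crd c p)"
      using Yf c p unfolding fields_def field_on_def vec_law_def by blast
    then show "bilin_law (jac c c' p) (Phi Y c (crd c p)) (Phi Y c' (crd c' p))"
      unfolding Phi_eq[OF Y cf c(1) x(1)] Phi_eq[OF Y cf c(2) x(2)] bilin_law_def
      using form_chg(2)[OF cf c p pick(2)] by simp
  qed (rule out)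
  moreover have "Phi Y c x $ i $ j = - Phi Y c x $ j $ i" for c x i j
    using kappa_skew[of _ _ "Y c x" i j] by (simp add: Phi_def phi_def)
  moreover have "cdot (cvec u) (Phi Y c x *v cvec v) = 0"
    if c: "c \<in> A" and x: "x \<in> img_of c" and uv: "u \<in> \<xi> c x" "v \<in> \<xi> c x" for c x u v
  proof -
    note cf = pick(1)[of "icrd c x"] and p = pick_point[OF c x]
    have "cdot (snd (pick (icrd c x)) c x) (cvec u) = 0" "cdot (snd (pick (icrd c x)) c x) (cvec v) = 0"
      using cform(6)[OF cf c p] uv by blast+
    then show ?thesis unfolding Phi_eq[OF Y cf c p] phi_def by (simp add: mscale_mult_vec kappa_kernel)
  qed
  ultimately show ?thesis unfolding Omega20_iff two_forms_def by blast
qed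

lemma congruence_cancel:
  fixes J :: "complex^'d^'d"
  assumes "det J \<noteq> 0" "transpose J ** P ** J = transpose J ** Q ** J"
  shows "P = Q"
proof -
  obtain K where K: "J ** K = mat 1" using assms(1) by (metis invertible_det_nz invertible_right_inverse)
  have KT: "transpose K ** transpose J = mat 1" using K by (metis matrix_transpose_mul transpose_mat)
  have "transpose K ** (transpose J ** B ** J) ** K = B" for B
    unfolding matrix_mul_assoc KT unfolding matrix_mul_assoc[symmetric] K by simp
  then show ?thesis using assms(2) by metis
qed

lemma Psi_in_TVect:
  assumes w: "w \<in> carrier OM"
  shows "Psi w \<in> carrier TV"
proof -
  note wf = OM_field[OF w]
  have "Psi w \<in> fields A vec_law"
  proof (rule fieldsI)
    fix c assume c: "c \<in> A"
    show "smooth_on (img_of c) (Psi w c)"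
    proof (rule smooth_on_local)
      fix y assume y: "y \<in> img_of c"
      let ?S = "crd c ` (dom_of c \<inter> fst (pick (icrd c y)))" and ?\<alpha> = "snd (pick (icrd c y))"
      note cf = pick(1)[of "icrd c y"]
      note o = cform(2)[OF cf c] and a = cform(4)[OF cf c] and v = smooth_vol[OF cf c]
      have ws: "smooth_on ?S (w c)"
        by (rule smooth_on_subset[OF fields_smooth[OF wf c] image_mono[OF Int_lower1]])
      have B: "smooth_on ?S (\<lambda>x. matrix_inv (ext_d (?\<alpha> c) x + outer (?\<alpha> c x) (?\<alpha> c x)))"
        by (rule smooth_on_matrix_inv[OF o v(4) cform(7)[OF cf c, unfolded vol_def]])
      have h: "smooth_on ?S (\<lambda>x. \<mu> c x / weight ?\<alpha> c x)"
        by (rule smooth_on_divide[OF o v(3,2) weight_nonzero[OF cf c]])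
      have "smooth_on ?S (\<lambda>x. tangent_vec ?\<alpha> c x (w c x))"
        unfolding tangent_vec_def tangent_of_def
        by (rule smooth_on_minus[OF o smooth_on_vec_ops(2)[OF o B smooth_on_vec_ops(3)[OF o
                smooth_on_vec_ops(6)[OF o h ws] smooth_on_vec_ops(2)[OF o B a]]]])
      from smooth_on_cong[OF o Psi_eq[OF w cf c, symmetric] this]
      have "smooth_on ?S (Psi w c)" .
      then show "\<exists>T. open T \<and> y \<in> T \<and> smooth_on T (Psi w c)"
        using o pick_point[OF c y] by blast
    qed
  next
    fix c c' p assume c: "c \<in> A" "c' \<in> A" and p: "p \<in> dom_of c" "p \<in> dom_of c'"
    note cf = pick(1)[of p]
    let ?\<alpha> = "snd (pick p)" and ?J = "cmat (jac c c' p)" and ?x = "crd c p" and ?x' = "crd c' p"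
    have x: "?x \<in> crd c ` (dom_of c \<inter> fst (pick p))" "?x' \<in> crd c' ` (dom_of c' \<inter> fst (pick p))"
      using p pick(2)[of p] by blast+
    note e = Psi_eq[OF w cf c(1) x(1)] Psi_eq[OF w cf c(2) x(2)]
    note ch = form_chg[OF cf c p pick(2), of "tangent_vec ?\<alpha> c ?x (w c ?x)"]
    have t: "cdot (?\<alpha> c' ?x') (?J *v tangent_vec ?\<alpha> c ?x (w c ?x)) = 0"
      using ch(1) tangent_vec_props(1)[OF w cf c(1) x(1)] by simp
    have "w c ?x = transpose ?J ** w c' ?x' ** ?J"
      using wf c p unfolding fields_def field_on_def bilin_law_def by blast
    then have "transpose ?J ** phi ?\<alpha> c' ?x' (?J *v tangent_vec ?\<alpha> c ?x (w c ?x)) ** ?J = transpose ?J ** w c' ?x' ** ?J"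
      using ch(2) tangent_vec_props(2)[OF w cf c(1) x(1)] by simp
    \<comment> \<open>The transformation law is verified after applying \<open>phi\<close>: the
      invertible J cancels from the congruence, and \<open>phi\<close> is injective on tangent
      vectors.\<close>
    then have "phi ?\<alpha> c' ?x' (?J *v tangent_vec ?\<alpha> c ?x (w c ?x)) = w c' ?x'"
      by (rule congruence_cancel[OF det_jac_nonzero[OF c p]])
    also have "\<dots> = phi ?\<alpha> c' ?x' (tangent_vec ?\<alpha> c' ?x' (w c' ?x'))" by (rule tangent_vec_props(2)[OF w cf c(2) x(2), symmetric])
    finally have "?J *v tangent_vec ?\<alpha> c ?x (w c ?x) = tangent_vec ?\<alpha> c' ?x' (w c' ?x')"
      by (rule phi_injective[OF cf c(2) x(2) t tangent_vec_props(1)[OF w cf c(2) x(2)]])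
    then show "vec_law (jac c c' p) (Psi w c ?x) (Psi w c' ?x')"
      unfolding e vec_law_def by (rule sym)
  next
    show "Psi w c x = 0" if "c \<notin> A \<or> x \<notin> img_of c" for c x
      using that unfolding Psi_def by (simp only: if_False de_Morgan_conj[symmetric])
  qed
  moreover have "cdot (\<alpha> c x) (Psi w c x) = 0"
    if "is_cform U \<alpha>" "c \<in> A" "x \<in> crd c ` (dom_of c \<inter> U)" for U \<alpha> c x
    unfolding Psi_eq[OF w that] by (rule tangent_vec_props(1)[OF w that])
  ultimately show ?thesis unfolding TVect_iff vector_fields_def by blast
qed

lemma Phi_Psi:
  assumes w: "w \<in> carrier OM"
  shows "Phi (Psi w) = w"
proof (intro ext)
  fix c x
  show "Phi (Psi w) c x = w c x"
  proof (cases "c \<in> A \<and> x \<in> img_of c")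
    case True
    then have c: "c \<in> A" and x: "x \<in> img_of c" by (rule conjunct1, rule conjunct2)
    note cf = pick(1)[of "icrd c x"] and p = pick_point[OF c x]
    show ?thesis unfolding Phi_eq[OF Psi_in_TVect[OF w] cf c p] Psi_eq[OF w cf c p] by (rule tangent_vec_props(2)[OF w cf c p])
  next
    case False
    then have "w c x = 0" by (intro fields_outside[OF OM_field[OF w]]) (simp only: de_Morgan_conj)
    then show ?thesis using False unfolding Phi_def by (simp only: if_False)
  qed
qed

lemma bij_Phi: "bij_betw Phi (carrier TV) (carrier OM)"
proof (rule bij_betwI[where g = Psi])
  show "Phi \<in> carrier TV \<rightarrow> carrier OM" "Psi \<in> carrier OM \<rightarrow> carrier TV"
    using Phi_in_Omega20 Psi_in_TVect by blast+
  show "Phi (Psi w) = w" if "w \<in> carrier OM" for w by (rule Phi_Psi[OF that])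
  fix Y assume Y: "Y \<in> carrier TV"
  show "Psi (Phi Y) = Y"
  proof (intro ext)
    fix c x
    show "Psi (Phi Y) c x = Y c x"
    proof (cases "c \<in> A \<and> x \<in> img_of c")
      case True
      then have c: "c \<in> A" and x: "x \<in> img_of c" by (rule conjunct1, rule conjunct2)
      note cf = pick(1)[of "icrd c x"] and p = pick_point[OF c x]
      note O = Phi_in_Omega20[OF Y]
      have "phi (snd (pick (icrd c x))) c x (tangent_vec (snd (pick (icrd c x))) c x (Phi Y c x)) = phi (snd (pick (icrd c x))) c x (Y c x)"
        unfolding tangent_vec_props(2)[OF O cf c p] by (rule Phi_eq[OF Y cf c p])
      then show ?thesis unfolding Psi_eq[OF O cf c p]
        by (rule phi_injective[OF cf c p tangent_vec_props(1)[OF O cf c p] TV_tangent[OF Y cf c p]])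
    next
      case False
      then have "Y c x = 0" by (intro fields_outside[OF TV_field[OF Y]]) (simp only: de_Morgan_conj)
      then show ?thesis using False unfolding Psi_def by (simp only: if_False)
    qed
  qed
qed

end

section \<open>Lie derivatives on both sides and equivariance\<close>

context contact_manifold
begin

lemma CVect_field: "X \<in> CVect A n \<xi> \<Longrightarrow> X \<in> vector_fields A"
  unfolding CVect_def by blast

lemma CVect_chart:
  assumes X: "X \<in> CVect A n \<xi>" and cf: "is_cform U \<alpha>" and c: "c \<in> A"
  obtains f where "smooth_on (crd c ` (dom_of c \<inter> U)) f"
    "\<And>y. y \<in> crd c ` (dom_of c \<inter> U) \<Longrightarrow> vecD (X c y) (\<alpha> c) y + \<alpha> c y v* cjac (X c) y = f y *s \<alpha> c y"
proof -
  obtain h where h: "smooth_fun_on A U h"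
    "\<And>c p. c \<in> A \<Longrightarrow> p \<in> dom_of c \<inter> U \<Longrightarrow> lie_one_form X \<alpha> c (crd c p) = h p *s \<alpha> c (crd c p)"
    using X cf unfolding CVect_def by blast
  have "vecD (X c y) (\<alpha> c) y + \<alpha> c y v* cjac (X c) y = (h \<circ> icrd c) y *s \<alpha> c y"
    if "y \<in> crd c ` (dom_of c \<inter> U)" for y
  proof -
    have "icrd c y \<in> dom_of c \<inter> U" "crd c (icrd c y) = y"
      using that icrd_crd[OF c] by auto
    then show ?thesis using h(2)[OF c, of "icrd c y"] by (simp add: lie_one_form_eq)
  qed
  moreover have "smooth_on (crd c ` (dom_of c \<inter> U)) (h \<circ> icrd c)"
    using h(1) c unfolding smooth_fun_on_def by blast
  ultimately show ?thesis using that by blast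
qed

lemma vector_field_smooth:
  "X \<in> vector_fields A \<Longrightarrow> c \<in> A \<Longrightarrow> smooth_on (crd c ` (dom_of c \<inter> U)) (X c)"
  unfolding vector_fields_def by (rule smooth_on_subset[OF fields_smooth image_mono[OF Int_lower1]])

text \<open>Differentiating \<alpha>(Y) = 0 along X gives (L_X \<alpha>)(Y) + \<alpha>([X, Y]) = 0,
  and the first term is f \<alpha>(Y) = 0.\<close>

lemma lie_vec_in_TVect:
  assumes X: "X \<in> CVect A n \<xi>" and Y: "Y \<in> carrier TV"
  shows "lie_vec X Y \<in> carrier TV"
proof -
  have Yv: "Y \<in> vector_fields A" using Y unfolding TVect_iff by blast
  have "cdot (\<alpha> c x) (lie_vec X Y c x) = 0"
    if cf: "is_cform U \<alpha>" and c: "c \<in> A" and x: "x \<in> crd c ` (dom_of c \<inter> U)" for U \<alpha> c x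
  proof -
    let ?S = "crd c ` (dom_of c \<inter> U)"
    note S = cform(2)[OF cf c] x
    note a = cform(4)[OF cf c] and Ys = vector_field_smooth[OF Yv c, of U]
    obtain f where f: "\<And>y. y \<in> ?S \<Longrightarrow> vecD (X c y) (\<alpha> c) y + \<alpha> c y v* cjac (X c) y = f y *s \<alpha> c y"
      using CVect_chart[OF X cf c] by metis
    have "ddir (X c x) (\<lambda>y. cdot (\<alpha> c y) (Y c y)) x = ddir (X c x) (\<lambda>y. 0) x"
      by (rule ddir_cong[OF S TV_tangent[OF Y cf c] smooth_on_vec_ops(1)[OF S(1) a Ys]])
    then have z: "cdot (vecD (X c x) (\<alpha> c) x) (Y c x) + cdot (\<alpha> c x) (vecD (X c x) (Y c) x) = 0"
      by (simp add: ddir_cdot[OF S a Ys] ddir_simps(1)[OF S])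
    have "cdot (vecD (X c x) (\<alpha> c) x + \<alpha> c x v* cjac (X c) x) (Y c x) = 0"
      unfolding f[OF x] by (simp add: TV_tangent[OF Y cf c x])
    then have "cdot (vecD (X c x) (\<alpha> c) x) (Y c x) + cdot (\<alpha> c x) (cjac (X c) x *v Y c x) = 0"
      by (simp only: cdot_simps cdot_mult_vec)
    with z have "cdot (\<alpha> c x) (vecD (X c x) (Y c) x) = cdot (\<alpha> c x) (cjac (X c) x *v Y c x)"
      by (metis add_left_imp_eq)
    then show ?thesis unfolding lie_vec_eq cdot_simps by simp
  qed
  then show ?thesis unfolding TVect_iff using lie_vec_in_vector_fields[OF CVect_field[OF X] Yv] by blast
qed

text \<open>Near a point w = \<alpha> \<and> b with b smooth, and L_X (\<alpha> \<and> b) = f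
  \<alpha> \<and> b + \<alpha> \<and> L_X b again contains the factor \<alpha>.\<close>

lemma lie_two_form_in_Omega20:
  assumes X: "X \<in> CVect A n \<xi>" and w: "w \<in> carrier OM"
  shows "lie_two_form X w \<in> carrier OM"
proof -
  note Xv = CVect_field[OF X]
  have w2: "w \<in> two_forms A" using w unfolding Omega20_iff by blast
  have "cdot (cvec u) (lie_two_form X w c x *v cvec v) = 0"
    if c: "c \<in> A" and i: "x \<in> img_of c" and uv: "u \<in> \<xi> c x" "v \<in> \<xi> c x" for c x u v
  proof -
    let ?\<alpha> = "snd (pick (icrd c x))" and ?S = "crd c ` (dom_of c \<inter> fst (pick (icrd c x)))"
    note cf = pick(1)[of "icrd c x"] and x = pick_point[OF c i]
    note S = cform(2)[OF cf c] x
    note a = cform(4)[OF cf c] and v4 = smooth_vol(4)[OF cf c]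
    obtain f where f: "smooth_on ?S f" "\<And>y. y \<in> ?S \<Longrightarrow> vecD (X c y) (?\<alpha> c) y + ?\<alpha> c y v* cjac (X c) y = f y *s ?\<alpha> c y"
      using CVect_chart[OF X cf c] by metis
    note Xs = vector_field_smooth[OF Xv c, of "fst (pick (icrd c x))"]
    define b where "b = (\<lambda>y. (matrix_inv (ext_d (?\<alpha> c) y + outer (?\<alpha> c y) (?\<alpha> c y)) *v ?\<alpha> c y) v* w c y)"
    have ws: "smooth_on ?S (w c)"
      by (rule smooth_on_subset[OF fields_smooth[OF OM_field[OF w] c] image_mono[OF Int_lower1]])
    have B: "smooth_on ?S (\<lambda>y. matrix_inv (ext_d (?\<alpha> c) y + outer (?\<alpha> c y) (?\<alpha> c y)))"
      by (rule smooth_on_matrix_inv[OF S(1) v4 cform(7)[OF cf c, unfolded vol_def]])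
    have b: "smooth_on ?S b"
      unfolding b_def by (rule smooth_on_vec_ops(3)[OF S(1) ws smooth_on_vec_ops(2)[OF S(1) B a]])
    have dec: "w c y = outer (?\<alpha> c y) (b y) - outer (b y) (?\<alpha> c y)" if "y \<in> ?S" for y
      unfolding b_def by (rule tangent_vec_props(3)[OF w cf c that])
    note ab = smooth_on_vec_ops(5)[OF S(1) a b] and ba = smooth_on_vec_ops(5)[OF S(1) b a]
    have "matD (X c x) (w c) x = matD (X c x) (\<lambda>y. outer (?\<alpha> c y) (b y) - outer (b y) (?\<alpha> c y)) x"
      by (rule matD_eq_on[OF S dec ws])
    also have "\<dots> = matD (X c x) (\<lambda>y. outer (?\<alpha> c y) (b y)) x - matD (X c x) (\<lambda>y. outer (b y) (?\<alpha> c y)) x"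
      by (rule matD_add_diff(2)[OF S ab ba])
    finally have m: "matD (X c x) (w c) x = matD (X c x) (\<lambda>y. outer (?\<alpha> c y) (b y)) x - matD (X c x) (\<lambda>y. outer (b y) (?\<alpha> c y)) x" .
    have ld: "C ** (P - Q) = C ** P - C ** Q" for P Q C :: "complex^'d^'d"
      by (simp add: vec_eq_iff matrix_matrix_mult_def algebra_simps sum_subtractf)
    have "lie_two_form X w c x =
      (matD (X c x) (\<lambda>y. outer (?\<alpha> c y) (b y)) x + transpose (cjac (X c) x) ** outer (?\<alpha> c x) (b x) + outer (?\<alpha> c x) (b x) ** cjac (X c) x)
      - (matD (X c x) (\<lambda>y. outer (b y) (?\<alpha> c y)) x + transpose (cjac (X c) x) ** outer (b x) (?\<alpha> c x) + outer (b x) (?\<alpha> c x) ** cjac (X c) x)"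
      unfolding lie_two_form_eq m dec[OF x] by (simp add: ld matrix_rdistribs)
    also have "matD (X c x) (\<lambda>y. outer (?\<alpha> c y) (b y)) x + transpose (cjac (X c) x) ** outer (?\<alpha> c x) (b x) + outer (?\<alpha> c x) (b x) ** cjac (X c) x
      = outer (vecD (X c x) (?\<alpha> c) x + ?\<alpha> c x v* cjac (X c) x) (b x) + outer (?\<alpha> c x) (vecD (X c x) b x + b x v* cjac (X c) x)"
      by (rule lie_outer[OF S Xs a f a b])
    also have "matD (X c x) (\<lambda>y. outer (b y) (?\<alpha> c y)) x + transpose (cjac (X c) x) ** outer (b x) (?\<alpha> c x) + outer (b x) (?\<alpha> c x) ** cjac (X c) x
      = outer (vecD (X c x) b x + b x v* cjac (X c) x) (?\<alpha> c x) + outer (b x) (vecD (X c x) (?\<alpha> c) x + ?\<alpha> c x v* cjac (X c) x)"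
      by (rule lie_outer[OF S Xs a f b a])
    finally have L: "lie_two_form X w c x = outer (f x *s ?\<alpha> c x) (b x) + outer (?\<alpha> c x) (vecD (X c x) b x + b x v* cjac (X c) x)
       - (outer (vecD (X c x) b x + b x v* cjac (X c) x) (?\<alpha> c x) + outer (b x) (f x *s ?\<alpha> c x))"
      unfolding f(2)[OF x] .
    have k: "cdot (?\<alpha> c x) (cvec u) = 0" "cdot (?\<alpha> c x) (cvec v) = 0"
      using cform(6)[OF cf c x] uv by blast+
    show ?thesis
      unfolding L by (simp add: matrix_vector_mult_diff_rdistrib matrix_vector_mult_add_rdistrib bilinear_outer k)
  qed
  then show ?thesis unfolding Omega20_iff using lie_two_form_in_two_forms[OF Xv w2] by blast
qed

text \<open>The Lie derivative of w \<otimes> \<mu> as an operator on w: the derivative of \<mu> is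
  a multiple of \<mu>, and the multiplier is moved across to w.\<close>

definition "lie_op X w c x = lie_two_form X w c x + mscale (lie_density \<Lambda> X \<mu> c x / \<mu> c x) (w c x)"

lemma Phi_equivariant:
  assumes X: "X \<in> CVect A n \<xi>" and Y: "Y \<in> carrier TV"
  shows "Phi (lie_vec X Y) = lie_op X (Phi Y)"
proof (intro ext)
  fix c x
  note Xv = CVect_field[OF X]
  have Yv: "Y \<in> vector_fields A" using Y unfolding TVect_iff by blast
  show "Phi (lie_vec X Y) c x = lie_op X (Phi Y) c x"
  proof (cases "c \<in> A \<and> x \<in> img_of c")
    case True
    then have c: "c \<in> A" and i: "x \<in> img_of c" by (rule conjunct1, rule conjunct2)
    let ?\<alpha> = "snd (pick (icrd c x))" and ?U = "fst (pick (icrd c x))"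
    let ?S = "crd c ` (dom_of c \<inter> ?U)" and ?T = "cjac (X c) x"
    note cf = pick(1)[of "icrd c x"] and x = pick_point[OF c i]
    note S = cform(2)[OF cf c] x
    note a = cform(4)[OF cf c] and v = smooth_vol[OF cf c]
    note Xs = vector_field_smooth[OF Xv c, of ?U] and Ys = vector_field_smooth[OF Yv c, of ?U]
    obtain f where f: "smooth_on ?S f" "\<And>y. y \<in> ?S \<Longrightarrow> vecD (X c y) (?\<alpha> c) y + ?\<alpha> c y v* cjac (X c) y = f y *s ?\<alpha> c y"
      using CVect_chart[OF X cf c] by metis
    define h where "h = (\<lambda>y. weight ?\<alpha> c y / \<mu> c y)"
    define \<kappa> where "\<kappa> = (\<lambda>y. kappa (?\<alpha> c y) (ext_d (?\<alpha> c) y) (Y c y))"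
    note sp = smooth_phi[OF cf c Ys]
    have h: "smooth_on ?S h" unfolding h_def by (rule sp(3))
    have \<kappa>: "smooth_on ?S \<kappa>" unfolding \<kappa>_def by (rule sp(2))
    have P: "Phi Y c y = mscale (h y) (\<kappa> y)" if "y \<in> ?S" for y
      unfolding Phi_eq[OF Y cf c that] phi_def h_def \<kappa>_def ..
    have Ps: "smooth_on ?S (Phi Y c)"
      by (rule smooth_on_cong[OF S(1) P[symmetric] smooth_on_vec_ops(6)[OF S(1) h \<kappa>]])
    have mP: "matD (X c x) (Phi Y c) x = mscale (ddir (X c x) h x) (\<kappa> x) + mscale (h x) (matD (X c x) \<kappa> x)"
    proof -
      have "matD (X c x) (Phi Y c) x = matD (X c x) (\<lambda>y. mscale (h y) (\<kappa> y)) x"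
        by (rule matD_eq_on[OF S P Ps])
      also have "\<dots> = mscale (ddir (X c x) h x) (\<kappa> x) + mscale (h x) (matD (X c x) \<kappa> x)"
        by (rule matD_mscale[OF S h \<kappa>])
      finally show ?thesis .
    qed
    have m0: "\<mu> c y \<noteq> 0" if "y \<in> ?S" for y using mu_nonzero[OF c] that by blast
    \<comment> \<open>The logarithmic derivative of \<open>weight\<close>. As dim + 1 = 2 (n + 1),
      the exponent -1/(n+1) reduces the coefficient of f to -2 and leaves 2/(n+1), that is
      \<open>- \<Lambda>\<close>, for the trace.\<close>
    have E: "ddir (X c x) (weight ?\<alpha> c) x = (- 2 * f x - of_real \<Lambda> * trace ?T) * weight ?\<alpha> c x"
    proof -
      have "ddir (X c x) (weight ?\<alpha> c) x
          = of_real (- (1 / (real n + 1))) * weight ?\<alpha> c x * ddir (X c x) (vol ?\<alpha> c) x / vol ?\<alpha> c x"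
        unfolding weight_def[abs_def]
        by (rule ddir_abs_powr[OF S(1) v(1) cform(8)[OF cf c] cform(7)[OF cf c] x])
      moreover have "ddir (X c x) (vol ?\<alpha> c) x = ((of_nat CARD('d) + 1) * f x - 2 * trace ?T) * vol ?\<alpha> c x"
        unfolding vol_def[abs_def]
        by (rule ddir_contact_volume[OF S Xs a f odd_dim cform(7)[OF cf c x, unfolded vol_def]])
      ultimately have e: "ddir (X c x) (weight ?\<alpha> c) x
          = of_real (- (1 / (real n + 1))) * ((of_nat CARD('d) + 1) * f x - 2 * trace ?T) * weight ?\<alpha> c x"
        using cform(7)[OF cf c x] by simp
      have "complex_of_real (- (1 / (real n + 1))) * ((of_nat CARD('d) + 1) * f x - 2 * trace ?T)
          = - 2 * f x - of_real \<Lambda> * trace ?T"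
      proof -
        have n1: "complex_of_nat n + 1 \<noteq> 0" by (metis of_nat_Suc of_nat_eq_0_iff add.commute nat.distinct(1))
        have "complex_of_nat CARD('d) + 1 = 2 * (of_nat n + 1)" by (simp add: dim)
        then show ?thesis using n1 by (simp add: field_simps)
      qed
      then show ?thesis unfolding e by simp
    qed
    \<comment> \<open>The derivative of h comes from the product rule for \<open>weight\<close> = h
      \<mu>; the divergence term in the Lie derivative of \<mu> cancels that of
      \<open>weight\<close>.\<close>
    have "ddir (X c x) (weight ?\<alpha> c) x = ddir (X c x) (\<lambda>y. h y * \<mu> c y) x"
      by (rule ddir_cong[OF S _ v(2)]) (simp add: h_def m0)
    also have "\<dots> = h x * ddir (X c x) (\<mu> c) x + ddir (X c x) h x * \<mu> c x"
      by (rule ddir_simps(4)[OF S h v(3)])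
    finally have "ddir (X c x) h x * \<mu> c x + h x * (ddir (X c x) (\<mu> c) x + of_real \<Lambda> * trace ?T * \<mu> c x) = - 2 * f x * (h x * \<mu> c x)"
      unfolding E using m0[OF x] by (simp add: h_def field_simps)
    \<comment> \<open>Only -2f is left for the coefficient h, and it cancels the 2f that
      \<open>lie_kappa\<close> produces.\<close>
    then have H: "ddir (X c x) h x + lie_density \<Lambda> X \<mu> c x / \<mu> c x * h x = - 2 * f x * h x"
      unfolding lie_density_eq using m0[OF x] by (simp add: field_simps)
    let ?K = "\<kappa> x" and ?Z = "kappa (?\<alpha> c x) (ext_d (?\<alpha> c) x) (lie_vec X Y c x)"
    have LK: "matD (X c x) \<kappa> x + transpose ?T ** ?K + ?K ** ?T = mscale (2 * f x) ?K + ?Z"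
      unfolding \<kappa>_def lie_vec_eq by (rule lie_kappa[OF S Xs a f Ys TV_tangent[OF Y cf c x]])
    have "lie_op X (Phi Y) c x = mscale (ddir (X c x) h x + lie_density \<Lambda> X \<mu> c x / \<mu> c x * h x) ?K
        + mscale (h x) (matD (X c x) \<kappa> x + transpose ?T ** ?K + ?K ** ?T)"
      unfolding lie_op_def lie_two_form_eq mP P[OF x] mscale_mult by (simp add: mscale_simps)
    also have "\<dots> = mscale (h x) ?Z"
      unfolding H LK by (simp add: vec_eq_iff algebra_simps)
    also have "\<dots> = Phi (lie_vec X Y) c x"
      unfolding Phi_eq[OF lie_vec_in_TVect[OF X Y] cf c x] phi_def h_def ..
    finally show ?thesis by (rule sym)
  next
    case False
    then have o: "c \<notin> A \<or> x \<notin> img_of c" by (simp only: de_Morgan_conj)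
    have z: "Phi Y c x = 0" "Phi (lie_vec X Y) c x = 0" using False unfolding Phi_def by (simp_all only: if_False)
    have "X c x = 0" using fields_outside[OF Xv[unfolded vector_fields_def] o] .
    then show ?thesis unfolding lie_op_def lie_two_form_eq z by (simp add: matrix_zero_mult) (simp add: vec_eq_iff)
  qed
qed

section \<open>The module of 2-forms and the coordinate of a density\<close>

lemma Omega20_add: "w \<oplus>\<^bsub>OM\<^esub> w' = (\<lambda>c x. w c x + w' c x)" and Omega20_zero: "\<zero>\<^bsub>OM\<^esub> = (\<lambda>c x. 0)"
  and Omega20_smult: "r \<odot>\<^bsub>OM\<^esub> w = (\<lambda>c x. mscale (r (icrd c x)) (w c x))"
  by (simp_all add: Omega20_def mscale_def)

lemma bilin_law_ops:
  fixes w w' v v' :: "complex^'d^'d"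
  shows "bilin_law J w w' \<Longrightarrow> bilin_law J v v' \<Longrightarrow> bilin_law J (w + v) (w' + v')"
    "bilin_law J w w' \<Longrightarrow> bilin_law J (mscale k w) (mscale k w')"
  by (simp_all add: bilin_law_def matrix_add_ldistrib matrix_rdistribs mscale_mult)

lemma Omega20_add_closed:
  assumes w: "w \<in> carrier OM" and v: "v \<in> carrier OM"
  shows "(\<lambda>c x. w c x + v c x) \<in> carrier OM"
proof -
  note wf = OM_field[OF w] and vf = OM_field[OF v]
  have "(\<lambda>c x. w c x + v c x) \<in> fields A bilin_law"
  proof (rule fieldsI)
    show "smooth_on (img_of c) (\<lambda>x. w c x + v c x)" if "c \<in> A" for c
      by (rule smooth_on_add[OF open_img[OF that] fields_smooth[OF wf that] fields_smooth[OF vf that]])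
    show "bilin_law (jac c c' p) (w c (crd c p) + v c (crd c p)) (w c' (crd c' p) + v c' (crd c' p))"
      if "c \<in> A" "c' \<in> A" "p \<in> dom_of c" "p \<in> dom_of c'" for c c' p
      by (rule bilin_law_ops(1)) (use wf vf that in \<open>unfold fields_def field_on_def, blast\<close>)+
    show "w c x + v c x = 0" if "c \<notin> A \<or> x \<notin> img_of c" for c x
      using fields_outside[OF wf that] fields_outside[OF vf that] by simp
  qed
  moreover have "(w c x + v c x) $ i $ j = - (w c x + v c x) $ j $ i" for c x i j
  proof -
    have "w c x $ i $ j = - w c x $ j $ i" "v c x $ i $ j = - v c x $ j $ i"
      using w v unfolding Omega20_iff two_forms_def by blast+
    then show ?thesis by (simp only: vector_add_component minus_add_distrib)
  qed
  moreover have "cdot (cvec s) ((w c x + v c x) *v cvec t) = 0"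
    if "c \<in> A" "x \<in> img_of c" "s \<in> \<xi> c x" "t \<in> \<xi> c x" for c x s t
  proof -
    have "cdot (cvec s) (w c x *v cvec t) = 0" "cdot (cvec s) (v c x *v cvec t) = 0"
      using w v that unfolding Omega20_iff by blast+
    then show ?thesis by (simp add: matrix_vector_mult_add_rdistrib)
  qed
  ultimately show ?thesis unfolding Omega20_iff two_forms_def by blast
qed

lemma Omega20_mscale_closed:
  assumes r: "r \<in> carrier R" and w: "w \<in> carrier OM"
  shows "(\<lambda>c x. mscale (r (icrd c x)) (w c x)) \<in> carrier OM"
proof -
  note wf = OM_field[OF w]
  have "(\<lambda>c x. mscale (r (icrd c x)) (w c x)) \<in> fields A bilin_law"
  proof (rule fieldsI)
    show "smooth_on (img_of c) (\<lambda>x. mscale (r (icrd c x)) (w c x))" if "c \<in> A" for c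
      using r that unfolding smooth_functions_iff
      by (intro smooth_on_vec_ops(6)[OF open_img[OF that] _ fields_smooth[OF wf that]]) blast
    show "bilin_law (jac c c' p) (mscale (r (icrd c (crd c p))) (w c (crd c p))) (mscale (r (icrd c' (crd c' p))) (w c' (crd c' p)))"
      if "c \<in> A" "c' \<in> A" "p \<in> dom_of c" "p \<in> dom_of c'" for c c' p
    proof -
      have "bilin_law (jac c c' p) (w c (crd c p)) (w c' (crd c' p))"
        using wf that unfolding fields_def field_on_def by blast
      then show ?thesis unfolding icrd_crd[OF that(1,3)] icrd_crd[OF that(2,4)] by (rule bilin_law_ops(2))
    qed
    show "mscale (r (icrd c x)) (w c x) = 0" if "c \<notin> A \<or> x \<notin> img_of c" for c x
      using fields_outside[OF wf that] by (simp add: vec_eq_iff)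
  qed
  moreover have "mscale (r (icrd c x)) (w c x) $ i $ j = - mscale (r (icrd c x)) (w c x) $ j $ i" for c x i j
  proof -
    have "w c x $ i $ j = - w c x $ j $ i" using w unfolding Omega20_iff two_forms_def by blast
    then show ?thesis by (simp only: mscale_nth mult_minus_right)
  qed
  moreover have "cdot (cvec s) (mscale (r (icrd c x)) (w c x) *v cvec t) = 0"
    if "c \<in> A" "x \<in> img_of c" "s \<in> \<xi> c x" "t \<in> \<xi> c x" for c x s t
  proof -
    have "cdot (cvec s) (w c x *v cvec t) = 0" using w that unfolding Omega20_iff by blast
    then show ?thesis by (simp add: mscale_mult_vec)
  qed
  ultimately show ?thesis unfolding Omega20_iff two_forms_def by blast
qed

lemma const_in_R: "(\<lambda>_. z) \<in> carrier R"
  unfolding smooth_functions_iff using smooth_on_const[OF open_img] by blast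

lemma Omega20_zero_closed: "(\<lambda>c x. 0) \<in> carrier OM"
proof -
  have "(\<lambda>c x. 0) \<in> fields A bilin_law"
    by (rule fieldsI) (use smooth_on_const[OF open_img] in \<open>auto simp: bilin_law_def matrix_zero_mult\<close>)
  then show ?thesis unfolding Omega20_iff two_forms_def by simp
qed

lemma module_Omega20: "Module.module R OM"
proof (rule moduleI[OF cring_smooth_functions])
  show "abelian_group OM"
  proof (rule abelian_groupI)
    fix w assume w: "w \<in> carrier OM"
    have "(\<lambda>c x. mscale (- 1) (w c x)) \<in> carrier OM"
      using Omega20_mscale_closed[OF const_in_R w] .
    moreover have "(\<lambda>c x. mscale (- 1) (w c x)) \<oplus>\<^bsub>OM\<^esub> w = \<zero>\<^bsub>OM\<^esub>"
      unfolding Omega20_add Omega20_zero by (simp add: fun_eq_iff vec_eq_iff)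
    ultimately show "\<exists>v\<in>carrier OM. v \<oplus>\<^bsub>OM\<^esub> w = \<zero>\<^bsub>OM\<^esub>" by blast
  next
    show "w \<oplus>\<^bsub>OM\<^esub> v \<in> carrier OM" if "w \<in> carrier OM" "v \<in> carrier OM" for w v
      unfolding Omega20_add by (rule Omega20_add_closed[OF that])
    show "\<zero>\<^bsub>OM\<^esub> \<in> carrier OM" unfolding Omega20_zero by (rule Omega20_zero_closed)
  qed (simp_all add: Omega20_add Omega20_zero add_ac)
  show "r \<odot>\<^bsub>OM\<^esub> w \<in> carrier OM" if "r \<in> carrier R" "w \<in> carrier OM" for r w
    unfolding Omega20_smult by (rule Omega20_mscale_closed[OF that])
qed (simp_all add: Omega20_smult Omega20_add smooth_functions_def mscale_simps)

text \<open>The function f / \<mu>. Numerator and denominator change by the same factor between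
  charts, so the chart chosen at p is immaterial for densities of degree
  \<open>\<Lambda>\<close>.\<close>

definition coord :: "('m, 'd, complex) field \<Rightarrow> 'm \<Rightarrow> complex" where
  "coord f p = (let c = SOME c. c \<in> A \<and> p \<in> dom_of c in f c (crd c p) / \<mu> c (crd c p))"

lemma coord_eq:
  assumes f: "f \<in> densities A \<Lambda>" and c: "c \<in> A" and x: "x \<in> img_of c"
  shows "coord f (icrd c x) = f c x / \<mu> c x"
proof -
  let ?p = "icrd c x"
  define b where "b = (SOME c. c \<in> A \<and> ?p \<in> dom_of c)"
  have "\<exists>c. c \<in> A \<and> ?p \<in> dom_of c" using chart_cover by metis
  from someI_ex[OF this] have b: "b \<in> A" "?p \<in> dom_of b" unfolding b_def by blast+
  have pc: "?p \<in> dom_of c" "crd c ?p = x" using icrd_in_dom[OF x] crd_icrd[OF x] by blast+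
  let ?r = "complex_of_real (\<bar>det (jac b c ?p)\<bar> powr \<Lambda>)"
  have law: "g b (crd b ?p) = ?r * g c x" if "g \<in> densities A \<Lambda>" for g
  proof -
    have "density_law \<Lambda> (jac b c ?p) (g b (crd b ?p)) (g c (crd c ?p))"
      using that b c pc(1) unfolding densities_def fields_def field_on_def by blast
    then show ?thesis unfolding density_law_def pc(2) .
  qed
  have "?r \<noteq> 0" using det_jac_nonzero[OF b(1) c b(2) pc(1)] by (auto simp: det_cmat)
  then have "f b (crd b ?p) / \<mu> b (crd b ?p) = f c x / \<mu> c x"
    unfolding law[OF f] law[OF mu] by simp
  then show ?thesis by (simp only: coord_def Let_def b_def)
qed

end

section \<open>The isomorphism\<close>

context contact_manifold
begin

lemma density_field: "f \<in> densities A \<Lambda> \<Longrightarrow> f \<in> fields A (density_law \<Lambda>)"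
  by (simp only: densities_def)

lemma coord_in_R:
  assumes f: "f \<in> densities A \<Lambda>"
  shows "coord f \<in> carrier R"
  unfolding smooth_functions_iff
proof
  fix c assume c: "c \<in> A"
  show "smooth_on (img_of c) (\<lambda>x. coord f (icrd c x))"
    by (rule smooth_on_cong[OF open_img[OF c] coord_eq[OF f c, symmetric]], assumption,
        rule smooth_on_divide[OF open_img[OF c] fields_smooth[OF density_field[OF f] c]
          fields_smooth[OF density_field[OF mu] c] mu_nonzero[OF c]])
qed

lemma Density_ops: "carrier DN = densities A \<Lambda>" "f \<oplus>\<^bsub>DN\<^esub> g = (\<lambda>c x. f c x + g c x)"
  "r \<odot>\<^bsub>DN\<^esub> f = (\<lambda>c x. r (icrd c x) * f c x)"
  by (simp_all add: Density_def)

lemma R_ops: "f \<oplus>\<^bsub>R\<^esub> g = (\<lambda>p. f p + g p)" "f \<otimes>\<^bsub>R\<^esub> g = (\<lambda>p. f p * g p)" "\<one>\<^bsub>R\<^esub> = (\<lambda>_. 1)"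
  by (simp_all add: smooth_functions_def)

lemma Density_add_closed:
  assumes f: "f \<in> densities A \<Lambda>" and g: "g \<in> densities A \<Lambda>"
  shows "(\<lambda>c x. f c x + g c x) \<in> densities A \<Lambda>"
  unfolding densities_def
proof (rule fieldsI)
  note ff = density_field[OF f] and gf = density_field[OF g]
  show "smooth_on (img_of c) (\<lambda>x. f c x + g c x)" if "c \<in> A" for c
    by (rule smooth_on_add[OF open_img[OF that] fields_smooth[OF ff that] fields_smooth[OF gf that]])
  show "density_law \<Lambda> (jac c c' p) (f c (crd c p) + g c (crd c p)) (f c' (crd c' p) + g c' (crd c' p))"
    if "c \<in> A" "c' \<in> A" "p \<in> dom_of c" "p \<in> dom_of c'" for c c' p
  proof -
    have "density_law \<Lambda> (jac c c' p) (f c (crd c p)) (f c' (crd c' p))"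
      "density_law \<Lambda> (jac c c' p) (g c (crd c p)) (g c' (crd c' p))"
      using ff gf that unfolding fields_def field_on_def by blast+
    then show ?thesis unfolding density_law_def by (simp add: distrib_left)
  qed
  show "f c x + g c x = 0" if "c \<notin> A \<or> x \<notin> img_of c" for c x
    using fields_outside[OF ff that] fields_outside[OF gf that] by simp
qed

lemma Density_smult_closed:
  assumes r: "r \<in> carrier R" and f: "f \<in> densities A \<Lambda>"
  shows "(\<lambda>c x. r (icrd c x) * f c x) \<in> densities A \<Lambda>"
  unfolding densities_def
proof (rule fieldsI)
  note ff = density_field[OF f]
  show "smooth_on (img_of c) (\<lambda>x. r (icrd c x) * f c x)" if "c \<in> A" for c
    using r that unfolding smooth_functions_iff
    by (intro smooth_on_mult[OF open_img[OF that] _ fields_smooth[OF ff that]]) blast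
  show "density_law \<Lambda> (jac c c' p) (r (icrd c (crd c p)) * f c (crd c p)) (r (icrd c' (crd c' p)) * f c' (crd c' p))"
    if "c \<in> A" "c' \<in> A" "p \<in> dom_of c" "p \<in> dom_of c'" for c c' p
  proof -
    have "density_law \<Lambda> (jac c c' p) (f c (crd c p)) (f c' (crd c' p))"
      using ff that unfolding fields_def field_on_def by blast
    then show ?thesis unfolding icrd_crd[OF that(1,3)] icrd_crd[OF that(2,4)] density_law_def by simp
  qed
  show "r (icrd c x) * f c x = 0" if "c \<notin> A \<or> x \<notin> img_of c" for c x
    using fields_outside[OF ff that] by simp
qed

lemma point_coords: obtains c where "c \<in> A" "crd c p \<in> img_of c" "icrd c (crd c p) = p"
proof -
  obtain c where "c \<in> A" "p \<in> dom_of c" by (rule chart_cover)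
  then show ?thesis using that[of c] icrd_crd by blast
qed

lemma coord_props:
  assumes f: "f \<in> densities A \<Lambda>"
  shows "(\<lambda>c x. coord f (icrd c x) * \<mu> c x) = f" "coord \<mu> = (\<lambda>_. 1)"
    "g \<in> densities A \<Lambda> \<Longrightarrow> coord (\<lambda>c x. f c x + g c x) = (\<lambda>p. coord f p + coord g p)"
    "r \<in> carrier R \<Longrightarrow> coord (\<lambda>c x. r (icrd c x) * f c x) = (\<lambda>p. r p * coord f p)"
proof -
  show "(\<lambda>c x. coord f (icrd c x) * \<mu> c x) = f"
  proof (intro ext)
    fix c x
    show "coord f (icrd c x) * \<mu> c x = f c x"
    proof (cases "c \<in> A \<and> x \<in> img_of c")
      case True
      then have c: "c \<in> A" and x: "x \<in> img_of c" by (rule conjunct1, rule conjunct2)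
      show ?thesis using coord_eq[OF f c x] mu_nonzero[OF c x] by simp
    next
      case False
      then have o: "c \<notin> A \<or> x \<notin> img_of c" by (simp only: de_Morgan_conj)
      show ?thesis using fields_outside[OF density_field[OF f] o] fields_outside[OF density_field[OF mu] o] by simp
    qed
  qed
  show "coord \<mu> = (\<lambda>_. 1)"
  proof
    fix p
    obtain c where c: "c \<in> A" "crd c p \<in> img_of c" "icrd c (crd c p) = p" by (rule point_coords)
    show "coord \<mu> p = 1"
      unfolding coord_eq[OF mu c(1,2), unfolded c(3)] by (rule divide_self[OF mu_nonzero[OF c(1,2)]])
  qed
  show "coord (\<lambda>c x. f c x + g c x) = (\<lambda>p. coord f p + coord g p)" if g: "g \<in> densities A \<Lambda>"
  proof
    fix p
    obtain c where c: "c \<in> A" "crd c p \<in> img_of c" "icrd c (crd c p) = p" by (rule point_coords)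
    show "coord (\<lambda>c x. f c x + g c x) p = coord f p + coord g p"
      using coord_eq[OF Density_add_closed[OF f g] c(1,2)] coord_eq[OF f c(1,2)] coord_eq[OF g c(1,2)]
      by (simp only: c(3) add_divide_distrib)
  qed
  show "coord (\<lambda>c x. r (icrd c x) * f c x) = (\<lambda>p. r p * coord f p)" if r: "r \<in> carrier R"
  proof
    fix p
    obtain c where c: "c \<in> A" "crd c p \<in> img_of c" "icrd c (crd c p) = p" by (rule point_coords)
    show "coord (\<lambda>c x. r (icrd c x) * f c x) p = r p * coord f p"
      using coord_eq[OF Density_smult_closed[OF r f] c(1,2)] coord_eq[OF f c(1,2)]
      by (simp only: c(3) times_divide_eq_right)
  qed
qed

sublocale tensor: tensor_rank_one R OM DN \<mu> coord
proof (intro tensor_rank_one.intro[OF module_Omega20] tensor_rank_one_axioms.intro, unfold Density_ops Omega20_smult R_ops)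
  show "\<mu> \<in> densities A \<Lambda>" by (rule mu)
  show "coord \<mu> = (\<lambda>_. 1)" by (rule coord_props(2)[OF mu])
  show "(\<lambda>c x. coord y (icrd c x) * \<mu> c x) = y" if "y \<in> densities A \<Lambda>" for y
    by (rule coord_props(1)[OF that])
  show "coord (\<lambda>c x. y c x + y' c x) = (\<lambda>p. coord y p + coord y' p)"
    if "y \<in> densities A \<Lambda>" "y' \<in> densities A \<Lambda>" for y y'
    by (rule coord_props(3)[OF that])
  show "coord (\<lambda>c x. r (icrd c x) * y c x) = (\<lambda>p. r p * coord y p)"
    if "r \<in> carrier R" "y \<in> densities A \<Lambda>" for r y
    by (rule coord_props(4)[OF that(2,1)])
qed (fact coord_in_R Density_add_closed Density_smult_closed)+

lemma lie_op_in:
  assumes X: "X \<in> CVect A n \<xi>" and w: "w \<in> carrier OM"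
  shows "lie_op X w \<in> carrier OM"
proof -
  have m: "lie_density \<Lambda> X \<mu> \<in> densities A \<Lambda>"
    by (rule lie_density_in_densities[OF CVect_field[OF X] mu])
  \<comment> \<open>The multiplier L_X \<mu> / \<mu> is recognized as a global smooth function, to
    which the closure rules of the module apply. Off the charts w is 0, so the value of the
    multiplier there does not matter.\<close>
  have "lie_op X w = (\<lambda>c x. lie_two_form X w c x + mscale (coord (lie_density \<Lambda> X \<mu>) (icrd c x)) (w c x))"
  proof (intro ext)
    fix c x
    show "lie_op X w c x = lie_two_form X w c x + mscale (coord (lie_density \<Lambda> X \<mu>) (icrd c x)) (w c x)"
    proof (cases "c \<in> A \<and> x \<in> img_of c")
      case True
      then have c: "c \<in> A" and x: "x \<in> img_of c" by (rule conjunct1, rule conjunct2)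
      show ?thesis unfolding lie_op_def coord_eq[OF m c x] ..
    next
      case False
      then have "w c x = 0" by (intro fields_outside[OF OM_field[OF w]]) (simp only: de_Morgan_conj)
      moreover have "mscale k (0 :: complex^'d^'d) = 0" for k by (simp add: vec_eq_iff)
      ultimately show ?thesis unfolding lie_op_def by (simp only:)
    qed
  qed
  then show ?thesis
    using Omega20_add_closed[OF lie_two_form_in_Omega20[OF X w] Omega20_mscale_closed[OF coord_in_R[OF m] w]] by (simp only:)
qed

lemma lie_op_outside:
  assumes X: "X \<in> CVect A n \<xi>" and o: "c \<notin> A \<or> x \<notin> img_of c" and w: "w c x = 0"
  shows "lie_op X w c x = 0"
proof -
  have "X c x = 0" by (rule fields_outside[OF CVect_field[OF X, unfolded vector_fields_def] o])
  moreover have "mscale k (0 :: complex^'d^'d) = 0" for k by (simp add: vec_eq_iff)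
  ultimately show ?thesis unfolding lie_op_def lie_two_form_eq by (simp add: w matrix_zero_mult)
qed

lemma lie_op_add:
  assumes X: "X \<in> CVect A n \<xi>" and w: "w \<in> carrier OM" and v: "v \<in> carrier OM"
  shows "lie_op X (\<lambda>c x. w c x + v c x) = (\<lambda>c x. lie_op X w c x + lie_op X v c x)"
proof (intro ext)
  fix c x
  show "lie_op X (\<lambda>c x. w c x + v c x) c x = lie_op X w c x + lie_op X v c x"
  proof (cases "c \<in> A \<and> x \<in> img_of c")
    case True
    then have c: "c \<in> A" and x: "x \<in> img_of c" by (rule conjunct1, rule conjunct2)
    have "matD (X c x) (\<lambda>x. w c x + v c x) x = matD (X c x) (w c) x + matD (X c x) (v c) x"
      by (rule matD_add_diff(1)[OF open_img[OF c] x fields_smooth[OF OM_field[OF w] c] fields_smooth[OF OM_field[OF v] c]])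
    then show ?thesis
      by (simp add: lie_op_def lie_two_form_eq matrix_add_ldistrib matrix_rdistribs mscale_simps)
  next
    case False
    then have o: "c \<notin> A \<or> x \<notin> img_of c" by (simp only: de_Morgan_conj)
    have z: "w c x = 0" "v c x = 0"
      by (rule fields_outside[OF OM_field[OF w] o] fields_outside[OF OM_field[OF v] o])+
    have "lie_op X (\<lambda>c x. w c x + v c x) c x = 0" by (rule lie_op_outside[OF X o]) (simp add: z)
    moreover have "lie_op X w c x = 0" by (rule lie_op_outside[OF X o]) (rule z)
    moreover have "lie_op X v c x = 0" by (rule lie_op_outside[OF X o]) (rule z)
    ultimately show ?thesis by simp
  qed
qed

text \<open>With y = r \<mu>, both sides equal r L_X w + (r L_X \<mu> / \<mu> + X(r)) w. On the left
  X(r) arises from differentiating the density, on the right from differentiating r w.\<close>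

lemma lie_op_leibniz:
  assumes X: "X \<in> CVect A n \<xi>" and w: "w \<in> carrier OM" and y: "y \<in> densities A \<Lambda>"
  shows "(\<lambda>c x. mscale (coord y (icrd c x)) (lie_two_form X w c x)
      + mscale (coord (lie_density \<Lambda> X y) (icrd c x)) (w c x))
    = lie_op X (\<lambda>c x. mscale (coord y (icrd c x)) (w c x))"
proof (intro ext)
  fix c x
  let ?rw = "\<lambda>c x. mscale (coord y (icrd c x)) (w c x)"
  show "mscale (coord y (icrd c x)) (lie_two_form X w c x) + mscale (coord (lie_density \<Lambda> X y) (icrd c x)) (w c x)
    = lie_op X ?rw c x"
  proof (cases "c \<in> A \<and> x \<in> img_of c")
    case True
    then have c: "c \<in> A" and x: "x \<in> img_of c" by (rule conjunct1, rule conjunct2)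
    note S = open_img[OF c] x
    define r where "r = (\<lambda>z. coord y (icrd c z))"
    have r: "smooth_on (img_of c) r" using coord_in_R[OF y] c unfolding smooth_functions_iff r_def by blast
    note ws = fields_smooth[OF OM_field[OF w] c] and ms = fields_smooth[OF density_field[OF mu] c]
      and ys = fields_smooth[OF density_field[OF y] c]
    have yr: "y c z = r z * \<mu> c z" for z
      using fun_cong[OF fun_cong[OF coord_props(1)[OF y]], of c z] unfolding r_def by (rule sym)
    have "ddir (X c x) (y c) x = ddir (X c x) (\<lambda>z. r z * \<mu> c z) x"
      by (rule ddir_cong[OF S yr ys])
    also have "\<dots> = r x * ddir (X c x) (\<mu> c) x + ddir (X c x) r x * \<mu> c x"
      by (rule ddir_simps(4)[OF S r ms])
    finally have "lie_density \<Lambda> X y c x = r x * lie_density \<Lambda> X \<mu> c x + ddir (X c x) r x * \<mu> c x"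
      unfolding lie_density_eq by (simp add: yr algebra_simps)
    then have l: "coord (lie_density \<Lambda> X y) (icrd c x) = r x * (lie_density \<Lambda> X \<mu> c x / \<mu> c x) + ddir (X c x) r x"
      unfolding coord_eq[OF lie_density_in_densities[OF CVect_field[OF X] y] c x]
      using mu_nonzero[OF c x] by (simp add: add_divide_distrib)
    have m: "matD (X c x) (\<lambda>z. mscale (r z) (w c z)) x = mscale (ddir (X c x) r x) (w c x) + mscale (r x) (matD (X c x) (w c) x)"
      by (rule matD_mscale[OF S r ws])
    have e: "?rw c = (\<lambda>z. mscale (r z) (w c z))" by (simp only: r_def)
    have "lie_op X ?rw c x = mscale (ddir (X c x) r x) (w c x) + mscale (r x) (lie_two_form X w c x)
        + mscale (lie_density \<Lambda> X \<mu> c x / \<mu> c x * r x) (w c x)"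
      unfolding lie_op_def lie_two_form_eq e m by (simp add: mscale_simps mscale_mult)
    also have "\<dots> = mscale (r x) (lie_two_form X w c x)
        + mscale (r x * (lie_density \<Lambda> X \<mu> c x / \<mu> c x) + ddir (X c x) r x) (w c x)"
      by (simp add: vec_eq_iff algebra_simps)
    finally show ?thesis unfolding l by (simp only: r_def)
  next
    case False
    then have o: "c \<notin> A \<or> x \<notin> img_of c" by (simp only: de_Morgan_conj)
    have z: "w c x = 0" by (rule fields_outside[OF OM_field[OF w] o])
    have z': "lie_two_form X w c x = 0"
      by (rule fields_outside[OF OM_field[OF lie_two_form_in_Omega20[OF X w]] o])
    have m: "mscale k (0 :: complex^'d^'d) = 0" for k by (simp add: vec_eq_iff)
    have "lie_op X ?rw c x = 0" by (rule lie_op_outside[OF X o]) (simp only: z m)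
    then show ?thesis by (simp only: z z' m add_0_left)
  qed
qed

lemma TVect_ops: "Y \<oplus>\<^bsub>TV\<^esub> Y' = (\<lambda>c x. Y c x + Y' c x)" "r \<odot>\<^bsub>TV\<^esub> Y = (\<lambda>c x. r (icrd c x) *s Y c x)"
  by (simp_all add: TVect_def)

lemma Phi_linear:
  "Phi (\<lambda>c x. Y c x + Y' c x) = (\<lambda>c x. Phi Y c x + Phi Y' c x)"
  "Phi (\<lambda>c x. k *s Y c x) = (\<lambda>c x. mscale k (Phi Y c x))"
proof -
  have m: "mscale k (0 :: complex^'d^'d) = 0" for k by (simp add: vec_eq_iff)
  show "Phi (\<lambda>c x. Y c x + Y' c x) = (\<lambda>c x. Phi Y c x + Phi Y' c x)"
    by (intro ext) (simp add: Phi_def phi_def kappa_linear mscale_simps)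
  show "Phi (\<lambda>c x. k *s Y c x) = (\<lambda>c x. mscale k (Phi Y c x))"
    by (intro ext) (simp add: Phi_def phi_def kappa_linear mscale_simps m mult.commute)
qed

abbreviation "act X \<equiv> tensor_leibniz R OM DN (lie_two_form X) (lie_density \<Lambda> X)"

lemma tensor_act:
  assumes X: "X \<in> CVect A n \<xi>" and w: "w \<in> carrier OM"
  shows "act X (tensor.tensor_gen w) = tensor.tensor_gen (lie_op X w)"
proof (rule tensor.tensor_gen_leibniz[OF _ _ _ _ _ w])
  show "lie_two_form X v \<in> carrier OM" if "v \<in> carrier OM" for v by (rule lie_two_form_in_Omega20[OF X that])
  show "lie_density \<Lambda> X y \<in> carrier DN" if "y \<in> carrier DN" for y
    using that unfolding Density_ops by (rule lie_density_in_densities[OF CVect_field[OF X]])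
  show "lie_op X (v \<oplus>\<^bsub>OM\<^esub> v') = lie_op X v \<oplus>\<^bsub>OM\<^esub> lie_op X v'" if "v \<in> carrier OM" "v' \<in> carrier OM" for v v'
    unfolding Omega20_add by (rule lie_op_add[OF X that])
  show "lie_op X v \<in> carrier OM" if "v \<in> carrier OM" for v by (rule lie_op_in[OF X that])
  show "coord y \<odot>\<^bsub>OM\<^esub> lie_two_form X v \<oplus>\<^bsub>OM\<^esub> coord (lie_density \<Lambda> X y) \<odot>\<^bsub>OM\<^esub> v = lie_op X (coord y \<odot>\<^bsub>OM\<^esub> v)"
    if "v \<in> carrier OM" "y \<in> carrier DN" for v y
    unfolding Omega20_add Omega20_smult by (rule lie_op_leibniz[OF X that[unfolded Density_ops]])
qed

text \<open>A composite of two bijections, Y to \<open>Phi Y\<close> and w to the class of w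
  \<otimes> \<mu>; each is additive, linear over constants and intertwines the actions, with
  \<open>lie_op\<close> in the middle.\<close>

lemma Phi_iso:
  "lie_module_iso (CVect A n \<xi>) TV lie_vec (tensor_product R OM DN) act (\<lambda>Y. tensor.tensor_gen (Phi Y))"
  unfolding lie_module_iso_def
proof (intro conjI ballI allI)
  fix X Y assume X: "X \<in> CVect A n \<xi>" and Y: "Y \<in> carrier TV"
  show "lie_vec X Y \<in> carrier TV" by (rule lie_vec_in_TVect[OF X Y])
  show "tensor.tensor_gen (Phi (lie_vec X Y)) = act X (tensor.tensor_gen (Phi Y))"
    unfolding tensor_act[OF X Phi_in_Omega20[OF Y]] Phi_equivariant[OF X Y] ..
next
  fix X C assume X: "X \<in> CVect A n \<xi>" and C: "C \<in> carrier (tensor_product R OM DN)"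
  then obtain w where w: "w \<in> carrier OM" "C = tensor.tensor_gen w" unfolding tensor.carrier_tensor by blast
  show "act X C \<in> carrier (tensor_product R OM DN)"
    unfolding w(2) tensor_act[OF X w(1)] tensor.carrier_tensor using lie_op_in[OF X w(1)] by blast
next
  show "bij_betw (\<lambda>Y. tensor.tensor_gen (Phi Y)) (carrier TV) (carrier (tensor_product R OM DN))"
    using bij_betw_trans[OF bij_Phi tensor.bij_tensor_gen] by (simp only: comp_def)
next
  fix Y Y' assume Y: "Y \<in> carrier TV" "Y' \<in> carrier TV"
  show "tensor.tensor_gen (Phi (Y \<oplus>\<^bsub>TV\<^esub> Y'))
      = tensor.tensor_gen (Phi Y) \<oplus>\<^bsub>tensor_product R OM DN\<^esub> tensor.tensor_gen (Phi Y')"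
  proof -
    have "tensor.tensor_gen (Phi Y) \<oplus>\<^bsub>tensor_product R OM DN\<^esub> tensor.tensor_gen (Phi Y')
        = tensor.tensor_gen (Phi Y \<oplus>\<^bsub>OM\<^esub> Phi Y')"
      by (rule tensor.tensor_gen_add[OF Phi_in_Omega20[OF Y(1)] Phi_in_Omega20[OF Y(2)]])
    also have "Phi Y \<oplus>\<^bsub>OM\<^esub> Phi Y' = Phi (Y \<oplus>\<^bsub>TV\<^esub> Y')"
      unfolding Omega20_add TVect_ops(1) by (rule Phi_linear(1)[symmetric])
    finally show ?thesis by (rule sym)
  qed
next
  fix z Y assume Y: "Y \<in> carrier TV"
  show "tensor.tensor_gen (Phi ((\<lambda>_. z) \<odot>\<^bsub>TV\<^esub> Y)) = (\<lambda>_. z) \<odot>\<^bsub>tensor_product R OM DN\<^esub> tensor.tensor_gen (Phi Y)"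
  proof -
    have "(\<lambda>_. z) \<odot>\<^bsub>tensor_product R OM DN\<^esub> tensor.tensor_gen (Phi Y) = tensor.tensor_gen ((\<lambda>_. z) \<odot>\<^bsub>OM\<^esub> Phi Y)"
      by (rule tensor.tensor_gen_smult[OF const_in_R Phi_in_Omega20[OF Y]])
    also have "(\<lambda>_. z) \<odot>\<^bsub>OM\<^esub> Phi Y = Phi ((\<lambda>_. z) \<odot>\<^bsub>TV\<^esub> Y)"
      unfolding Omega20_smult TVect_ops(2) by (rule Phi_linear(2)[symmetric])
    finally show ?thesis by (rule sym)
  qed
qed

end

theorem theorem4p1:
  fixes A :: "('m::{t2_space,second_countable_topology}, 'd::finite) chart set"
    and \<xi> :: "('m, 'd, (real^'d) set) field"
    and n :: nat
  assumes "n \<ge> 1"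
    and "CARD('d) = 2 * n + 1"
    and "smooth_atlas A"
    and "contact_structure A n \<xi>"
  shows "let l = - (2 / (real n + 1)); R = smooth_functions A;
             \<Omega> = Omega20 A \<xi>; F = Density A l
         in \<exists>\<Phi>. lie_module_iso (CVect A n \<xi>)
              (TVect A n \<xi>) lie_vec
              (tensor_product R \<Omega> F)
              (\<lambda>X. tensor_leibniz R \<Omega> F (lie_two_form X) (lie_density l X))
              \<Phi>"
proof -
  interpret atlas A by unfold_locales fact
  \<comment> \<open>The choice of generator affects the intermediate 2-form \<open>Phi Y\<close> but
    not the tensor \<open>Phi Y\<close> \<otimes> \<mu>, in which \<mu> cancels.\<close>
  obtain \<mu> where \<mu>: "\<mu> \<in> densities A (- (2 / (real n + 1)))" "\<And>c x. c \<in> A \<Longrightarrow> x \<in> img_of c \<Longrightarrow> \<mu> c x \<noteq> 0"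
    using positive_density_exists[of "- (2 / (real n + 1))"] by blast
  interpret contact_manifold A \<xi> n \<mu>
    by unfold_locales (fact assms \<mu>)+
  show ?thesis unfolding Let_def by (rule exI, rule Phi_iso)
qed

end
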